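(* Let $(H,W,\mu)$ be an abstract Wiener space and let $\{X_n\}_{n\geq 1}$ be a sequence of independent and identically distributed random variables taking values in $W$. Assume: (1) The law of the $X_n$'s is absolutely continuous with respect to $\mu$ with a density $f\in\mathcal{L}^2(W,\mu)$. (2) For every $h\in H$, $\mathrm{Var}(\langle X_n,h\rangle)\geq |h|_H^2$, and for some orthonormal basis $\{e_j\}_{j\geq 1}$ of $H$, $$\sum_{j\geq 1}[\mathrm{Var}(\langle X_n,e_j\rangle)-1]<+\infty.$$ (3) For some orthonormal basis $\{e_j\}_{j\geq 1}$ of $H$, $$\sum_{i,j\geq 1}[\mathrm{Cov}(\langle X_n,e_i\rangle,\langle X_n,e_j\rangle)-\delta_{ij}]^2<1.$$ Set $g_2:=f_2-\frac{f_1^{\otimes 2}}{2}$, where $f_1\in H$ and $f_2\in H^{\hat\otimes 2}$ are the first and second order kernels in the Wiener-Itô chaos decomposition $f=\sum_{k\geq 0}\delta^k(f_k)$. Then $$\xi=\sum_{k\geq 0}\frac{\delta^{2k}(g_2^{\otimes k})}{k!}$$ is the square integrable density (with respect to $\mu$) of a Gaussian measure on $W$ with characteristic functional given by $$\int_W e^{i\langle w,h\rangle}\xi(w)\,d\mu(w)=\exp\Big\{-\langle g_2,h^{\otimes 2}\rangle_{H^{\otimes 2}}-\frac{|h|_H^2}{2}\Big\},\qquad h\in H.$$ Moreover, for any $n\in\mathbb{N}$, if the $W$-valued random variables $\mathcal{X}_1,\dots,\mathcal{X}_n$ are independent with law $\xi\,d\mu$, then $$\frac{\mathcal{X}_1+\cdots+\mathcal{X}_n}{\sqrt{n}}\quad\text{has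 law}\quad \xi\,d\mu.$$
   Context: Abstract Wiener space: $(H,\langle\cdot,\cdot\rangle_H)$ is a separable (real) Hilbert space with norm $|\cdot|_H$, continuously and densely embedded in the Banach space $(W,|\cdot|_W)$, and $\mu$ is a Gaussian probability measure on the Borel sets of $W$ such that $\int_W e^{i\langle w,\varphi\rangle}d\mu(w)=e^{-\frac12|\varphi|_H^2}$ for all $\varphi\in W^*$. Here $W^*\subset H$ is the dual space of $W$, which is dense in $H$, and $\langle\cdot,\cdot\rangle$ is the dual pairing between $W$ and $W^*$; $\langle w,\varphi\rangle=\langle w,\varphi\rangle_H$ if $w\in H$, $\varphi\in W^*$. For $h\in H$, $\langle w,h\rangle$ is defined $\mu$-almost surely as the limit in $\mathcal{L}^2(W,\mu)$ of $\langle w,\varphi_j\rangle$, where $\varphi_j\in W^*$ and $\varphi_j\to h$ in $H$. When the law of $X_n$ has a density in $\mathcal{L}^2(W,\mu)$ with respect to $\mu$, all moments of $\langle X_n,\varphi\rangle$, $\varphi\in W^*$, are finite, and for $h\in H$ the real random variable $\langle X_n,h\rangle$ is defined almost surely as the mean-square limit of $\langle X_n,\varphi_j\rangle$ for $\varphi_j\in W^*$, $\varphi_j\to h$ in $H$. Chaos decomposition: $H^{\hat\otimes k}$ is the space of symmetric elements of $H^{\otimes k}$, and $\delta^k(u)$ is the multiple Wiener-Itô integral of $u\in H^{\hat\otimes k}$, with $\delta^0(c)=c$ for constants and $\delta^1(h)=\langle\cdot,h\rangle$. For non-symmetric $u\in H^{\otimes k}$, $\delta^k(u)$ means $\delta^k$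 of the symmetrization of $u$. Every $f\in\mathcal{L}^2(W,\mu)$ is uniquely $f=\sum_{k\geq0}\delta^k(f_k)$ with $f_k\in H^{\hat\otimes k}$ (the $k$-th order kernels). The normalization is such that $\int_W fg\,d\mu=\sum_{k\geq 0}k!\langle f_k,g_k\rangle_{H^{\otimes k}}$ and $\exp\{\langle\cdot,h\rangle-\frac{|h|_H^2}{2}\}=\sum_{k\geq0}\delta^k(h^{\otimes k}/k!)$ for $h\in H$. $\delta_{ij}$ is the Kronecker delta. *)

theory Defs
  imports "HOL-Probability.Probability" "HOL-Combinatorics.Permutations"
begin

section \<open>Square integrable functions and mean-square limits\<close>

definition square_integrable :: "'a measure \<Rightarrow> ('a \<Rightarrow> real) \<Rightarrow> bool" where
  "square_integrable M f \<longleftrightarrow> f \<in> borel_measurable M \<and> integrable M (\<lambda>x. (f x)\<^sup>2)"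

definition L2_lim :: "'a measure \<Rightarrow> (nat \<Rightarrow> 'a \<Rightarrow> real) \<Rightarrow> ('a \<Rightarrow> real) \<Rightarrow> bool" where
  "L2_lim M F f \<longleftrightarrow>
     (\<forall>n. square_integrable M (F n)) \<and> square_integrable M f \<and>
     (\<lambda>n. \<integral>x. (F n x - f x)\<^sup>2 \<partial>M) \<longlonglongrightarrow> 0"

definition L2_sums :: "'a measure \<Rightarrow> (nat \<Rightarrow> 'a \<Rightarrow> real) \<Rightarrow> ('a \<Rightarrow> real) \<Rightarrow> bool" where
  "L2_sums M F f \<longleftrightarrow> L2_lim M (\<lambda>N x. \<Sum>k<N. F k x) f"

definition covariance :: "'a measure \<Rightarrow> ('a \<Rightarrow> real) \<Rightarrow> ('a \<Rightarrow> real) \<Rightarrow> real" where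
  "covariance M Y Z =
     prob_space.expectation M
       (\<lambda>x. (Y x - prob_space.expectation M Y) * (Z x - prob_space.expectation M Z))"

definition has_density :: "'a measure \<Rightarrow> 'a measure \<Rightarrow> ('a \<Rightarrow> real) \<Rightarrow> bool" where
  "has_density \<nu> \<mu> f \<longleftrightarrow>
     f \<in> borel_measurable \<mu> \<and> (AE w in \<mu>. 0 \<le> f w) \<and> \<nu> = density \<mu> (\<lambda>w. ennreal (f w))"


section \<open>Abstract Wiener spaces\<close>

definition gaussian_measure :: "'w::real_normed_vector measure \<Rightarrow> bool" where
  "gaussian_measure \<nu> \<longleftrightarrow>
     prob_space \<nu> \<and> sets \<nu> = sets borel \<and>
     (\<forall>\<phi>::'w \<Rightarrow>\<^sub>L real. \<exists>m \<sigma>. 0 \<le> \<sigma> \<and>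
        distr \<nu> borel (blinfun_apply \<phi>) =
          (if \<sigma> = 0 then return borel m
           else density lborel (\<lambda>x. ennreal (normal_density m \<sigma> x))))"

text \<open>
  The inclusion of the dual space of \<open>W\<close> in \<open>H\<close>: a functional \<open>\<phi>\<close> is sent to the Riesz
  representative of its restriction to \<open>H\<close>, where \<open>\<iota>\<close> is the embedding of \<open>H\<close> in \<open>W\<close>.
\<close>
definition dual_embed :: "('h::real_inner \<Rightarrow> 'w::real_normed_vector) \<Rightarrow> ('w \<Rightarrow>\<^sub>L real) \<Rightarrow> 'h" where
  "dual_embed \<iota> \<phi> = (THE u. \<forall>x. blinfun_apply \<phi> (\<iota> x) = inner x u)"

text \<open>
  Second countability expresses separability. For \<open>W\<close> it is no extra hypothesis, as \<open>W\<close> has the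
  dense subset \<open>\<iota> H\<close>, the continuous image of a separable space.
\<close>
locale abstract_wiener_space =
  fixes \<iota> :: "'h::{real_inner, complete_space, second_countable_topology}
               \<Rightarrow> 'w::{banach, second_countable_topology}"
    and \<mu> :: "'w measure"
  assumes bounded_linear_embedding: "bounded_linear \<iota>"
    and inj_embedding: "inj \<iota>"
    and dense_embedding: "closure (range \<iota>) = UNIV"
    and gaussian: "gaussian_measure \<mu>"
    and characteristic_functional:
      "(\<integral>w. iexp (blinfun_apply \<phi> w) \<partial>\<mu>) = complex_of_real (exp (- (norm (dual_embed \<iota> \<phi>))\<^sup>2 / 2))"

text \<open>
  \<open>wiener_pairing \<iota> M X h\<close> is a version of the random variable \<open>\<langle>X, h\<rangle>\<close> for \<open>h\<close> in \<open>H\<close> and a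
  random variable \<open>X\<close> on \<open>M\<close> with values in \<open>W\<close>. For \<open>M = \<mu>\<close> and \<open>X\<close> the identity it is \<open>\<langle>w, h\<rangle>\<close>.
\<close>
definition wiener_pairing ::
  "('h::real_inner \<Rightarrow> 'w::real_normed_vector) \<Rightarrow> 'a measure \<Rightarrow> ('a \<Rightarrow> 'w) \<Rightarrow> 'h \<Rightarrow> 'a \<Rightarrow> real" where
  "wiener_pairing \<iota> M X h =
     (SOME Y. \<forall>\<phi>. (\<lambda>j. dual_embed \<iota> (\<phi> j)) \<longlonglongrightarrow> h \<longrightarrow>
        L2_lim M (\<lambda>j x. blinfun_apply (\<phi> j) (X x)) Y)"


section \<open>Hilbert space tensor powers\<close>

text \<open>The index set is the basis itself, so that finite-dimensional spaces are covered too.\<close>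
definition orthonormal_basis :: "'h::real_inner set \<Rightarrow> bool" where
  "orthonormal_basis B \<longleftrightarrow>
     (\<forall>b\<in>B. norm b = 1) \<and> pairwise orthogonal B \<and> closure (span B) = UNIV"

definition some_basis :: "'h::real_inner set" where
  "some_basis = (SOME B. orthonormal_basis B)"

definition basis_tuples :: "nat \<Rightarrow> 'h::real_inner list set" where
  "basis_tuples k = {bs. length bs = k \<and> set bs \<subseteq> some_basis}"

text \<open>
  The \<open>k\<close>-th Hilbert space tensor power of \<open>H\<close> is realised as the space of Hilbert-Schmidt
  \<open>k\<close>-linear forms on \<open>H\<close>, where \<open>h\<^sub>1 \<otimes> \<dots> \<otimes> h\<^sub>k\<close> is the form
  \<open>(x\<^sub>1, \<dots>, x\<^sub>k) \<mapsto> \<langle>h\<^sub>1, x\<^sub>1\<rangle> \<cdots> \<langle>h\<^sub>k, x\<^sub>k\<rangle>\<close>. A \<open>k\<close>-linear form is a function on lists that vanishes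
  on lists of length other than \<open>k\<close>. In particular \<open>h\<close> in \<open>H\<close> is identified with the form
  \<open>\<langle>h, _\<rangle>\<close> in the first tensor power, and a constant with its value at the empty list. Neither
  the space nor the inner product depends on the orthonormal basis; continuity has to be
  required, because it does not follow from the summability over a single basis.
\<close>
definition tensor_space :: "nat \<Rightarrow> ('h::real_inner list \<Rightarrow> real) set" where
  "tensor_space k =
     {u. (\<forall>xs. length xs \<noteq> k \<longrightarrow> u xs = 0) \<and>
         (\<forall>xs i. length xs = k \<longrightarrow> i < k \<longrightarrow> linear (\<lambda>x. u (xs[i := x]))) \<and>
         (\<exists>C. \<forall>xs. length xs = k \<longrightarrow> \<bar>u xs\<bar> \<le> C * (\<Prod>i<k. norm (xs ! i))) \<and>
         (\<lambda>bs. (u bs)\<^sup>2) summable_on basis_tuples k}"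

definition tensor_inner :: "nat \<Rightarrow> ('h::real_inner list \<Rightarrow> real) \<Rightarrow> ('h list \<Rightarrow> real) \<Rightarrow> real" where
  "tensor_inner k u v = (\<Sum>\<^sub>\<infinity>bs\<in>basis_tuples k. u bs * v bs)"

definition pure_tensor :: "'h::real_inner list \<Rightarrow> 'h list \<Rightarrow> real" where
  "pure_tensor hs xs =
     (if length xs = length hs then \<Prod>i<length hs. inner (hs ! i) (xs ! i) else 0)"

text \<open>The tensor product of an \<open>m\<close>-linear form with another form, and tensor powers thereof.\<close>
definition tensor_prod ::
  "nat \<Rightarrow> ('h list \<Rightarrow> real) \<Rightarrow> ('h list \<Rightarrow> real) \<Rightarrow> 'h list \<Rightarrow> real" where
  "tensor_prod m u v xs = u (take m xs) * v (drop m xs)"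

fun tensor_power :: "nat \<Rightarrow> ('h::real_inner list \<Rightarrow> real) \<Rightarrow> nat \<Rightarrow> 'h list \<Rightarrow> real" where
  "tensor_power m u 0 = pure_tensor []"
| "tensor_power m u (Suc k) = tensor_prod m u (tensor_power m u k)"

definition symmetrize :: "nat \<Rightarrow> ('h list \<Rightarrow> real) \<Rightarrow> 'h list \<Rightarrow> real" where
  "symmetrize k u xs =
     (if length xs = k then (\<Sum>p | p permutes {..<k}. u (permute_list p xs)) / fact k else 0)"

definition sym_tensor_space :: "nat \<Rightarrow> ('h::real_inner list \<Rightarrow> real) set" where
  "sym_tensor_space k = {u \<in> tensor_space k. symmetrize k u = u}"


section \<open>Multiple Wiener-Ito integrals\<close>

fun hermite :: "nat \<Rightarrow> real \<Rightarrow> real \<Rightarrow> real" where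
  "hermite 0 s x = 1"
| "hermite (Suc 0) s x = x"
| "hermite (Suc (Suc k)) s x = x * hermite (Suc k) s x - real (Suc k) * s * hermite k s x"

lemma hermite_has_real_derivative:
  "(hermite k s has_real_derivative real k * hermite (k - 1) s x) (at x)"
proof (induction k s x rule: hermite.induct)
  case (3 k s x)
  have "((\<lambda>x. x * hermite (Suc k) s x - real (Suc k) * s * hermite k s x) has_real_derivative
      1 * hermite (Suc k) s x + real (Suc k) * hermite k s x * x
        - real (Suc k) * s * (real k * hermite (k - 1) s x)) (at x)"
    using 3 by (auto intro!: derivative_eq_intros)
  moreover have "1 * hermite (Suc k) s x + real (Suc k) * hermite k s x * x
        - real (Suc k) * s * (real k * hermite (k - 1) s x)
      = real (Suc (Suc k)) * hermite (Suc (Suc k) - 1) s x"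
    by (cases k) (auto simp: algebra_simps)
  ultimately show ?case by simp
qed (auto intro!: derivative_eq_intros)

text \<open>
  With \<open>x = \<langle>w, h\<rangle>\<close> and \<open>s = \<bar>h\<bar>\<^sup>2\<close>, this identity turns the normalization
  \<open>exp (\<langle>_, t h\<rangle> - \<bar>t h\<bar>\<^sup>2 / 2) = (\<Sum>k. t^k \<delta>\<^sup>k(h\<^sup>\<otimes>\<^sup>k) / k!)\<close> of the multiple integrals into
  \<open>\<delta>\<^sup>k(h\<^sup>\<otimes>\<^sup>k) = hermite k \<bar>h\<bar>\<^sup>2 \<langle>_, h\<rangle>\<close>.
\<close>
lemma hermite_eq_deriv_exp:
  "(deriv ^^ k) (\<lambda>t. exp (t * x - t\<^sup>2 * s / 2)) 0 = hermite k s x"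
proof -
  have "(deriv ^^ k) (\<lambda>t. exp (t * x - t\<^sup>2 * s / 2))
      = (\<lambda>t. hermite k s (x - t * s) * exp (t * x - t\<^sup>2 * s / 2))"
  proof (induction k)
    case (Suc k)
    have "deriv (\<lambda>t. hermite k s (x - t * s) * exp (t * x - t\<^sup>2 * s / 2)) t
        = hermite (Suc k) s (x - t * s) * exp (t * x - t\<^sup>2 * s / 2)" for t
    proof (rule DERIV_imp_deriv)
      have h: "((\<lambda>t. hermite k s (x - t * s)) has_real_derivative
          real k * hermite (k - 1) s (x - t * s) * (- s)) (at t)"
        by (rule DERIV_chain2[OF hermite_has_real_derivative])
          (auto intro!: derivative_eq_intros)
      have e: "((\<lambda>t. exp (t * x - t\<^sup>2 * s / 2)) has_real_derivative
          exp (t * x - t\<^sup>2 * s / 2) * (x - t * s)) (at t)"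
        by (auto intro!: derivative_eq_intros)
      have r: "hermite (Suc k) s y = y * hermite k s y - real k * s * hermite (k - 1) s y" for y
        by (cases k) auto
      show "((\<lambda>t. hermite k s (x - t * s) * exp (t * x - t\<^sup>2 * s / 2)) has_real_derivative
          hermite (Suc k) s (x - t * s) * exp (t * x - t\<^sup>2 * s / 2)) (at t)"
        by (rule DERIV_cong[OF DERIV_mult[OF h e]]) (simp add: r algebra_simps)
    qed
    then show ?case unfolding funpow.simps o_apply Suc by (rule ext)
  qed simp
  then show ?thesis by simp
qed

text \<open>
  \<open>D\<close> is a version of \<open>\<delta>\<^sup>k(u)\<close>: the integral is the continuous linear extension of
  \<open>h\<^sup>\<otimes>\<^sup>k \<mapsto> hermite k \<bar>h\<bar>\<^sup>2 \<langle>_, h\<rangle>\<close> from the linear span of the powers \<open>h\<^sup>\<otimes>\<^sup>k\<close> with \<open>h\<close> in the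
  dual of \<open>W\<close>, which is dense in the space of symmetric tensors.
\<close>
definition is_multiple_integral ::
  "('h::real_inner \<Rightarrow> 'w::real_normed_vector) \<Rightarrow> 'w measure \<Rightarrow> nat \<Rightarrow>
   ('h list \<Rightarrow> real) \<Rightarrow> ('w \<Rightarrow> real) \<Rightarrow> bool" where
  "is_multiple_integral \<iota> \<mu> k u D \<longleftrightarrow>
     (\<exists>(N :: nat \<Rightarrow> nat) (c :: nat \<Rightarrow> nat \<Rightarrow> real) (\<phi> :: nat \<Rightarrow> nat \<Rightarrow> 'w \<Rightarrow>\<^sub>L real)
        (U :: nat \<Rightarrow> 'h list \<Rightarrow> real).
        (\<forall>n xs. U n xs =
           (\<Sum>i<N n. c n i * pure_tensor (replicate k (dual_embed \<iota> (\<phi> n i))) xs)) \<and>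
        (\<lambda>n. tensor_inner k (\<lambda>xs. U n xs - symmetrize k u xs)
                            (\<lambda>xs. U n xs - symmetrize k u xs)) \<longlonglongrightarrow> 0 \<and>
        L2_lim \<mu> (\<lambda>n w. \<Sum>i<N n.
           c n i * hermite k ((norm (dual_embed \<iota> (\<phi> n i)))\<^sup>2) (blinfun_apply (\<phi> n i) w)) D)"

definition multiple_integral ::
  "('h::real_inner \<Rightarrow> 'w::real_normed_vector) \<Rightarrow> 'w measure \<Rightarrow> nat \<Rightarrow>
   ('h list \<Rightarrow> real) \<Rightarrow> 'w \<Rightarrow> real" where
  "multiple_integral \<iota> \<mu> k u = (SOME D. is_multiple_integral \<iota> \<mu> k u D)"

text \<open>\<open>F k\<close> is the \<open>k\<close>-th order kernel of \<open>f\<close>.\<close>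
definition chaos_kernels ::
  "('h::real_inner \<Rightarrow> 'w::real_normed_vector) \<Rightarrow> 'w measure \<Rightarrow> ('w \<Rightarrow> real) \<Rightarrow>
   (nat \<Rightarrow> 'h list \<Rightarrow> real) \<Rightarrow> bool" where
  "chaos_kernels \<iota> \<mu> f F \<longleftrightarrow>
     (\<forall>k. F k \<in> sym_tensor_space k) \<and>
     L2_sums \<mu> (\<lambda>k. multiple_integral \<iota> \<mu> k (F k)) f"

end

theory Submission
  imports Defs
begin

text \<open>
  The kernels of orders one and two of the density \<open>f\<close> are its first two moments. Multiple integrals
  of different orders are orthogonal, and \<open>\<langle>w, \<phi>\<rangle>\<close> and \<open>\<langle>w, \<phi>\<rangle>\<^sup>2 - \<bar>\<phi>\<bar>\<^sup>2\<close> are multiple integrals of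
  orders one and two, so pairing \<open>f\<close> with them gives \<open>E \<langle>X, h\<rangle> = F 1 [h]\<close> and
  \<open>E \<langle>X, h\<rangle> \<langle>X, k\<rangle> = \<langle>h, k\<rangle> + 2 F 2 [h, k]\<close>. Hence \<open>A = 2 g\<^sub>2\<close> is the covariance form of \<open>X\<close> minus the
  inner product (\<open>pairing_covariance\<close>), and the hypotheses say that \<open>A\<close> is positive, has finite trace and
  has Hilbert-Schmidt norm less than \<open>1\<close>. The theorem concerns only such a form.

  Convergence of \<open>\<xi>\<close>. The isometry of multiple integrals shows that the \<open>k\<close>-th term has squared norm at
  most \<open>(2k)! / (k!)\<^sup>2 \<bar>g\<^sub>2\<bar>\<^sup>2\<^sup>k \<le> (4 \<bar>g\<^sub>2\<bar>\<^sup>2)\<^sup>k = (\<bar>A\<bar>\<^sup>2)\<^sup>k\<close>, a convergent geometric series of orthogonal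
  terms (\<open>wick_exponential_exists\<close>). The isometry comes from Gaussian integration by parts for Hermite
  polynomials of functionals (\<open>hermite_orthogonal\<close>), together with the density of the span of the powers
  \<open>h \<otimes> \<dots> \<otimes> h\<close> in the symmetric tensors, a consequence of polarization (\<open>symmetrize_pure_tensor\<close>).

  Characteristic functional of \<open>\<xi>\<close>. Integrated against the character of \<open>\<phi>\<close>, the \<open>k\<close>-th term gives
  \<open>(- g\<^sub>2(\<phi>, \<phi>))\<^sup>k / k!\<close> times \<open>exp (- \<bar>\<phi>\<bar>\<^sup>2 / 2)\<close>. The sum over \<open>k\<close> is an exponential series
  (\<open>wick_exponential_char\<close>).

  Positivity of \<open>\<xi>\<close> cannot be read off the series. It is obtained by producing a Gaussian measure \<open>\<nu>\<close> with
  the same characteristic functional. Cholesky elimination writes the positive form as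
  \<open>A(x, x) = (\<Sum>m. \<langle>v\<^sub>m, x\<rangle>\<^sup>2)\<close> (\<open>positive_form_sum_of_squares\<close>), finite trace means \<open>(\<Sum>m. \<bar>v\<^sub>m\<bar>\<^sup>2) < \<infinity>\<close>, and
  then \<open>w + (\<Sum>m. \<zeta>\<^sub>m v\<^sub>m)\<close>, with standard normal \<open>\<zeta>\<^sub>m\<close> independent of each other and of \<open>w\<close>, has the wanted
  law \<open>\<nu>\<close> (\<open>gaussian_perturbation_exists\<close>). A finite signed measure on a separable normed space is
  determined by its characteristic functional, so \<open>\<nu> = \<xi> \<mu>\<close> and \<open>\<xi> \<ge> 0\<close>
  (\<open>density_nonneg_of_characteristic_functional\<close>). This rests on \<open>characteristic_functional_unique\<close>, where
  the uniqueness theorem of Levy on the line is applied to one functional after the other, and on norming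
  functionals, which make the half spaces generate the Borel sets.

  Stability. The exponent of the characteristic functional is quadratic and has no linear part, so the
  normalized sum of \<open>n\<close> independent copies has the same one (\<open>stable_law_of_char\<close>).
\<close>

section \<open>Square integrable functions\<close>

lemma square_integrableD:
  assumes "square_integrable M f"
  shows "f \<in> borel_measurable M" "integrable M (\<lambda>x. (f x)\<^sup>2)"
  using assms by (auto simp: square_integrable_def)

lemma square_integrable_mult:
  assumes "square_integrable M f" "square_integrable M g"
  shows "integrable M (\<lambda>x. f x * g x)"
proof (rule Bochner_Integration.integrable_bound)
  show "integrable M (\<lambda>x. (f x)\<^sup>2 + (g x)\<^sup>2)"
    using assms by (auto simp: square_integrable_def)
  show "(\<lambda>x. f x * g x) \<in> borel_measurable M"
    using assms by (auto simp: square_integrable_def)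
  have "\<bar>a * b\<bar> \<le> a\<^sup>2 + b\<^sup>2" for a b :: real
  proof -
    have "2 * \<bar>a\<bar> * \<bar>b\<bar> \<le> a\<^sup>2 + b\<^sup>2" "0 \<le> \<bar>a\<bar> * \<bar>b\<bar>"
      using sum_squares_bound[of "\<bar>a\<bar>" "\<bar>b\<bar>"] by simp_all
    then show ?thesis unfolding abs_mult by linarith
  qed
  then show "AE x in M. norm (f x * g x) \<le> norm ((f x)\<^sup>2 + (g x)\<^sup>2)"
    by (simp add: abs_of_nonneg)
qed

lemma square_integrable_cmult:
  "square_integrable M f \<Longrightarrow> square_integrable M (\<lambda>x. c * f x)"
  by (auto simp: square_integrable_def power_mult_distrib)

lemma square_integrable_add:
  assumes "square_integrable M f" "square_integrable M g"
  shows "square_integrable M (\<lambda>x. f x + g x)"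
proof -
  have "integrable M (\<lambda>x. (f x)\<^sup>2 + (g x)\<^sup>2 + 2 * (f x * g x))"
    using assms square_integrable_mult[OF assms] by (auto simp: square_integrable_def)
  then show ?thesis using assms
    by (auto simp: square_integrable_def power2_sum algebra_simps)
qed

lemma square_integrable_diff:
  "square_integrable M f \<Longrightarrow> square_integrable M g \<Longrightarrow> square_integrable M (\<lambda>x. f x - g x)"
  using square_integrable_add[of M f "\<lambda>x. (-1) * g x"] square_integrable_cmult[of M g "-1"] by simp

lemma square_integrable_zero: "square_integrable M (\<lambda>x. 0)"
  by (simp add: square_integrable_def)

lemma square_integrable_sum:
  "(\<And>i. i \<in> I \<Longrightarrow> square_integrable M (f i)) \<Longrightarrow> square_integrable M (\<lambda>x. \<Sum>i\<in>I. f i x)"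
  by (induction I rule: infinite_finite_induct)
    (auto intro: square_integrable_add square_integrable_zero)

lemma (in prob_space) square_integrable_const: "square_integrable M (\<lambda>x. c)"
  by (simp add: square_integrable_def)

lemma (in prob_space) square_integrable_integrable:
  "square_integrable M f \<Longrightarrow> integrable M f"
  using square_integrable_mult[OF _ square_integrable_const[of 1]] by simp

lemma L2_Cauchy_Schwarz:
  assumes f: "square_integrable M f" and g: "square_integrable M g"
  shows "\<bar>\<integral>x. f x * g x \<partial>M\<bar> \<le> sqrt (\<integral>x. (f x)\<^sup>2 \<partial>M) * sqrt (\<integral>x. (g x)\<^sup>2 \<partial>M)"
proof -
  define A B C where "A = (\<integral>x. (f x)\<^sup>2 \<partial>M)" and "B = (\<integral>x. (g x)\<^sup>2 \<partial>M)"
    and "C = (\<integral>x. f x * g x \<partial>M)"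
  note [simp] = square_integrableD(2)[OF f] square_integrableD(2)[OF g] square_integrable_mult[OF f g]
  have AB: "A \<ge> 0" "B \<ge> 0" by (simp_all add: A_def B_def)
  have "C\<^sup>2 \<le> A * B"
  proof (cases "B = 0")
    case True
    then have "AE x in M. (g x)\<^sup>2 = 0"
      using integral_nonneg_eq_0_iff_AE[of M "\<lambda>x. (g x)\<^sup>2"] by (simp add: B_def)
    then have "C = (\<integral>x. 0 \<partial>M)" unfolding C_def
      using f g by (intro integral_cong_AE) (auto simp: square_integrable_def)
    with AB show ?thesis by simp
  next
    case False
    have "0 \<le> (\<integral>x. (B * f x - C * g x)\<^sup>2 \<partial>M)" by simp
    also have "(\<lambda>x. (B * f x - C * g x)\<^sup>2) = (\<lambda>x. B\<^sup>2 * (f x)\<^sup>2 + C\<^sup>2 * (g x)\<^sup>2 - (2 * B * C) * (f x * g x))"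
      by (auto simp: power2_eq_square algebra_simps)
    also have "(\<integral>x. \<dots> x \<partial>M) = B\<^sup>2 * A + C\<^sup>2 * B - 2 * B * C * C"
      by (simp add: A_def B_def C_def)
    also have "\<dots> = B * (A * B - C\<^sup>2)" by (simp add: power2_eq_square algebra_simps)
    finally show ?thesis using False AB by (simp add: zero_le_mult_iff)
  qed
  then have "\<bar>C\<bar> \<le> sqrt (A * B)" by (simp add: real_le_rsqrt)
  then show ?thesis by (simp add: real_sqrt_mult A_def B_def C_def)
qed

lemma (in prob_space) L1_le_L2:
  assumes f: "square_integrable M f"
  shows "(\<integral>x. \<bar>f x\<bar> \<partial>M) \<le> sqrt (\<integral>x. (f x)\<^sup>2 \<partial>M)"
proof -
  have "square_integrable M (\<lambda>x. \<bar>f x\<bar>)" using f by (auto simp: square_integrable_def)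
  from L2_Cauchy_Schwarz[OF this square_integrable_const[of 1]] show ?thesis
    by (simp add: prob_space)
qed

section \<open>Mean-square limits\<close>

lemma L2_limD:
  assumes "L2_lim M F f"
  shows "square_integrable M (F n)" "square_integrable M f"
    "(\<lambda>n. \<integral>x. (F n x - f x)\<^sup>2 \<partial>M) \<longlonglongrightarrow> 0"
  using assms by (auto simp: L2_lim_def)

lemma L2_lim_const: "square_integrable M f \<Longrightarrow> L2_lim M (\<lambda>n. f) f"
  by (simp add: L2_lim_def)

lemma L2_lim_cmult:
  assumes "L2_lim M F f" shows "L2_lim M (\<lambda>n x. c * F n x) (\<lambda>x. c * f x)"
proof -
  have "(\<lambda>x. (c * F n x - c * f x)\<^sup>2) = (\<lambda>x. c\<^sup>2 * (F n x - f x)\<^sup>2)" for n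
    by (auto simp: power2_eq_square algebra_simps)
  then show ?thesis using assms tendsto_mult_right_zero[of "\<lambda>n. \<integral>x. (F n x - f x)\<^sup>2 \<partial>M" _ "c\<^sup>2"]
    by (auto simp: L2_lim_def square_integrable_cmult)
qed

lemma L2_lim_integral_mult:
  assumes F: "L2_lim M F f" and G: "L2_lim M G g"
  shows "(\<lambda>n. \<integral>x. F n x * G n x \<partial>M) \<longlonglongrightarrow> (\<integral>x. f x * g x \<partial>M)"
proof -
  note sq = L2_limD(1)[OF F] L2_limD(2)[OF F] L2_limD(1)[OF G] L2_limD(2)[OF G]
  define a where "a n = sqrt (\<integral>x. (F n x - f x)\<^sup>2 \<partial>M)" for n
  define b where "b n = sqrt (\<integral>x. (G n x - g x)\<^sup>2 \<partial>M)" for n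
  have a: "a \<longlonglongrightarrow> 0" unfolding a_def using tendsto_real_sqrt[OF L2_limD(3)[OF F]] by simp
  have b: "b \<longlonglongrightarrow> 0" unfolding b_def using tendsto_real_sqrt[OF L2_limD(3)[OF G]] by simp
  define p q where "p = sqrt (\<integral>x. (f x)\<^sup>2 \<partial>M)" and "q = sqrt (\<integral>x. (g x)\<^sup>2 \<partial>M)"
  have bnd: "\<bar>(\<integral>x. F n x * G n x \<partial>M) - (\<integral>x. f x * g x \<partial>M)\<bar> \<le> a n * b n + p * b n + a n * q" for n
  proof -
    have d: "square_integrable M (\<lambda>x. F n x - f x)" "square_integrable M (\<lambda>x. G n x - g x)"
      using sq by (auto intro: square_integrable_diff)
    have "(\<integral>x. F n x * G n x \<partial>M) - (\<integral>x. f x * g x \<partial>M) = (\<integral>x. F n x * G n x - f x * g x \<partial>M)"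
      using sq by (subst Bochner_Integration.integral_diff) (auto intro: square_integrable_mult)
    also have "\<dots> = (\<integral>x. (F n x - f x) * (G n x - g x) + f x * (G n x - g x) + (F n x - f x) * g x \<partial>M)"
      by (simp add: algebra_simps)
    also have "\<dots> = (\<integral>x. (F n x - f x) * (G n x - g x) \<partial>M) + (\<integral>x. f x * (G n x - g x) \<partial>M)
        + (\<integral>x. (F n x - f x) * g x \<partial>M)"
      using sq d square_integrable_mult[of M] by (simp add: algebra_simps)
    finally show ?thesis
      using L2_Cauchy_Schwarz[OF d] L2_Cauchy_Schwarz[OF sq(2) d(2)] L2_Cauchy_Schwarz[OF d(1) sq(4)]
      unfolding a_def b_def p_def q_def by linarith
  qed
  have "(\<lambda>n. a n * b n + p * b n + a n * q) \<longlonglongrightarrow> 0 * 0 + p * 0 + 0 * q"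
    by (intro tendsto_intros a b)
  then have lim0: "(\<lambda>n. a n * b n + p * b n + a n * q) \<longlonglongrightarrow> 0" by simp
  have "(\<lambda>n. (\<integral>x. F n x * G n x \<partial>M) - (\<integral>x. f x * g x \<partial>M)) \<longlonglongrightarrow> 0"
  proof (rule Lim_null_comparison[OF always_eventually lim0], rule allI)
    show "norm ((\<integral>x. F n x * G n x \<partial>M) - (\<integral>x. f x * g x \<partial>M)) \<le> a n * b n + p * b n + a n * q" for n
      using bnd[of n] unfolding real_norm_def .
  qed
  then show ?thesis using LIM_zero_iff by blast
qed

lemma integral_square_add_le:
  assumes f: "square_integrable M f" and g: "square_integrable M g"
  shows "(\<integral>x. (f x + g x)\<^sup>2 \<partial>M) \<le> 2 * (\<integral>x. (f x)\<^sup>2 \<partial>M) + 2 * (\<integral>x. (g x)\<^sup>2 \<partial>M)"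
proof -
  have "(a + b)\<^sup>2 \<le> 2 * a\<^sup>2 + 2 * b\<^sup>2" for a b :: real
    using zero_le_power2[of "a - b"] by (simp add: power2_eq_square algebra_simps)
  then have "(\<integral>x. (f x + g x)\<^sup>2 \<partial>M) \<le> (\<integral>x. 2 * (f x)\<^sup>2 + 2 * (g x)\<^sup>2 \<partial>M)"
    using square_integrable_add[OF f g] f g
    by (intro integral_mono) (auto simp: square_integrable_def)
  then show ?thesis using f g by (simp add: square_integrable_def)
qed

lemma L2_lim_add:
  assumes F: "L2_lim M F f" and G: "L2_lim M G g"
  shows "L2_lim M (\<lambda>n x. F n x + G n x) (\<lambda>x. f x + g x)"
  unfolding L2_lim_def
proof (intro conjI allI)
  note sq = L2_limD(1)[OF F] L2_limD(2)[OF F] L2_limD(1)[OF G] L2_limD(2)[OF G]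
  show "square_integrable M (\<lambda>x. F n x + G n x)" "square_integrable M (\<lambda>x. f x + g x)" for n
    using sq by (auto intro: square_integrable_add)
  have "(\<lambda>n. 2 * (\<integral>x. (F n x - f x)\<^sup>2 \<partial>M) + 2 * (\<integral>x. (G n x - g x)\<^sup>2 \<partial>M)) \<longlonglongrightarrow> 2 * 0 + 2 * 0"
    by (intro tendsto_intros L2_limD(3)[OF F] L2_limD(3)[OF G])
  then have lim0: "(\<lambda>n. 2 * (\<integral>x. (F n x - f x)\<^sup>2 \<partial>M) + 2 * (\<integral>x. (G n x - g x)\<^sup>2 \<partial>M)) \<longlonglongrightarrow> 0"
    by simp
  show "(\<lambda>n. \<integral>x. (F n x + G n x - (f x + g x))\<^sup>2 \<partial>M) \<longlonglongrightarrow> 0"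
  proof (rule Lim_null_comparison[OF always_eventually lim0], rule allI)
    fix n
    have "(\<integral>x. (F n x + G n x - (f x + g x))\<^sup>2 \<partial>M) = (\<integral>x. ((F n x - f x) + (G n x - g x))\<^sup>2 \<partial>M)"
      by (simp only: add_diff_add)
    also have "\<dots> \<le> 2 * (\<integral>x. (F n x - f x)\<^sup>2 \<partial>M) + 2 * (\<integral>x. (G n x - g x)\<^sup>2 \<partial>M)"
      using sq by (intro integral_square_add_le square_integrable_diff)
    finally show "norm (\<integral>x. (F n x + G n x - (f x + g x))\<^sup>2 \<partial>M) \<le>
        2 * (\<integral>x. (F n x - f x)\<^sup>2 \<partial>M) + 2 * (\<integral>x. (G n x - g x)\<^sup>2 \<partial>M)" by simp
  qed
qed

lemma L2_lim_perturb:
  assumes F: "L2_lim M F f" and G: "\<And>n. square_integrable M (G n)"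
    and "(\<lambda>n. \<integral>x. (G n x - F n x)\<^sup>2 \<partial>M) \<longlonglongrightarrow> 0"
  shows "L2_lim M G f"
proof -
  have "L2_lim M (\<lambda>n x. G n x - F n x) (\<lambda>x. 0)"
    using assms L2_limD(1)[OF F]
    by (auto simp: L2_lim_def intro: square_integrable_diff square_integrable_zero)
  from L2_lim_add[OF F this] show ?thesis by simp
qed

text \<open>
  With a character for \<open>G\<close> this transports the computation of characteristic integrals along
  mean-square limits.
\<close>
lemma L2_lim_integral_complex:
  fixes G :: "'a \<Rightarrow> complex"
  assumes F: "L2_lim M F f" and [measurable]: "G \<in> borel_measurable M"
    and G: "square_integrable M (\<lambda>x. norm (G x))"
  shows "(\<lambda>n. \<integral>x. complex_of_real (F n x) * G x \<partial>M) \<longlonglongrightarrow> (\<integral>x. complex_of_real (f x) * G x \<partial>M)"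
proof -
  have i: "integrable M (\<lambda>x. complex_of_real (h x) * G x)" if h: "square_integrable M h" for h
  proof -
    have [measurable]: "h \<in> borel_measurable M" using h by (simp add: square_integrable_def)
    have "square_integrable M (\<lambda>x. \<bar>h x\<bar>)" using h by (auto simp: square_integrable_def)
    from square_integrable_mult[OF this G] show ?thesis
      by (rule Bochner_Integration.integrable_bound) (auto simp: norm_mult)
  qed
  have "(\<lambda>n. (\<integral>x. complex_of_real (F n x) * G x \<partial>M) - (\<integral>x. complex_of_real (f x) * G x \<partial>M)) \<longlonglongrightarrow> 0"
  proof (rule Lim_null_comparison, intro always_eventually allI)
    fix n
    have d: "square_integrable M (\<lambda>x. F n x - f x)"
      using L2_limD[OF F] by (auto intro: square_integrable_diff)
    then have d': "square_integrable M (\<lambda>x. \<bar>F n x - f x\<bar>)" by (auto simp: square_integrable_def)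
    have "(\<integral>x. complex_of_real (F n x) * G x \<partial>M) - (\<integral>x. complex_of_real (f x) * G x \<partial>M)
        = (\<integral>x. complex_of_real (F n x - f x) * G x \<partial>M)"
      using L2_limD(1,2)[OF F] by (subst Bochner_Integration.integral_diff[symmetric]) (auto intro!: i simp: left_diff_distrib)
    also have "norm \<dots> \<le> (\<integral>x. \<bar>F n x - f x\<bar> * norm (G x) \<partial>M)"
      by (rule integral_norm_bound[THEN order_trans]) (simp add: norm_mult flip: of_real_diff)
    also have "\<dots> \<le> sqrt (\<integral>x. (F n x - f x)\<^sup>2 \<partial>M) * sqrt (\<integral>x. (norm (G x))\<^sup>2 \<partial>M)"
      using L2_Cauchy_Schwarz[OF d' G] by simp
    finally show "norm ((\<integral>x. complex_of_real (F n x) * G x \<partial>M) - (\<integral>x. complex_of_real (f x) * G x \<partial>M))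
      \<le> sqrt (\<integral>x. (F n x - f x)\<^sup>2 \<partial>M) * sqrt (\<integral>x. (norm (G x))\<^sup>2 \<partial>M)" .
  next
    have "(\<lambda>n. sqrt (\<integral>x. (F n x - f x)\<^sup>2 \<partial>M) * sqrt (\<integral>x. (norm (G x))\<^sup>2 \<partial>M))
      \<longlonglongrightarrow> sqrt 0 * sqrt (\<integral>x. (norm (G x))\<^sup>2 \<partial>M)"
      by (intro tendsto_intros L2_limD(3)[OF F])
    then show "(\<lambda>n. sqrt (\<integral>x. (F n x - f x)\<^sup>2 \<partial>M) * sqrt (\<integral>x. (norm (G x))\<^sup>2 \<partial>M)) \<longlonglongrightarrow> 0"
      by simp
  qed
  then show ?thesis using LIM_zero_iff by blast
qed

section \<open>Completeness\<close>

text \<open>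
  The total length of the steps has finite mean by monotone convergence, so it is finite almost
  everywhere, and absolute convergence of the telescoping series suffices in a Banach space.
\<close>
lemma AE_convergent_summable_steps:
  fixes S :: "nat \<Rightarrow> 'a \<Rightarrow> 'b::{banach, second_countable_topology}"
  assumes [measurable]: "\<And>k. S k \<in> borel_measurable M"
    and step: "\<And>k. (\<integral>\<^sup>+x. ennreal (norm (S (Suc k) x - S k x)) \<partial>M) \<le> ennreal (c k)"
    and c: "summable c" "\<And>k. 0 \<le> c k"
  shows "AE x in M. convergent (\<lambda>k. S k x)"
proof -
  have "(\<integral>\<^sup>+x. (\<Sum>k. ennreal (norm (S (Suc k) x - S k x))) \<partial>M)
      = (\<Sum>k. \<integral>\<^sup>+x. ennreal (norm (S (Suc k) x - S k x)) \<partial>M)"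
    by (rule nn_integral_suminf) measurable
  also have "\<dots> \<le> (\<Sum>k. ennreal (c k))" by (intro suminf_le step) auto
  also have "\<dots> = ennreal (\<Sum>k. c k)" using c by (intro suminf_ennreal2)
  finally have "(\<integral>\<^sup>+x. (\<Sum>k. ennreal (norm (S (Suc k) x - S k x))) \<partial>M) \<noteq> \<infinity>"
    by (auto simp: top_unique)
  then have "AE x in M. (\<Sum>k. ennreal (norm (S (Suc k) x - S k x))) \<noteq> \<infinity>"
    by (intro nn_integral_PInf_AE) measurable
  then show ?thesis
  proof eventually_elim
    fix x assume "(\<Sum>k. ennreal (norm (S (Suc k) x - S k x))) \<noteq> \<infinity>"
    then have "summable (\<lambda>k. norm (S (Suc k) x - S k x))"
      by (intro summable_suminf_not_top) auto
    then have "summable (\<lambda>k. S (Suc k) x - S k x)" by (rule summable_norm_cancel)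
    then have "convergent (\<lambda>n. \<Sum>k<n. S (Suc k) x - S k x)"
      by (simp add: summable_iff_convergent)
    moreover have "(\<Sum>k<n. S (Suc k) x - S k x) = S n x - S 0 x" for n
      by (rule sum_lessThan_telescope)
    ultimately have "convergent (\<lambda>n. S n x - S 0 x)" by simp
    then show "convergent (\<lambda>n. S n x)" using convergent_add[OF _ convergent_const[of "S 0 x"]] by fastforce
  qed
qed

text \<open>
  In the applications \<open>d\<close> is a squared distance. The speed \<open>1/4\<close> then gives steps of length at most
  \<open>(1/2)\<^sup>k\<close>, which are summable.
\<close>
lemma fast_Cauchy_subsequence:
  fixes d :: "nat \<Rightarrow> nat \<Rightarrow> real"
  assumes C: "\<And>e. e > 0 \<Longrightarrow> \<exists>N. \<forall>m\<ge>N. \<forall>n\<ge>N. d m n < e"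
  obtains r where "strict_mono r" "\<And>k. d (r (Suc k)) (r k) \<le> (1/4) ^ k"
proof -
  have "\<forall>k. \<exists>N. \<forall>m\<ge>N. \<forall>n\<ge>N. d m n < (1/4) ^ k" using C by simp
  then obtain N where N: "\<And>k m n. m \<ge> N k \<Longrightarrow> n \<ge> N k \<Longrightarrow> d m n < (1/4) ^ k" by metis
  define r where "r k = k + (\<Sum>i\<le>k. N i)" for k
  have "r k < r (Suc k)" for k by (simp add: r_def)
  then have mono: "strict_mono r" by (simp add: strict_mono_Suc_iff)
  have ge: "r k \<ge> N k" for k
  proof -
    have "N k \<le> (\<Sum>i\<le>k. N i)" by (rule member_le_sum) auto
    then show ?thesis by (simp add: r_def)
  qed
  have "d (r (Suc k)) (r k) \<le> (1/4) ^ k" for k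
    using N[of k "r (Suc k)" "r k"] ge[of k] strict_monoD[OF mono, of k "Suc k"] by simp
  with mono show ?thesis by (rule that)
qed

text \<open>
  A fast subsequence converges almost surely. Fatou's lemma carries the Cauchy estimate over to the
  distance of the whole sequence from the pointwise limit.
\<close>
lemma (in prob_space) L2_complete:
  assumes F: "\<And>n. square_integrable M (F n)"
    and C: "\<And>e. e > 0 \<Longrightarrow> \<exists>N. \<forall>m\<ge>N. \<forall>n\<ge>N. (\<integral>x. (F m x - F n x)\<^sup>2 \<partial>M) < e"
  shows "\<exists>f. L2_lim M F f"
proof -
  have [measurable]: "F n \<in> borel_measurable M" for n using F by (simp add: square_integrable_def)
  have d: "square_integrable M (\<lambda>x. F m x - F n x)" for m n using F by (intro square_integrable_diff)
  obtain r where r: "strict_mono r" "\<And>k. (\<integral>x. (F (r (Suc k)) x - F (r k) x)\<^sup>2 \<partial>M) \<le> (1/4) ^ k"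
    using fast_Cauchy_subsequence[OF C] by auto
  have "AE x in M. convergent (\<lambda>k. F (r k) x)"
  proof (rule AE_convergent_summable_steps[where c="\<lambda>k. (1/2)^k"])
    fix k
    have "(\<integral>x. \<bar>F (r (Suc k)) x - F (r k) x\<bar> \<partial>M) \<le> sqrt ((1/4) ^ k)"
      using L1_le_L2[OF d] r(2)[of k] by (meson order_trans real_sqrt_le_mono)
    also have "sqrt ((1/4) ^ k) = (1/2 :: real) ^ k"
      by (simp add: real_sqrt_power real_sqrt_divide)
    finally show "(\<integral>\<^sup>+x. ennreal (norm (F (r (Suc k)) x - F (r k) x)) \<partial>M) \<le> ennreal ((1/2)^k)"
      using square_integrable_integrable[OF d, of "r (Suc k)" "r k"]
      by (subst nn_integral_eq_integral) (auto intro: ennreal_leI)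
  qed (auto intro: summable_geometric)
  then have conv: "AE x in M. (\<lambda>k. F (r k) x) \<longlonglongrightarrow> lim (\<lambda>k. F (r k) x)"
    by eventually_elim (simp add: convergent_LIMSEQ_iff)
  define f where "f x = lim (\<lambda>k. F (r k) x)" for x
  have [measurable]: "f \<in> borel_measurable M" unfolding f_def by measurable
  have key: "(\<integral>\<^sup>+x. ennreal ((F n x - f x)\<^sup>2) \<partial>M) \<le> ennreal e"
    if N: "\<forall>m\<ge>N. \<forall>n\<ge>N. (\<integral>x. (F m x - F n x)\<^sup>2 \<partial>M) < e" and n: "n \<ge> N" for n N e
  proof -
    have "(\<integral>\<^sup>+x. ennreal ((F n x - f x)\<^sup>2) \<partial>M)
        \<le> (\<integral>\<^sup>+x. liminf (\<lambda>k. ennreal ((F n x - F (r k) x)\<^sup>2)) \<partial>M)"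
    proof (rule nn_integral_mono_AE, use conv in eventually_elim)
      fix x assume "(\<lambda>k. F (r k) x) \<longlonglongrightarrow> lim (\<lambda>k. F (r k) x)"
      then have "(\<lambda>k. ennreal ((F n x - F (r k) x)\<^sup>2)) \<longlonglongrightarrow> ennreal ((F n x - f x)\<^sup>2)"
        unfolding f_def by (intro tendsto_intros tendsto_ennrealI)
      from lim_imp_Liminf[OF sequentially_bot this]
      show "ennreal ((F n x - f x)\<^sup>2) \<le> liminf (\<lambda>k. ennreal ((F n x - F (r k) x)\<^sup>2))"
        by simp
    qed
    also have "\<dots> \<le> liminf (\<lambda>k. \<integral>\<^sup>+x. ennreal ((F n x - F (r k) x)\<^sup>2) \<partial>M)"
      by (rule nn_integral_liminf) measurable
    also have "\<dots> \<le> liminf (\<lambda>k. ennreal e)"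
    proof (rule Liminf_mono, rule eventually_sequentiallyI[of N])
      fix k assume "k \<ge> N"
      then have "r k \<ge> N" using seq_suble[OF r(1), of k] by simp
      then have "(\<integral>x. (F n x - F (r k) x)\<^sup>2 \<partial>M) \<le> e" using N n by (auto intro: less_imp_le)
      then show "(\<integral>\<^sup>+x. ennreal ((F n x - F (r k) x)\<^sup>2) \<partial>M) \<le> ennreal e"
        using square_integrableD(2)[OF d, of n "r k"]
        by (subst nn_integral_eq_integral) (auto intro: ennreal_leI)
    qed
    also have "\<dots> = ennreal e" by (simp add: Liminf_const)
    finally show ?thesis .
  qed
  have sqd: "square_integrable M (\<lambda>x. F n x - f x)"
    if "\<forall>m\<ge>N. \<forall>n\<ge>N. (\<integral>x. (F m x - F n x)\<^sup>2 \<partial>M) < e" "n \<ge> N" for n N e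
    using key[OF that] unfolding square_integrable_def
    by (auto intro!: integrableI_bounded simp: top_unique less_top[symmetric])
  have sqf: "square_integrable M f"
  proof -
    obtain N where "\<forall>m\<ge>N. \<forall>n\<ge>N. (\<integral>x. (F m x - F n x)\<^sup>2 \<partial>M) < 1" using C[of 1] by auto
    from square_integrable_diff[OF F[of N] sqd[OF this order_refl]] show ?thesis by simp
  qed
  have "(\<lambda>n. \<integral>x. (F n x - f x)\<^sup>2 \<partial>M) \<longlonglongrightarrow> 0"
  proof (rule LIMSEQ_I)
    fix e :: real assume "e > 0"
    then obtain N where N: "\<forall>m\<ge>N. \<forall>n\<ge>N. (\<integral>x. (F m x - F n x)\<^sup>2 \<partial>M) < e/2" using C[of "e/2"] by auto
    have "norm ((\<integral>x. (F n x - f x)\<^sup>2 \<partial>M) - 0) < e" if "n \<ge> N" for n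
    proof -
      have "ennreal (\<integral>x. (F n x - f x)\<^sup>2 \<partial>M) \<le> ennreal (e/2)"
        using key[OF N that] square_integrableD(2)[OF sqd[OF N that]]
        by (subst (asm) nn_integral_eq_integral) auto
      then have "(\<integral>x. (F n x - f x)\<^sup>2 \<partial>M) \<le> e/2" using \<open>e > 0\<close> by (simp add: ennreal_le_iff)
      then show ?thesis using \<open>e > 0\<close> by simp
    qed
    then show "\<exists>N. \<forall>n\<ge>N. norm ((\<integral>x. (F n x - f x)\<^sup>2 \<partial>M) - 0) < e" by blast
  qed
  with F sqf show ?thesis unfolding L2_lim_def by blast
qed

section \<open>Orthonormal bases and the Riesz representation\<close>

lemma orthonormal_basis_inner:
  assumes "orthonormal_basis B" "b \<in> B" "c \<in> B"
  shows "inner b c = (if b = c then 1 else 0)"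
  using assms unfolding orthonormal_basis_def pairwise_def orthogonal_def
  by (auto simp: dot_square_norm)

text \<open>
  The partial sums of the Fourier expansion are best approximations, so they inherit the density
  of the span.
\<close>
lemma basis_expansion_has_sum:
  assumes B: "orthonormal_basis B"
  shows "((\<lambda>b. inner x b *\<^sub>R b) has_sum x) B"
proof -
  have "\<exists>F0. finite F0 \<and> F0 \<subseteq> B \<and> (\<forall>F. finite F \<and> F0 \<subseteq> F \<and> F \<subseteq> B \<longrightarrow>
      dist (\<Sum>b\<in>F. inner x b *\<^sub>R b) x < e)" if "e > 0" for e
  proof -
    have "x \<in> closure (span B)" using B by (simp add: orthonormal_basis_def)
    then obtain y where y: "y \<in> span B" "dist y x < e"
      using \<open>e > 0\<close> unfolding closure_approachable by blast
    then obtain t r where t: "finite t" "t \<subseteq> B" "y = (\<Sum>b\<in>t. r b *\<^sub>R b)"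
      unfolding span_explicit by blast
    have "dist (\<Sum>b\<in>F. inner x b *\<^sub>R b) x < e" if F: "finite F" "t \<subseteq> F" "F \<subseteq> B" for F
    proof -
      define s where "s b = (if b \<in> t then r b else 0)" for b
      have y': "y = (\<Sum>b\<in>F. s b *\<^sub>R b)"
        unfolding t(3) s_def using F by (intro sum.mono_neutral_cong_left) auto
      have on: "inner b c = (if b = c then 1 else 0)" if "b \<in> F" "c \<in> F" for b c
        using orthonormal_basis_inner[OF B] that F by blast
      have sq: "(norm (x - (\<Sum>b\<in>F. q b *\<^sub>R b)))\<^sup>2
          = (norm x)\<^sup>2 - (\<Sum>b\<in>F. (inner x b)\<^sup>2) + (\<Sum>b\<in>F. (q b - inner x b)\<^sup>2)" for q
      proof -
        have 1: "inner (\<Sum>b\<in>F. q b *\<^sub>R b) (\<Sum>b\<in>F. q b *\<^sub>R b) = (\<Sum>b\<in>F. (q b)\<^sup>2)"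
        proof -
          have "inner (\<Sum>b\<in>F. q b *\<^sub>R b) (\<Sum>b\<in>F. q b *\<^sub>R b)
              = (\<Sum>b\<in>F. \<Sum>c\<in>F. inner (q b *\<^sub>R b) (q c *\<^sub>R c))"
            by (subst inner_sum_left, subst inner_sum_right) (rule refl)
          also have "\<dots> = (\<Sum>b\<in>F. \<Sum>c\<in>F. if b = c then q b * q c else 0)"
            by (intro sum.cong refl) (auto simp: on)
          finally show ?thesis using F by (simp add: power2_eq_square)
        qed
        have 2: "inner x (\<Sum>b\<in>F. q b *\<^sub>R b) = (\<Sum>b\<in>F. q b * inner x b)"
          by (simp add: inner_sum_right)
        have "(norm (x - (\<Sum>b\<in>F. q b *\<^sub>R b)))\<^sup>2
            = (norm x)\<^sup>2 - 2 * (\<Sum>b\<in>F. q b * inner x b) + (\<Sum>b\<in>F. (q b)\<^sup>2)"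
          unfolding power2_norm_eq_inner inner_diff_left inner_diff_right
            inner_commute[of "\<Sum>b\<in>F. q b *\<^sub>R b" x] 1 2 by simp
        moreover have "(\<Sum>b\<in>F. (q b - inner x b)\<^sup>2)
            = (\<Sum>b\<in>F. (q b)\<^sup>2) - 2 * (\<Sum>b\<in>F. q b * inner x b) + (\<Sum>b\<in>F. (inner x b)\<^sup>2)"
          by (simp add: power2_diff sum.distrib sum_subtractf sum_distrib_left mult.assoc)
        ultimately show ?thesis by simp
      qed
      have "(norm (x - (\<Sum>b\<in>F. inner x b *\<^sub>R b)))\<^sup>2 \<le> (norm (x - y))\<^sup>2"
        unfolding y' sq by (simp add: sum_nonneg)
      then have "norm (x - (\<Sum>b\<in>F. inner x b *\<^sub>R b)) \<le> norm (x - y)"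
        by (rule power2_le_imp_le) simp
      with y show ?thesis by (simp add: dist_norm norm_minus_commute)
    qed
    with t show ?thesis by blast
  qed
  then show ?thesis
    unfolding has_sum_def tendsto_iff eventually_finite_subsets_at_top by blast
qed

lemma Parseval_has_sum:
  assumes B: "orthonormal_basis B"
  shows "((\<lambda>b. inner x b * inner y b) has_sum inner x y) B"
  using has_sum_bounded_linear[OF bounded_linear_inner_left[of y] basis_expansion_has_sum[OF B, of x]]
  by (simp add: o_def inner_commute)

lemma Parseval_norm_has_sum:
  assumes B: "orthonormal_basis B"
  shows "((\<lambda>b. (inner x b)\<^sup>2) has_sum (norm x)\<^sup>2) B"
  using Parseval_has_sum[OF B, of x x] by (simp add: power2_eq_square dot_square_norm)

lemma some_basis_orthonormal:
  assumes "\<exists>B::'h::real_inner set. orthonormal_basis B"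
  shows "orthonormal_basis (some_basis :: 'h set)"
  unfolding some_basis_def using assms by (rule someI_ex)

lemma first_order_condition:
  fixes a b :: real
  assumes "\<And>t. 0 \<le> 2 * t * a + t\<^sup>2 * b" "0 \<le> b"
  shows "a = 0"
proof (rule ccontr)
  assume "a \<noteq> 0"
  define t where "t = - a / (b + 1)"
  have "2 * t * a + t\<^sup>2 * b = - (a\<^sup>2 * (b + 2)) / (b + 1)\<^sup>2"
    using \<open>0 \<le> b\<close> unfolding t_def by (simp add: divide_simps power2_eq_square) (simp add: algebra_simps)
  moreover have "- (a\<^sup>2 * (b + 2)) / (b + 1)\<^sup>2 < 0"
    using \<open>0 \<le> b\<close> \<open>a \<noteq> 0\<close> by (simp add: divide_neg_pos)
  ultimately show False using assms(1)[of t] by simp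
qed

text \<open>
  The representing vector is the minimizer of \<open>\<bar>x\<bar>\<^sup>2 - 2 f x\<close>; the parallelogram identity makes every
  minimizing sequence Cauchy.
\<close>
lemma Riesz_representation:
  fixes f :: "'h::{real_inner, complete_space} \<Rightarrow> real"
  assumes f: "bounded_linear f"
  shows "\<exists>u. \<forall>x. f x = inner x u"
proof -
  interpret bounded_linear f by (rule f)
  define J where "J x = (norm x)\<^sup>2 - 2 * f x" for x
  obtain K where K: "\<And>x. norm (f x) \<le> norm x * K" using bounded by blast
  have lb: "- (K\<^sup>2) \<le> J x" for x
  proof -
    have "0 \<le> (norm x - K)\<^sup>2" by simp
    moreover have "f x \<le> norm x * K" using K[of x] by simp
    ultimately show ?thesis unfolding J_def by (simp add: power2_diff)
  qed
  define m where "m = (INF x. J x)"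
  have bdd: "bdd_below (range J)" using lb by (auto intro!: bdd_belowI)
  have m_le: "m \<le> J x" for x unfolding m_def by (rule cINF_lower[OF bdd]) simp
  have "\<exists>x. J x < m + 1 / (real n + 1)" for n
  proof -
    have "m < m + 1 / (real n + 1)" by simp
    then show ?thesis using cINF_less_iff[of UNIV J "m + 1 / (real n + 1)"] bdd unfolding m_def by auto
  qed
  then obtain X where X: "\<And>n. J (X n) < m + 1 / (real n + 1)" by metis
  have par: "(norm (x - y))\<^sup>2 = 2 * (J x + J y - 2 * J ((x + y) /\<^sub>R 2))" for x y
  proof -
    have 1: "f ((x + y) /\<^sub>R 2) = (f x + f y) / 2" by (simp add: add scaleR)
    have 2: "(norm ((x + y) /\<^sub>R 2))\<^sup>2 = (norm (x + y))\<^sup>2 / 4" by (simp add: power_divide)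
    have 3: "(norm (x - y))\<^sup>2 + (norm (x + y))\<^sup>2 = 2 * (norm x)\<^sup>2 + 2 * (norm y)\<^sup>2"
      unfolding power2_norm_eq_inner
      by (simp add: inner_diff_left inner_diff_right inner_add_left inner_add_right)
    show ?thesis using 3 unfolding J_def 1 2 by (simp add: field_simps)
  qed
  have close: "(norm (X p - X q))\<^sup>2 < 2 / (real p + 1) + 2 / (real q + 1)" for p q
    unfolding par using X[of p] X[of q] m_le[of "(X p + X q) /\<^sub>R 2"] by simp
  have "Cauchy X"
  proof (rule metric_CauchyI)
    fix e :: real assume "e > 0"
    obtain N :: nat where N: "4 / e\<^sup>2 < real N" using reals_Archimedean2 by blast
    have "dist (X p) (X q) < e" if "p \<ge> N" "q \<ge> N" for p q
    proof -
      have "0 < 4 / e\<^sup>2" using \<open>e > 0\<close> by simp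
      with N have "0 < real N" by linarith
      have "2 / (real p + 1) \<le> 2 / real N" "2 / (real q + 1) \<le> 2 / real N"
        using that \<open>0 < real N\<close> by (auto intro!: divide_left_mono)
      with close[of p q] have "(norm (X p - X q))\<^sup>2 < 4 / real N" by simp
      also have "\<dots> < e\<^sup>2" using N \<open>e > 0\<close> \<open>0 < real N\<close> by (simp add: field_simps)
      finally show ?thesis using \<open>e > 0\<close> by (simp add: dist_norm power2_less_imp_less)
    qed
    then show "\<exists>N. \<forall>p\<ge>N. \<forall>q\<ge>N. dist (X p) (X q) < e" by blast
  qed
  then obtain u where u: "X \<longlonglongrightarrow> u" using Cauchy_convergent convergent_def by blast
  have "(\<lambda>n. J (X n)) \<longlonglongrightarrow> J u" unfolding J_def by (intro tendsto_intros u tendsto)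
  moreover have "(\<lambda>n. m + 1 / (real n + 1)) \<longlonglongrightarrow> m + 0"
    using LIMSEQ_inverse_real_of_nat by (intro tendsto_intros) (simp add: inverse_eq_divide add.commute)
  ultimately have "J u \<le> m" using X by (intro LIMSEQ_le[where Y="\<lambda>n. m + 1 / (real n + 1)"]) (auto intro: less_imp_le)
  have "f x = inner x u" for x
  proof -
    have "0 \<le> 2 * t * (inner x u - f x) + t\<^sup>2 * (norm x)\<^sup>2" for t
    proof -
      have "J (u + t *\<^sub>R x) - J u = 2 * t * (inner x u - f x) + t\<^sup>2 * (norm x)\<^sup>2"
        unfolding J_def power2_norm_eq_inner
        by (simp add: add scaleR inner_add_left inner_add_right inner_commute[of u x]
            power2_eq_square algebra_simps)
      with m_le[of "u + t *\<^sub>R x"] \<open>J u \<le> m\<close> show ?thesis by linarith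
    qed
    from first_order_condition[OF this] show ?thesis by simp
  qed
  then show ?thesis by blast
qed

section \<open>Norming functionals\<close>

definition sublinear :: "('a::real_vector \<Rightarrow> real) \<Rightarrow> bool" where
  "sublinear p \<longleftrightarrow> (\<forall>x y. p (x + y) \<le> p x + p y) \<and> (\<forall>t x. 0 \<le> t \<longrightarrow> p (t *\<^sub>R x) = t * p x)"

text \<open>
  The largest sublinear functional below \<open>p\<close> with value \<open>- p y\<close> at \<open>- y\<close>, and hence the largest one that
  is linear on the line through \<open>y\<close> and agrees with \<open>p\<close> there at \<open>y\<close>.
\<close>
definition tilt :: "('a::real_vector \<Rightarrow> real) \<Rightarrow> 'a \<Rightarrow> 'a \<Rightarrow> real" where
  "tilt p y x = (INF t\<in>{0..}. p (x + t *\<^sub>R y) - t * p y)"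

lemma sublinear_zero: "sublinear p \<Longrightarrow> p 0 = 0"
  unfolding sublinear_def by (metis mult_zero_left order_refl scale_zero_left)

lemma sublinear_ge_minus: "sublinear p \<Longrightarrow> - p (- x) \<le> p x"
  using sublinear_zero[of p] unfolding sublinear_def by (smt (verit) add.right_inverse)

lemma sublinear_tilt:
  assumes p: "sublinear p"
  shows "sublinear (tilt p y)" "tilt p y x \<le> p x" "tilt p y x \<le> p (x + y) - p y"
proof -
  have sub: "p (a + b) \<le> p a + p b" and hom: "0 \<le> t \<Longrightarrow> p (t *\<^sub>R a) = t * p a" for a b t
    using p by (auto simp: sublinear_def)
  have "- p (- x) \<le> p (x + t *\<^sub>R y) - t * p y" if "0 \<le> t" for x t
    using sub[of "x + t *\<^sub>R y" "- x"] hom[OF that, of y] by simp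
  then have bdd: "bdd_below ((\<lambda>t. p (x + t *\<^sub>R y) - t * p y) ` {0..})" for x
    by (auto intro!: bdd_belowI2)
  have le: "tilt p y x \<le> p (x + t *\<^sub>R y) - t * p y" if "0 \<le> t" for x t
    unfolding tilt_def using that by (intro cINF_lower bdd) auto
  show "tilt p y x \<le> p x" using le[of 0 x] by simp
  show "tilt p y x \<le> p (x + y) - p y" using le[of 1 x] by simp
  have ge: "c \<le> tilt p y x" if "\<And>t. 0 \<le> t \<Longrightarrow> c \<le> p (x + t *\<^sub>R y) - t * p y" for c x
    unfolding tilt_def using that by (intro cINF_greatest) auto
  have add: "tilt p y (a + b) \<le> tilt p y a + tilt p y b" for a b
  proof -
    have "tilt p y (a + b) - (p (b + t *\<^sub>R y) - t * p y) \<le> tilt p y a" if t: "0 \<le> t" for t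
    proof (rule ge)
      fix s :: real assume s: "0 \<le> s"
      have "tilt p y (a + b) \<le> p ((a + b) + (s + t) *\<^sub>R y) - (s + t) * p y"
        using s t by (intro le) simp
      also have "(a + b) + (s + t) *\<^sub>R y = (a + s *\<^sub>R y) + (b + t *\<^sub>R y)"
        by (simp add: algebra_simps)
      also have "p \<dots> \<le> p (a + s *\<^sub>R y) + p (b + t *\<^sub>R y)" by (rule sub)
      finally show "tilt p y (a + b) - (p (b + t *\<^sub>R y) - t * p y) \<le> p (a + s *\<^sub>R y) - s * p y"
        by (simp add: algebra_simps)
    qed
    then have "tilt p y (a + b) - tilt p y a \<le> tilt p y b" by (intro ge) (simp add: algebra_simps)
    then show ?thesis by simp
  qed
  have scale: "tilt p y (s *\<^sub>R a) \<le> s * tilt p y a" if s: "0 < s" for s a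
  proof -
    have "tilt p y (s *\<^sub>R a) / s \<le> tilt p y a"
    proof (rule ge)
      fix t :: real assume t: "0 \<le> t"
      have "tilt p y (s *\<^sub>R a) \<le> p (s *\<^sub>R a + (s * t) *\<^sub>R y) - (s * t) * p y"
        using s t by (intro le) simp
      also have "s *\<^sub>R a + (s * t) *\<^sub>R y = s *\<^sub>R (a + t *\<^sub>R y)" by (simp add: algebra_simps)
      also have "p \<dots> = s * p (a + t *\<^sub>R y)" using s by (intro hom) simp
      finally show "tilt p y (s *\<^sub>R a) / s \<le> p (a + t *\<^sub>R y) - t * p y"
        using s by (simp add: field_simps)
    qed
    then show ?thesis using s by (simp add: field_simps)
  qed
  have z: "tilt p y 0 = 0"
  proof (rule antisym)
    show "tilt p y 0 \<le> 0" using le[of 0 0] sublinear_zero[OF p] by simp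
    show "0 \<le> tilt p y 0" by (rule ge) (simp add: hom)
  qed
  have "tilt p y (s *\<^sub>R a) = s * tilt p y a" if "0 \<le> s" for s a
  proof (cases "s = 0")
    case False
    with that have s: "0 < s" by simp
    have "tilt p y ((1/s) *\<^sub>R (s *\<^sub>R a)) \<le> (1/s) * tilt p y (s *\<^sub>R a)"
      using s by (intro scale) simp
    then have "s * tilt p y a \<le> tilt p y (s *\<^sub>R a)" using s by (simp add: field_simps)
    with scale[OF s, of a] show ?thesis by simp
  qed (simp add: z)
  with add show "sublinear (tilt p y)" by (simp add: sublinear_def)
qed

text \<open>
  A minimal sublinear functional coincides with each of its tilts and is therefore linear. Minimal ones
  exist by Zorn's lemma, because the infimum of a chain is again sublinear.
\<close>
lemma sublinear_dominates_linear:
  assumes p: "sublinear p"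
  shows "\<exists>f. linear f \<and> (\<forall>x. f x \<le> p x)"
proof -
  define A where "A = {q. sublinear q \<and> q \<le> p}"
  have "\<exists>m\<in>A. \<forall>a\<in>A. a \<le> m \<longrightarrow> a = m"
  proof (rule predicate_Zorn[of A "\<lambda>a b. b \<le> a"])
    show "partial_order_on A (relation_of (\<lambda>a b. b \<le> a) A)"
      unfolding partial_order_on_def preorder_on_def refl_on_def trans_def antisym_def relation_of_def
      by (auto intro: order_trans)
  next
    fix C assume "C \<in> Chains (relation_of (\<lambda>a b. b \<le> a) A)"
    then have C: "\<And>q. q \<in> C \<Longrightarrow> q \<in> A" "\<And>q q'. q \<in> C \<Longrightarrow> q' \<in> C \<Longrightarrow> q \<le> q' \<or> q' \<le> q"
      unfolding Chains_def relation_of_def by auto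
    show "\<exists>u\<in>A. \<forall>a\<in>C. u \<le> a"
    proof (cases "C = {}")
      case True
      then show ?thesis using p by (intro bexI[of _ p]) (auto simp: A_def)
    next
      case False
      have sl: "sublinear q" "q x \<le> p x" if "q \<in> C" for q x
        using C(1)[OF that] by (auto simp: A_def le_fun_def)
      define u where "u x = (INF q\<in>C. q x)" for x
      have "- p (- x) \<le> q x" if "q \<in> C" for q x
        using sublinear_ge_minus[OF sl(1)[OF that], of x] sl(2)[OF that, of "- x"] by linarith
      then have bdd: "bdd_below ((\<lambda>q. q x) ` C)" for x by (auto intro!: bdd_belowI2)
      have le: "u x \<le> q x" if "q \<in> C" for q x
        unfolding u_def using that by (intro cINF_lower bdd)
      have ge: "c \<le> u x" if "\<And>q. q \<in> C \<Longrightarrow> c \<le> q x" for c x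
        unfolding u_def using that False by (intro cINF_greatest) auto
      have "u (x + y) \<le> u x + u y" for x y
      proof -
        have "u (x + y) \<le> q x + q' y" if q: "q \<in> C" "q' \<in> C" for q q'
        proof -
          obtain r where r: "r \<in> C" "r \<le> q" "r \<le> q'" using C(2)[OF q] q by auto
          have "u (x + y) \<le> r (x + y)" by (rule le[OF r(1)])
          also have "\<dots> \<le> r x + r y" using sl(1)[OF r(1)] by (simp add: sublinear_def)
          also have "\<dots> \<le> q x + q' y" using r by (simp add: le_fun_def add_mono)
          finally show ?thesis .
        qed
        then have "u (x + y) - q' y \<le> u x" if "q' \<in> C" for q'
          using that by (intro ge) (simp add: algebra_simps)
        then have "u (x + y) - u x \<le> u y" by (intro ge) (simp add: algebra_simps)
        then show ?thesis by simp
      qed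
      moreover have "u (t *\<^sub>R x) = t * u x" if t: "0 \<le> t" for t x
      proof -
        have "(\<lambda>q. q (t *\<^sub>R x)) ` C = (\<lambda>y. t * y) ` (\<lambda>q. q x) ` C"
          using sl(1) t by (auto simp: image_image sublinear_def)
        moreover have "Inf ((\<lambda>y. t * y) ` S) = t * Inf S" if "S \<noteq> {}" "bdd_below S" for S
          using continuous_at_Inf_mono[of "\<lambda>y. t * y" S] that t
          by (simp add: mono_def mult_left_mono continuous_intros)
        ultimately show ?thesis unfolding u_def using bdd False by simp
      qed
      ultimately have "sublinear u" by (simp add: sublinear_def)
      moreover have "u \<le> p"
      proof -
        obtain q where "q \<in> C" using False by auto
        then show ?thesis using le[of q] sl(2)[of q] by (auto simp: le_fun_def intro: order_trans)
      qed
      ultimately show ?thesis using le by (auto simp: A_def le_fun_def)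
    qed
  qed
  then obtain m where m: "sublinear m" "m \<le> p" "\<And>a. sublinear a \<Longrightarrow> a \<le> m \<Longrightarrow> a = m"
    unfolding A_def using order_trans by blast
  have add: "m (x + y) = m x + m y" for x y
  proof -
    have "tilt m y = m" using sublinear_tilt[OF m(1)] by (intro m(3)) (auto simp: le_fun_def)
    then have "m x \<le> m (x + y) - m y" using sublinear_tilt(3)[OF m(1), of y x] by simp
    moreover have "m (x + y) \<le> m x + m y" using m(1) by (simp add: sublinear_def)
    ultimately show ?thesis by linarith
  qed
  have minus: "m (- x) = - m x" for x
    using add[of x "- x"] sublinear_zero[OF m(1)] by simp
  have "m (t *\<^sub>R x) = t *\<^sub>R m x" for t x
  proof (cases "0 \<le> t")
    case True
    then show ?thesis using m(1) by (simp add: sublinear_def)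
  next
    case False
    then have "m ((- t) *\<^sub>R x) = (- t) * m x" using m(1) by (simp only: sublinear_def)
    then show ?thesis using minus[of "t *\<^sub>R x"] by simp
  qed
  with add have "linear m" by (intro linearI) auto
  then show ?thesis using m(2) by (auto simp: le_fun_def)
qed

text \<open>Tilting the norm at \<open>d\<close> first forces the linear minorant to attain the norm there.\<close>
lemma norming_functional:
  fixes d :: "'w::real_normed_vector"
  shows "\<exists>\<phi>::'w \<Rightarrow>\<^sub>L real. (\<forall>x. blinfun_apply \<phi> x \<le> norm x) \<and> blinfun_apply \<phi> d = norm d"
proof -
  have N: "sublinear (norm :: 'w \<Rightarrow> real)" by (auto simp: sublinear_def norm_triangle_ineq)
  obtain f where f: "linear f" "\<And>x. f x \<le> tilt norm d x"
    using sublinear_dominates_linear[OF sublinear_tilt(1)[OF N, of d]] by blast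
  have le: "f x \<le> norm x" for x using f(2)[of x] sublinear_tilt(2)[OF N, of d x] by linarith
  have ge: "norm d \<le> f d"
    using f(2)[of "- d"] sublinear_tilt(3)[OF N, of d "- d"] linear_neg[OF f(1), of d] by simp
  have "\<bar>f x\<bar> \<le> norm x" for x
    using le[of x] le[of "- x"] linear_neg[OF f(1), of x] by simp
  then have "bounded_linear f"
    using linear_add[OF f(1)] linear_scale[OF f(1)]
    by (intro bounded_linear_intro[where K=1]) auto
  then show ?thesis using le ge
    by (intro exI[of _ "Blinfun f"]) (auto simp: bounded_linear_Blinfun_apply intro: antisym)
qed

section \<open>Characteristic functionals determine Borel measures\<close>

text \<open>
  Norming functionals at a countable dense set write closed balls as countable intersections of
  half spaces.
\<close>
lemma borel_eq_sigma_functionals: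
  fixes T :: "'w::{real_normed_vector, second_countable_topology} set set"
  assumes T: "\<And>(\<phi> :: 'w \<Rightarrow>\<^sub>L real) c. {x. blinfun_apply \<phi> x \<le> c} \<in> sigma_sets UNIV T"
    and T': "T \<subseteq> sets borel"
  shows "sets borel = sigma_sets UNIV T"
proof
  interpret sigma_algebra UNIV "sigma_sets UNIV T" by (rule sigma_algebra_sigma_sets) simp
  obtain D :: "'w set" where D: "countable D" "\<And>X. open X \<Longrightarrow> X \<noteq> {} \<Longrightarrow> \<exists>d\<in>D. d \<in> X"
    using countable_dense_setE by blast
  obtain \<Phi> :: "'w \<Rightarrow> 'w \<Rightarrow>\<^sub>L real" where
    \<Phi>: "\<And>d x. blinfun_apply (\<Phi> d) x \<le> norm x" "\<And>d. blinfun_apply (\<Phi> d) d = norm d"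
    using norming_functional by metis
  have ball: "cball c r \<in> sigma_sets UNIV T" for c :: 'w and r
  proof -
    have "norm x \<le> r" if le: "\<And>d. d \<in> D \<Longrightarrow> blinfun_apply (\<Phi> d) x \<le> r" for x
    proof (rule field_le_epsilon)
      fix e :: real assume "e > 0"
      then obtain d where d: "d \<in> D" "d \<in> ball x (e/2)" using D(2)[of "ball x (e/2)"] by auto
      have "norm x \<le> norm d + norm (x - d)" using norm_triangle_sub[of x d] by simp
      moreover have "norm d = blinfun_apply (\<Phi> d) x + blinfun_apply (\<Phi> d) (d - x)"
        by (simp add: blinfun.diff_right \<Phi>)
      moreover have "norm (x - d) < e/2" "norm (d - x) < e/2"
        using d(2) by (simp_all add: dist_norm norm_minus_commute)
      ultimately show "norm x \<le> r + e" using le[OF d(1)] \<Phi>(1)[of d "d - x"] by linarith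
    qed
    then have *: "norm x \<le> r \<longleftrightarrow> (\<forall>d\<in>D. blinfun_apply (\<Phi> d) x \<le> r)" for x
      using \<Phi>(1) order_trans by blast
    have "cball c r = (\<Inter>d\<in>D. {x. blinfun_apply (\<Phi> d) x \<le> r + blinfun_apply (\<Phi> d) c})"
      by (auto simp: dist_norm norm_minus_commute[of c] * blinfun.diff_right diff_le_eq)
    moreover have "D \<noteq> {}" using D(2)[of UNIV] by auto
    ultimately show ?thesis using D(1) T by (auto intro!: countable_INT'')
  qed
  have "open U \<Longrightarrow> U \<in> sigma_sets UNIV T" for U :: "'w set"
  proof -
    assume U: "open U"
    define I where "I = {(d, q). d \<in> D \<and> q \<in> \<rat> \<and> cball d q \<subseteq> U}"
    have "countable I" unfolding I_def
      by (rule countable_subset[OF _ countable_SIGMA[OF D(1) countable_rat]]) auto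
    moreover have "U = (\<Union>(d, q)\<in>I. cball d q)"
    proof (intro equalityI subsetI)
      fix x assume "x \<in> U"
      then obtain e where e: "e > 0" "ball x e \<subseteq> U" using U open_contains_ball by blast
      obtain q where q: "q \<in> \<rat>" "e/4 < q" "q < e/2" using Rats_dense_in_real[of "e/4" "e/2"] e by auto
      obtain d where d: "d \<in> D" "d \<in> ball x (e/4)" using D(2)[of "ball x (e/4)"] e by auto
      have "cball d q \<subseteq> ball x e"
      proof
        fix y assume "y \<in> cball d q"
        then show "y \<in> ball x e" using d q dist_triangle[of x y d] by simp
      qed
      then have "(d, q) \<in> I" using d q e by (auto simp: I_def)
      moreover have "x \<in> cball d q" using d q by (simp add: dist_commute)
      ultimately show "x \<in> (\<Union>(d, q)\<in>I. cball d q)" by blast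
    qed (auto simp: I_def)
    ultimately show ?thesis using ball by (auto intro!: countable_UN')
  qed
  then show "sets borel \<subseteq> sigma_sets UNIV T"
    unfolding borel_def by (auto intro!: sigma_sets_subset)
  show "sigma_sets UNIV T \<subseteq> sets borel"
    using sets.sigma_sets_subset[OF T'] by simp
qed

lemma blinfun_borel_measurable [measurable]:
  "blinfun_apply \<phi> \<in> borel_measurable (borel :: 'w measure)"
  for \<phi> :: "'w::real_normed_vector \<Rightarrow>\<^sub>L real"
  by (intro borel_measurable_continuous_onI) (simp add: continuous_intros)

lemma integrable_bounded_finite_measure:
  fixes f :: "'a \<Rightarrow> 'b::{banach, second_countable_topology}"
  assumes "finite_measure N" "f \<in> borel_measurable N" "\<And>x. norm (f x) \<le> K"
  shows "integrable N f"
proof -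
  interpret finite_measure N by fact
  show ?thesis using assms(2,3) by (intro integrable_const_bound[where B=K]) auto
qed

text \<open>
  The value of the characteristic function at \<open>0\<close> is the total mass, so that both measures can be
  normalized by the same factor.
\<close>
lemma Levy_uniqueness_finite_measure:
  assumes N: "finite_measure N1" "finite_measure N2" "sets N1 = sets borel" "sets N2 = sets borel"
    and char: "\<And>t. (CLINT x|N1. iexp (t * x)) = (CLINT x|N2. iexp (t * x))"
  shows "N1 = (N2 :: real measure)"
proof -
  interpret A: finite_measure N1 by fact
  interpret B: finite_measure N2 by fact
  have sp: "space N1 = UNIV" "space N2 = UNIV"
    using sets_eq_imp_space_eq[OF N(3)] sets_eq_imp_space_eq[OF N(4)] by auto
  define m where "m = measure N1 UNIV"
  have "complex_of_real (measure N1 UNIV) = complex_of_real (measure N2 UNIV)"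
    using char[of 0] by (simp add: sp)
  then have m2: "m = measure N2 UNIV" by (simp add: m_def)
  have em: "emeasure N1 UNIV = ennreal m" "emeasure N2 UNIV = ennreal m"
    using A.emeasure_eq_measure B.emeasure_eq_measure m2 by (auto simp: m_def)
  have "m \<ge> 0" by (simp add: m_def)
  show ?thesis
  proof (cases "m = 0")
    case True
    have "emeasure N1 S = emeasure N2 S" if "S \<in> sets N1" for S
      using emeasure_mono[of S UNIV N1] emeasure_mono[of S UNIV N2] em True N(3,4) sp by auto
    with N(3,4) show ?thesis by (intro measure_eqI) auto
  next
    case False
    with \<open>m \<ge> 0\<close> have m: "m > 0" by simp
    have rd: "real_distribution (scale_measure (ennreal (1/m)) N)"
      if "sets N = sets borel" "emeasure N UNIV = ennreal m" for N :: "real measure"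
    proof -
      have "space N = UNIV" using sets_eq_imp_space_eq[OF that(1)] by auto
      then have "prob_space (scale_measure (ennreal (1/m)) N)"
        using that m by (intro prob_spaceI) (auto simp: space_scale_measure ennreal_mult[symmetric])
      then show ?thesis using that(1)
        by (auto simp: real_distribution_def real_distribution_axioms_def)
    qed
    have sc: "char (scale_measure (ennreal (1/m)) N) t = (CLINT x|N. iexp (t * x)) /\<^sub>R m"
      if "sets N = sets borel" "finite_measure N" for N :: "real measure" and t
    proof -
      have "scale_measure (ennreal (1/m)) N = density N (\<lambda>_. ennreal (1/m))"
        using that by (intro measure_eqI) (auto simp: emeasure_density nn_integral_cmult)
      then have "char (scale_measure (ennreal (1/m)) N) t = (CLINT x|N. (1/m) *\<^sub>R iexp (t * x))"
        unfolding char_def using that m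
        by (simp add: integral_density)
      then show ?thesis by (simp add: inverse_eq_divide)
    qed
    have "char (scale_measure (ennreal (1/m)) N1) = char (scale_measure (ennreal (1/m)) N2)"
      using sc[OF N(3,1)] sc[OF N(4,2)] char by auto
    then have eq: "scale_measure (ennreal (1/m)) N1 = scale_measure (ennreal (1/m)) N2"
      using rd[OF N(3) em(1)] rd[OF N(4) em(2)] Levy_uniqueness by blast
    have unscale: "scale_measure (ennreal m) (scale_measure (ennreal (1/m)) N) = N" for N :: "real measure"
      using m by (simp add: scale_scale_measure ennreal_mult[symmetric])
    from eq have "scale_measure (ennreal m) (scale_measure (ennreal (1/m)) N1) = scale_measure (ennreal m) (scale_measure (ennreal (1/m)) N2)" by simp
    then show ?thesis unfolding unscale .
  qed
qed

text \<open>
  Weights for which the weighted characteristic functionals of \<open>N1\<close> and \<open>N2\<close> agree. The closure of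
  this class under restriction to half spaces, or other preimages under one functional, replaces the
  multivariate uniqueness theorem by repeated use of the univariate one.
\<close>
definition char_agree ::
  "'w::real_normed_vector measure \<Rightarrow> 'w measure \<Rightarrow> ('w \<Rightarrow> real) \<Rightarrow> bool" where
  "char_agree N1 N2 g \<longleftrightarrow> g \<in> borel_measurable borel \<and> (\<forall>x. 0 \<le> g x \<and> g x \<le> 1) \<and>
     (\<forall>\<psi>::'w \<Rightarrow>\<^sub>L real. (CLINT x|N1. g x *\<^sub>R iexp (blinfun_apply \<psi> x))
        = (CLINT x|N2. g x *\<^sub>R iexp (blinfun_apply \<psi> x)))"

text \<open>
  The measures on the line are the images under \<open>\<phi>\<close> of \<open>N1\<close> and \<open>N2\<close> with density \<open>g\<close>. The bound \<open>2\<close> leaves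
  room for a factor \<open>1 + cos\<close> or \<open>1 + sin\<close> next to a weight bounded by \<open>1\<close>.
\<close>
lemma weighted_Levy_uniqueness:
  fixes \<phi> :: "'w::real_normed_vector \<Rightarrow>\<^sub>L real"
  assumes N: "finite_measure N1" "finite_measure N2" "sets N1 = sets borel" "sets N2 = sets borel"
    and g: "g \<in> borel_measurable borel" "\<And>x. 0 \<le> g x" "\<And>x. g x \<le> 2"
    and eq: "\<And>t. (CLINT x|N1. g x *\<^sub>R iexp (t * blinfun_apply \<phi> x))
        = (CLINT x|N2. g x *\<^sub>R iexp (t * blinfun_apply \<phi> x))"
    and S: "S \<in> sets borel"
  shows "(\<integral>x. g x * indicator S (blinfun_apply \<phi> x) \<partial>N1)
    = (\<integral>x. g x * indicator S (blinfun_apply \<phi> x) \<partial>N2)"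
proof -
  define D where "D N = distr (density N (\<lambda>x. ennreal (g x))) borel (blinfun_apply \<phi>)" for N
  have meas: "h \<in> borel_measurable N" if "sets N = sets borel" "h \<in> borel_measurable borel"
    for N and h :: "'w \<Rightarrow> 'z::topological_space"
    using that(2) by (subst measurable_cong_sets[OF that(1) refl])
  have fin: "finite_measure (D N)" if "finite_measure N" "sets N = sets borel" for N
  proof -
    interpret finite_measure N by fact
    have "(\<integral>\<^sup>+x. ennreal (g x) \<partial>N) \<le> (\<integral>\<^sup>+x. ennreal 2 \<partial>N)"
      using g(3) by (intro nn_integral_mono ennreal_leI)
    also have "\<dots> < \<infinity>" using emeasure_finite[of "space N"]
      by (auto simp: ennreal_mult_eq_top_iff less_top[symmetric])
    finally have "emeasure (density N (\<lambda>x. ennreal (g x))) (space N) \<noteq> \<infinity>"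
      using meas[OF that(2) g(1)] by (simp add: emeasure_density)
    then have "finite_measure (density N (\<lambda>x. ennreal (g x)))"
      by (intro finite_measureI) simp
    then show ?thesis unfolding D_def
      by (rule finite_measure.finite_measure_distr[OF _ meas[OF _ blinfun_borel_measurable]])
        (simp add: that(2))
  qed
  have int: "(\<integral>y. h y \<partial>D N) = (\<integral>x. g x *\<^sub>R h (blinfun_apply \<phi> x) \<partial>N)"
    if N: "sets N = sets borel" and h: "h \<in> borel_measurable borel"
    for N and h :: "real \<Rightarrow> 'z::{banach, second_countable_topology}"
  proof -
    have "(\<integral>y. h y \<partial>D N) = (\<integral>x. h (blinfun_apply \<phi> x) \<partial>density N (\<lambda>x. ennreal (g x)))"
      unfolding D_def by (rule integral_distr[OF meas[OF _ blinfun_borel_measurable] h]) (simp add: N)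
    also have "\<dots> = (\<integral>x. g x *\<^sub>R h (blinfun_apply \<phi> x) \<partial>N)"
    proof (rule integral_density)
      show "(\<lambda>x. h (blinfun_apply \<phi> x)) \<in> borel_measurable N"
        by (rule meas[OF N measurable_compose[OF blinfun_borel_measurable h]])
    qed (use meas[OF N g(1)] g(2) in auto)
    finally show ?thesis .
  qed
  have "D N1 = D N2"
  proof (rule Levy_uniqueness_finite_measure)
    show "(CLINT x|D N1. iexp (t * x)) = (CLINT x|D N2. iexp (t * x))" for t
      using int[OF N(3), of "\<lambda>x. iexp (t * x)"] int[OF N(4), of "\<lambda>x. iexp (t * x)"] eq by simp
  qed (use fin N in \<open>simp_all add: D_def\<close>)
  then have "(\<integral>y. indicator S y \<partial>D N1) = (\<integral>y. indicator S y \<partial>D N2 :: real)" by simp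
  then show ?thesis
    using int[OF N(3), of "indicator S :: real \<Rightarrow> real"] int[OF N(4), of "indicator S :: real \<Rightarrow> real"] S
    by simp
qed

text \<open>
  The character of \<open>\<psi>\<close> is not a positive weight, but \<open>1\<close>, \<open>1 + cos \<psi>\<close> and \<open>1 + sin \<psi>\<close> are. Along the line
  of \<open>\<phi>\<close>, the characteristic functions with weights \<open>g cos \<psi>\<close> and \<open>g sin \<psi>\<close> are combinations of the values
  of the one with weight \<open>g\<close> at \<open>t \<phi> + \<psi>\<close> and \<open>t \<phi> - \<psi>\<close>, and these agree by hypothesis. Univariate
  uniqueness then allows restriction to \<open>\<phi> \<in> S\<close>, and subtracting the weight \<open>1\<close> leaves the real and the
  imaginary part of the character.
\<close>
lemma char_agree_restrict:
  fixes \<phi> :: "'w::real_normed_vector \<Rightarrow>\<^sub>L real"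
  assumes N: "finite_measure N1" "finite_measure N2" "sets N1 = sets borel" "sets N2 = sets borel"
    and g: "char_agree N1 N2 g" and S: "S \<in> sets borel"
  shows "char_agree N1 N2 (\<lambda>x. g x * indicator S (blinfun_apply \<phi> x))"
proof -
  have gm: "g \<in> borel_measurable borel" and g0: "0 \<le> g x" and g1: "g x \<le> 1" for x
    using g by (auto simp: char_agree_def)
  have g_eq: "(CLINT x|N1. g x *\<^sub>R iexp (blinfun_apply \<psi> x)) = (CLINT x|N2. g x *\<^sub>R iexp (blinfun_apply \<psi> x))"
    for \<psi> :: "'w \<Rightarrow>\<^sub>L real" using g by (simp add: char_agree_def)
  have meas: "h \<in> borel_measurable N" if "sets N = sets borel" "h \<in> borel_measurable borel"
    for N and h :: "'w \<Rightarrow> 'z::topological_space"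
    using that(2) by (subst measurable_cong_sets[OF that(1) refl])
  have intg: "integrable N (\<lambda>x. (g x * k x) *\<^sub>R h x)"
    if "finite_measure N" "sets N = sets borel" "h \<in> borel_measurable borel" "\<And>x. norm (h x) \<le> 1"
      "k \<in> borel_measurable borel" "\<And>x. \<bar>k x\<bar> \<le> 1"
    for N and h :: "'w \<Rightarrow> 'z::{banach, second_countable_topology}" and k
    using that meas[OF that(2)] gm g0 g1
    by (intro integrable_bounded_finite_measure[where K=1])
      (auto simp: abs_mult intro!: mult_le_one)
  show ?thesis unfolding char_agree_def
  proof (intro conjI allI)
    show "(\<lambda>x. g x * indicator S (blinfun_apply \<phi> x)) \<in> borel_measurable borel"
      using gm S by measurable
    show "0 \<le> g x * indicator S (blinfun_apply \<phi> x)" "g x * indicator S (blinfun_apply \<phi> x) \<le> 1" for x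
      using g0 g1 by (auto simp: indicator_def)
    fix \<psi> :: "'w \<Rightarrow>\<^sub>L real"
    define T where "T k = (\<integral>x. g x * k x * indicator S (blinfun_apply \<phi> x) \<partial>N1)
      - (\<integral>x. g x * k x * indicator S (blinfun_apply \<phi> x) \<partial>N2)" for k
    have T: "T (\<lambda>x. 1 + k x) = 0"
      if k: "k \<in> borel_measurable borel" "\<And>x. \<bar>k x\<bar> \<le> 1"
        and e: "\<And>t. (CLINT x|N1. (g x * k x) *\<^sub>R iexp (blinfun_apply (t *\<^sub>R \<phi>) x))
          = (CLINT x|N2. (g x * k x) *\<^sub>R iexp (blinfun_apply (t *\<^sub>R \<phi>) x))" for k
    proof -
      have "(\<integral>x. g x * (1 + k x) * indicator S (blinfun_apply \<phi> x) \<partial>N1)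
          = (\<integral>x. g x * (1 + k x) * indicator S (blinfun_apply \<phi> x) \<partial>N2)"
      proof (rule weighted_Levy_uniqueness[OF N _ _ _ _ S])
        show "(\<lambda>x. g x * (1 + k x)) \<in> borel_measurable borel" using gm k by measurable
        show "0 \<le> g x * (1 + k x)" "g x * (1 + k x) \<le> 2" for x
          using g0[of x] g1[of x] k(2)[of x] mult_mono[of "g x" 1 "1 + k x" 2] by auto
        fix t
        have "(CLINT x|N. (g x * (1 + k x)) *\<^sub>R iexp (t * blinfun_apply \<phi> x))
          = (CLINT x|N. g x *\<^sub>R iexp (blinfun_apply (t *\<^sub>R \<phi>) x)) + (CLINT x|N. (g x * k x) *\<^sub>R iexp (blinfun_apply (t *\<^sub>R \<phi>) x))"
          if "finite_measure N" "sets N = sets borel" for N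
        proof -
          have "(g x * (1 + k x)) *\<^sub>R iexp (t * blinfun_apply \<phi> x)
              = g x *\<^sub>R iexp (blinfun_apply (t *\<^sub>R \<phi>) x) + (g x * k x) *\<^sub>R iexp (blinfun_apply (t *\<^sub>R \<phi>) x)" for x
            by (simp add: blinfun.scaleR_left distrib_left scaleR_add_left)
          moreover have "integrable N (\<lambda>x. g x *\<^sub>R iexp (blinfun_apply (t *\<^sub>R \<phi>) x))"
            using intg[OF that, of "\<lambda>x. iexp (blinfun_apply (t *\<^sub>R \<phi>) x)" "\<lambda>_. 1"] by simp
          moreover have "integrable N (\<lambda>x. (g x * k x) *\<^sub>R iexp (blinfun_apply (t *\<^sub>R \<phi>) x))"
            by (rule intg[OF that _ _ k]) auto
          ultimately show ?thesis by simp
        qed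
        from this[OF N(1,3)] this[OF N(2,4)]
        show "(CLINT x|N1. (g x * (1 + k x)) *\<^sub>R iexp (t * blinfun_apply \<phi> x))
          = (CLINT x|N2. (g x * (1 + k x)) *\<^sub>R iexp (t * blinfun_apply \<phi> x))"
          unfolding e[of t] g_eq[of "t *\<^sub>R \<phi>"] by (rule trans[OF _ sym])
      qed
      then show ?thesis by (simp add: T_def)
    qed
    have T0: "T (\<lambda>x. 1) = 0" using T[of "\<lambda>_. 0"] by simp
    have split: "T (\<lambda>x. 1 + k x) = T (\<lambda>x. 1) + T k" if k: "k \<in> borel_measurable borel" "\<And>x. \<bar>k x\<bar> \<le> 1" for k
    proof -
      have "(\<integral>x. g x * (1 + k x) * indicator S (blinfun_apply \<phi> x) \<partial>N)
        = (\<integral>x. g x * 1 * indicator S (blinfun_apply \<phi> x) \<partial>N) + (\<integral>x. g x * k x * indicator S (blinfun_apply \<phi> x) \<partial>N)"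
        if "finite_measure N" "sets N = sets borel" for N
      proof -
        have Ind: "(\<lambda>x. indicator S (blinfun_apply \<phi> x) :: real) \<in> borel_measurable borel"
          using S by measurable
        have "g x * (1 + k x) * indicator S (blinfun_apply \<phi> x)
            = g x * 1 * indicator S (blinfun_apply \<phi> x) + g x * k x * indicator S (blinfun_apply \<phi> x)" for x
          by (simp add: distrib_left distrib_right)
        moreover have "integrable N (\<lambda>x. g x * 1 * indicator S (blinfun_apply \<phi> x))"
          using intg[OF that Ind, of "\<lambda>_. 1"] by (simp add: indicator_def)
        moreover have "integrable N (\<lambda>x. g x * k x * indicator S (blinfun_apply \<phi> x))"
          using intg[OF that Ind _ k] by (simp add: indicator_def)
        ultimately show ?thesis by simp
      qed
      from this[OF N(1,3)] this[OF N(2,4)] show ?thesis unfolding T_def by linarith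
    qed
    have half: "(CLINT x|N. (g x * cos (blinfun_apply \<psi> x)) *\<^sub>R iexp (blinfun_apply \<zeta> x))
        = ((CLINT x|N. g x *\<^sub>R iexp (blinfun_apply (\<zeta> + \<psi>) x)) + (CLINT x|N. g x *\<^sub>R iexp (blinfun_apply (\<zeta> - \<psi>) x))) / 2"
      "(CLINT x|N. (g x * sin (blinfun_apply \<psi> x)) *\<^sub>R iexp (blinfun_apply \<zeta> x))
        = ((CLINT x|N. g x *\<^sub>R iexp (blinfun_apply (\<zeta> + \<psi>) x)) - (CLINT x|N. g x *\<^sub>R iexp (blinfun_apply (\<zeta> - \<psi>) x))) / (2 * \<i>)"
      if "finite_measure N" "sets N = sets borel" for N \<zeta>
    proof -
      have i: "integrable N (\<lambda>x. g x *\<^sub>R iexp (blinfun_apply \<eta> x))" for \<eta>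
        using intg[OF that, of "\<lambda>x. iexp (blinfun_apply \<eta> x)" "\<lambda>_. 1"] by simp
      have p: "iexp (blinfun_apply (\<zeta> + \<psi>) x) = iexp (blinfun_apply \<zeta> x) * cis (blinfun_apply \<psi> x)"
        "iexp (blinfun_apply (\<zeta> - \<psi>) x) = iexp (blinfun_apply \<zeta> x) * cis (- blinfun_apply \<psi> x)" for x
        by (simp_all add: blinfun.add_left blinfun.diff_left cis_conv_exp distrib_left right_diff_distrib
            exp_add exp_diff exp_minus divide_inverse)
      have c: "cis y + cis (- y) = 2 * complex_of_real (cos y)"
        "cis y - cis (- y) = 2 * \<i> * complex_of_real (sin y)" for y
        by (simp_all add: complex_eq_iff)
      have "g x *\<^sub>R iexp (blinfun_apply (\<zeta> + \<psi>) x) + g x *\<^sub>R iexp (blinfun_apply (\<zeta> - \<psi>) x)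
          = 2 * ((g x * cos (blinfun_apply \<psi> x)) *\<^sub>R iexp (blinfun_apply \<zeta> x))" for x
        unfolding p scaleR_add_right[symmetric] distrib_left[symmetric] c
        by (simp add: scaleR_conv_of_real)
      then have "(CLINT x|N. g x *\<^sub>R iexp (blinfun_apply (\<zeta> + \<psi>) x)) + (CLINT x|N. g x *\<^sub>R iexp (blinfun_apply (\<zeta> - \<psi>) x))
          = 2 * (CLINT x|N. (g x * cos (blinfun_apply \<psi> x)) *\<^sub>R iexp (blinfun_apply \<zeta> x))"
        using Bochner_Integration.integral_add[OF i i, of "\<zeta> + \<psi>" "\<zeta> - \<psi>"]
        by (simp del: mult_scaleR_right)
      then show "(CLINT x|N. (g x * cos (blinfun_apply \<psi> x)) *\<^sub>R iexp (blinfun_apply \<zeta> x))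
        = ((CLINT x|N. g x *\<^sub>R iexp (blinfun_apply (\<zeta> + \<psi>) x)) + (CLINT x|N. g x *\<^sub>R iexp (blinfun_apply (\<zeta> - \<psi>) x))) / 2"
        by simp
      have "g x *\<^sub>R iexp (blinfun_apply (\<zeta> + \<psi>) x) - g x *\<^sub>R iexp (blinfun_apply (\<zeta> - \<psi>) x)
          = (2 * \<i>) * ((g x * sin (blinfun_apply \<psi> x)) *\<^sub>R iexp (blinfun_apply \<zeta> x))" for x
        unfolding p scaleR_diff_right[symmetric] right_diff_distrib[symmetric] c
        by (simp add: scaleR_conv_of_real)
      then have "(CLINT x|N. g x *\<^sub>R iexp (blinfun_apply (\<zeta> + \<psi>) x)) - (CLINT x|N. g x *\<^sub>R iexp (blinfun_apply (\<zeta> - \<psi>) x))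
          = (2 * \<i>) * (CLINT x|N. (g x * sin (blinfun_apply \<psi> x)) *\<^sub>R iexp (blinfun_apply \<zeta> x))"
        using Bochner_Integration.integral_diff[OF i i, of "\<zeta> + \<psi>" "\<zeta> - \<psi>"]
        by (simp del: mult_scaleR_right)
      then show "(CLINT x|N. (g x * sin (blinfun_apply \<psi> x)) *\<^sub>R iexp (blinfun_apply \<zeta> x))
        = ((CLINT x|N. g x *\<^sub>R iexp (blinfun_apply (\<zeta> + \<psi>) x)) - (CLINT x|N. g x *\<^sub>R iexp (blinfun_apply (\<zeta> - \<psi>) x))) / (2 * \<i>)"
        by simp
    qed
    have cs: "T (\<lambda>x. cos (blinfun_apply \<psi> x)) = 0" "T (\<lambda>x. sin (blinfun_apply \<psi> x)) = 0"
    proof -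
      have "T (\<lambda>x. 1 + cos (blinfun_apply \<psi> x)) = 0"
      proof (rule T)
        show "(\<lambda>x. cos (blinfun_apply \<psi> x)) \<in> borel_measurable borel" by measurable
      qed (simp_all only: half(1)[OF N(1,3)] half(1)[OF N(2,4)] g_eq abs_cos_le_one)
      then show "T (\<lambda>x. cos (blinfun_apply \<psi> x)) = 0" using split T0 by simp
      have "T (\<lambda>x. 1 + sin (blinfun_apply \<psi> x)) = 0"
      proof (rule T)
        show "(\<lambda>x. sin (blinfun_apply \<psi> x)) \<in> borel_measurable borel" by measurable
      qed (simp_all only: half(2)[OF N(1,3)] half(2)[OF N(2,4)] g_eq abs_sin_le_one)
      then show "T (\<lambda>x. sin (blinfun_apply \<psi> x)) = 0" using split T0 by simp
    qed
    have "(CLINT x|N. (g x * indicator S (blinfun_apply \<phi> x)) *\<^sub>R iexp (blinfun_apply \<psi> x))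
      = Complex (\<integral>x. g x * cos (blinfun_apply \<psi> x) * indicator S (blinfun_apply \<phi> x) \<partial>N)
          (\<integral>x. g x * sin (blinfun_apply \<psi> x) * indicator S (blinfun_apply \<phi> x) \<partial>N)" (is "?L = ?R")
      if "finite_measure N" "sets N = sets borel" for N
    proof -
      have "integrable N (\<lambda>x. (g x * indicator S (blinfun_apply \<phi> x)) *\<^sub>R iexp (blinfun_apply \<psi> x))"
        using S by (intro intg[OF that]) (auto simp: indicator_def)
      then have "Re ?L = Re ?R" "Im ?L = Im ?R"
        by (simp_all flip: integral_Re integral_Im add: cis_conv_exp[symmetric] mult_ac)
      then show ?thesis by (rule complex_eqI)
    qed
    with cs N show "(CLINT x|N1. (g x * indicator S (blinfun_apply \<phi> x)) *\<^sub>R iexp (blinfun_apply \<psi> x))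
      = (CLINT x|N2. (g x * indicator S (blinfun_apply \<phi> x)) *\<^sub>R iexp (blinfun_apply \<psi> x))"
      by (simp add: T_def)
  qed
qed

text \<open>
  Starting with the weight \<open>1\<close> and restricting to one half space at a time, the measures agree on finite
  intersections of half spaces. These form a generator of the Borel sets that is stable under intersection.
\<close>
theorem characteristic_functional_unique:
  fixes N1 N2 :: "'w::{real_normed_vector, second_countable_topology} measure"
  assumes N: "finite_measure N1" "finite_measure N2" "sets N1 = sets borel" "sets N2 = sets borel"
    and char: "\<And>\<phi>::'w \<Rightarrow>\<^sub>L real. (CLINT x|N1. iexp (blinfun_apply \<phi> x)) = (CLINT x|N2. iexp (blinfun_apply \<phi> x))"
  shows "N1 = N2"
proof -
  define cyl where "cyl = (\<lambda>cs :: (('w \<Rightarrow>\<^sub>L real) \<times> real) list. {x. \<forall>(\<phi>, c)\<in>set cs. blinfun_apply \<phi> x \<le> c})"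
  have cyl_app: "cyl (cs @ ds) = cyl cs \<inter> cyl ds" for cs ds by (auto simp: cyl_def)
  have cyl_Cons: "cyl ((\<phi>, c) # cs) = {x. blinfun_apply \<phi> x \<le> c} \<inter> cyl cs" for \<phi> c cs
    by (auto simp: cyl_def)
  have cyl_sets: "cyl cs \<in> sets borel" for cs
  proof (induction cs)
    case (Cons p cs)
    then show ?case by (cases p) (auto simp: cyl_Cons intro!: sets.Int)
  qed (simp add: cyl_def)
  have agree: "char_agree N1 N2 (indicator (cyl cs))" for cs
  proof (induction cs)
    case Nil
    then show ?case using char by (simp add: char_agree_def cyl_def)
  next
    case (Cons p cs)
    obtain \<phi> c where p: "p = (\<phi>, c)" by (cases p)
    have "indicator (cyl (p # cs)) = (\<lambda>x. indicator (cyl cs) x * indicator {..c} (blinfun_apply \<phi> x) :: real)"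
      by (auto simp: p cyl_Cons indicator_def)
    then show ?case using char_agree_restrict[OF N Cons.IH, of "{..c}" \<phi>] by simp
  qed
  have mcyl: "measure N1 (cyl cs) = measure N2 (cyl cs)" for cs
  proof -
    \<comment> \<open>At the functional \<open>0\<close> the weighted characteristic functional is the integral of the weight.\<close>
    have "(CLINT x|N1. indicator (cyl cs) x *\<^sub>R iexp (blinfun_apply 0 x))
      = (CLINT x|N2. indicator (cyl cs) x *\<^sub>R iexp (blinfun_apply 0 x))"
      using agree[of cs] unfolding char_agree_def by blast
    then have "(CLINT x|N1. complex_of_real (indicator (cyl cs) x)) = (CLINT x|N2. complex_of_real (indicator (cyl cs) x))"
      by (simp add: scaleR_conv_of_real)
    then show ?thesis using cyl_sets N(3,4) sets_eq_imp_space_eq[OF N(3)] sets_eq_imp_space_eq[OF N(4)]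
      by (simp add: integral_complex_of_real)
  qed
  show ?thesis
  proof (rule measure_eqI_generator_eq[where \<Omega>=UNIV and E="range cyl" and A="\<lambda>_. UNIV"])
    show "Int_stable (range cyl)"
      unfolding Int_stable_def by (auto simp flip: cyl_app)
    have gen: "sets borel = sigma_sets UNIV (range cyl)"
    proof (rule borel_eq_sigma_functionals)
      fix \<phi> :: "'w \<Rightarrow>\<^sub>L real" and c
      have "{x. blinfun_apply \<phi> x \<le> c} = cyl [(\<phi>, c)]" by (simp add: cyl_def)
      then show "{x. blinfun_apply \<phi> x \<le> c} \<in> sigma_sets UNIV (range cyl)" by auto
    qed (use cyl_sets in auto)
    with N show "sets N1 = sigma_sets UNIV (range cyl)" "sets N2 = sigma_sets UNIV (range cyl)" by auto
    have "cyl [] = UNIV" by (simp add: cyl_def)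
    then show "range (\<lambda>_::nat. UNIV) \<subseteq> range cyl" by auto
    fix X assume "X \<in> range cyl"
    then show "emeasure N1 X = emeasure N2 X"
      using mcyl finite_measure.emeasure_eq_measure[OF N(1)] finite_measure.emeasure_eq_measure[OF N(2)] by auto
  next
    show "emeasure N1 UNIV \<noteq> \<infinity>" using finite_measure.emeasure_finite[OF N(1)] by simp
  qed auto
qed

section \<open>The dual of an abstract Wiener space\<close>

lemma infdist_subspace_sublinear:
  fixes S :: "'a::real_normed_vector set"
  assumes S: "subspace S"
  shows "sublinear (\<lambda>x. infdist x S)"
proof -
  have ne: "S \<noteq> {}" using subspace_0[OF S] by blast
  have le: "infdist (x + y) S \<le> infdist x S + infdist y S" for x y
  proof -
    have "infdist (x + y) S - dist x a \<le> infdist y S" if a: "a \<in> S" for a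
    proof -
      have "infdist (x + y) S - dist x a \<le> dist y b" if b: "b \<in> S" for b
      proof -
        have "infdist (x + y) S \<le> dist (x + y) (a + b)"
          using subspace_add[OF S a b] by (rule infdist_le)
        also have "\<dots> \<le> dist x a + dist y b" by (rule dist_triangle_add)
        finally show ?thesis by simp
      qed
      then show ?thesis unfolding infdist_notempty[OF ne, of y] by (rule cINF_greatest[OF ne])
    qed
    then have "infdist (x + y) S - infdist y S \<le> dist x a" if "a \<in> S" for a
      using that by (simp add: algebra_simps)
    then have "infdist (x + y) S - infdist y S \<le> infdist x S"
      unfolding infdist_notempty[OF ne, of x] by (rule cINF_greatest[OF ne])
    then show ?thesis by simp
  qed
  have sc: "infdist (t *\<^sub>R x) S \<le> t * infdist x S" if t: "t > 0" for t x
  proof -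
    have "infdist (t *\<^sub>R x) S / t \<le> dist x a" if a: "a \<in> S" for a
    proof -
      have "infdist (t *\<^sub>R x) S \<le> dist (t *\<^sub>R x) (t *\<^sub>R a)"
        using subspace_scale[OF S a] by (rule infdist_le)
      also have "\<dots> = t * dist x a" using t by (simp add: dist_norm flip: scaleR_diff_right)
      finally show ?thesis using t by (simp add: field_simps)
    qed
    then have "infdist (t *\<^sub>R x) S / t \<le> infdist x S"
      unfolding infdist_notempty[OF ne, of x] by (rule cINF_greatest[OF ne])
    then show ?thesis using t by (simp add: field_simps)
  qed
  have "infdist (t *\<^sub>R x) S = t * infdist x S" if "t \<ge> 0" for t x
  proof (cases "t = 0")
    case True
    then show ?thesis using infdist_le[OF subspace_0[OF S], of 0] infdist_nonneg[of 0 S] by simp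
  next
    case False
    with that have t: "t > 0" by simp
    have "infdist ((1/t) *\<^sub>R (t *\<^sub>R x)) S \<le> (1/t) * infdist (t *\<^sub>R x) S" using t by (intro sc) simp
    then have "t * infdist x S \<le> infdist (t *\<^sub>R x) S" using t by (simp add: field_simps)
    with sc[OF t, of x] show ?thesis by simp
  qed
  with le show ?thesis by (simp add: sublinear_def)
qed

text \<open>
  The distance to \<open>S\<close> is sublinear. Off the closure of \<open>S\<close> it dominates a linear functional that attains it at
  a given point, and the vector representing this functional is nonzero and orthogonal to \<open>S\<close>.
\<close>
lemma dense_subspaceI:
  fixes S :: "'h::{real_inner, complete_space} set"
  assumes S: "subspace S" and orth: "\<And>u. (\<And>s. s \<in> S \<Longrightarrow> inner s u = 0) \<Longrightarrow> u = 0"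
  shows "closure S = UNIV"
proof (rule ccontr)
  assume "closure S \<noteq> UNIV"
  then obtain h where h: "h \<notin> closure S" by auto
  define p where "p x = infdist x S" for x
  have p: "sublinear p" unfolding p_def by (rule infdist_subspace_sublinear[OF S])
  obtain f where f: "linear f" "\<And>x. f x \<le> tilt p h x"
    using sublinear_dominates_linear[OF sublinear_tilt(1)[OF p, of h]] by blast
  have le: "f x \<le> p x" for x using f(2)[of x] sublinear_tilt(2)[OF p, of h x] by linarith
  have "p h \<le> f h"
    using f(2)[of "- h"] sublinear_tilt(3)[OF p, of h "- h"] linear_neg[OF f(1), of h]
      sublinear_zero[OF p] by simp
  have pS: "p s = 0" if "s \<in> S" for s using that by (simp add: p_def)
  have p_norm: "p x \<le> norm x" for x using infdist_le[OF subspace_0[OF S], of x] by (simp add: p_def)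
  have "\<bar>f x\<bar> \<le> norm x" for x
    using le[of x] le[of "- x"] p_norm[of x] p_norm[of "- x"] linear_neg[OF f(1), of x] by simp
  then have "bounded_linear f"
    using linear_add[OF f(1)] linear_scale[OF f(1)] by (intro bounded_linear_intro[where K=1]) auto
  then obtain u where u: "\<And>x. f x = inner x u" using Riesz_representation by blast
  have "inner s u = 0" if "s \<in> S" for s
    using le[of s] le[of "- s"] pS[OF that] pS[OF subspace_neg[OF S that]]
      linear_neg[OF f(1), of s] u by simp
  then have "u = 0" by (rule orth)
  then have "p h \<le> 0" using \<open>p h \<le> f h\<close> u by simp
  moreover have "p h \<noteq> 0"
    using h in_closure_iff_infdist_zero[of S h] subspace_0[OF S] by (auto simp: p_def)
  ultimately show False using infdist_nonneg[of h S] by (simp add: p_def)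
qed

context abstract_wiener_space
begin

abbreviation J :: "('w \<Rightarrow>\<^sub>L real) \<Rightarrow> 'h" where "J \<equiv> dual_embed \<iota>"

lemma apply_embedding: "blinfun_apply \<phi> (\<iota> x) = inner x (J \<phi>)"
proof -
  have "bounded_linear (\<lambda>x. blinfun_apply \<phi> (\<iota> x))"
    by (rule bounded_linear_compose[OF blinfun.bounded_linear_right bounded_linear_embedding])
  then obtain u where u: "\<forall>x. blinfun_apply \<phi> (\<iota> x) = inner x u"
    using Riesz_representation by blast
  have "J \<phi> = u" unfolding dual_embed_def
  proof (rule the_equality[of _ u])
    fix v assume "\<forall>x. blinfun_apply \<phi> (\<iota> x) = inner x v"
    with u have "inner x v = inner x u" for x by metis
    then have "inner (v - u) (v - u) = 0" by (simp add: inner_diff_right)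
    then show "v = u" by simp
  qed (rule u)
  with u show ?thesis by simp
qed

lemma J_eqI: "(\<And>x. blinfun_apply \<phi> (\<iota> x) = inner x u) \<Longrightarrow> J \<phi> = u"
proof -
  assume "\<And>x. blinfun_apply \<phi> (\<iota> x) = inner x u"
  then have "inner x (J \<phi> - u) = 0" for x by (simp add: apply_embedding inner_diff_right)
  from this[of "J \<phi> - u"] show ?thesis by simp
qed

lemma J_add: "J (\<phi> + \<psi>) = J \<phi> + J \<psi>"
  and J_diff: "J (\<phi> - \<psi>) = J \<phi> - J \<psi>"
  and J_scaleR: "J (c *\<^sub>R \<phi>) = c *\<^sub>R J \<phi>"
  and J_zero: "J 0 = 0"
  by (rule J_eqI; simp add: blinfun.add_left blinfun.diff_left blinfun.scaleR_left
      inner_add_right inner_diff_right flip: apply_embedding)+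

text \<open>
  A vector \<open>u\<close> orthogonal to all \<open>J \<phi>\<close> satisfies \<open>\<phi> (\<iota> u) = 0\<close> for all \<open>\<phi>\<close>. A norming functional then gives
  \<open>\<iota> u = 0\<close>, and the embedding is injective.
\<close>
lemma J_dense: "closure (range J) = UNIV"
proof (rule dense_subspaceI)
  show "subspace (range J)"
    unfolding subspace_def by (auto simp flip: J_zero J_add J_scaleR)
  fix u assume orth: "\<And>s. s \<in> range J \<Longrightarrow> inner s u = 0"
  obtain \<phi> :: "'w \<Rightarrow>\<^sub>L real" where \<phi>: "blinfun_apply \<phi> (\<iota> u) = norm (\<iota> u)"
    using norming_functional by blast
  have "norm (\<iota> u) = 0"
    unfolding \<phi>[symmetric] apply_embedding using orth[of "J \<phi>"] by (simp add: inner_commute)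
  then show "u = 0"
    using inj_embedding bounded_linear.linear[OF bounded_linear_embedding] linear_0 injD
    by (metis norm_eq_zero)
qed

lemma J_approx: "\<exists>\<phi>. (\<lambda>n::nat. J (\<phi> n)) \<longlonglongrightarrow> h"
proof -
  have "h \<in> closure (range J)" by (simp add: J_dense)
  then obtain x where x: "\<And>n. x n \<in> range J" "x \<longlonglongrightarrow> h" unfolding closure_sequential by blast
  then have "\<forall>n. \<exists>\<phi>. x n = J \<phi>" by blast
  then obtain \<phi> where "\<And>n. x n = J (\<phi> n)" by metis
  then have "x = (\<lambda>n. J (\<phi> n))" by (rule ext)
  with x(2) show ?thesis by blast
qed

lemma sets_mu: "sets \<mu> = sets borel" and prob_space_mu: "prob_space \<mu>"
  using gaussian by (auto simp: gaussian_measure_def)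

sublocale mu: prob_space \<mu> by (rule prob_space_mu)

lemma measurable_mu: "f \<in> borel_measurable borel \<Longrightarrow> f \<in> borel_measurable \<mu>"
  by (subst measurable_cong_sets[OF sets_mu refl])

lemma functional_measurable [measurable]:
  "blinfun_apply \<phi> \<in> borel_measurable \<mu>" for \<phi> :: "'w \<Rightarrow>\<^sub>L real"
  by (rule measurable_mu[OF blinfun_borel_measurable])

section \<open>Moments\<close>

lemma functional_distr:
  "distr \<mu> borel (blinfun_apply \<phi>) = distr std_normal_distribution borel (\<lambda>x. norm (J \<phi>) * x)"
proof (rule Levy_uniqueness)
  interpret S: real_distribution std_normal_distribution by (rule real_dist_normal_dist)
  show "real_distribution (distr \<mu> borel (blinfun_apply \<phi>))"
    by (intro mu.real_distribution_distr) simp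
  show "real_distribution (distr std_normal_distribution borel (\<lambda>x. norm (J \<phi>) * x))"
    by (intro S.real_distribution_distr) simp
  show "char (distr \<mu> borel (blinfun_apply \<phi>)) = char (distr std_normal_distribution borel (\<lambda>x. norm (J \<phi>) * x))"
  proof
    fix t
    have "char (distr \<mu> borel (blinfun_apply \<phi>)) t = (CLINT w|\<mu>. iexp (blinfun_apply (t *\<^sub>R \<phi>) w))"
      unfolding char_def by (subst integral_distr) (auto simp: blinfun.scaleR_left)
    also have "\<dots> = char std_normal_distribution (t * norm (J \<phi>))"
      unfolding characteristic_functional char_std_normal_distribution
      by (simp add: J_scaleR power_mult_distrib)
    also have "\<dots> = char (distr std_normal_distribution borel (\<lambda>x. norm (J \<phi>) * x)) t"
      unfolding char_def by (subst integral_distr) (auto simp: mult.assoc)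
    finally show "char (distr \<mu> borel (blinfun_apply \<phi>)) t
      = char (distr std_normal_distribution borel (\<lambda>x. norm (J \<phi>) * x)) t" .
  qed
qed

text \<open>
  Integrability of all powers makes these weights an algebra. It contains the functionals, which provides
  every integral in the integration by parts below.
\<close>
definition moments :: "('w \<Rightarrow> real) \<Rightarrow> bool" where
  "moments G \<longleftrightarrow> G \<in> borel_measurable \<mu> \<and> (\<forall>n::nat. integrable \<mu> (\<lambda>w. \<bar>G w\<bar> ^ n))"

lemma moments_measurable: "moments G \<Longrightarrow> G \<in> borel_measurable \<mu>"
  by (simp add: moments_def)

lemma moments_functional: "moments (blinfun_apply \<phi>)"
proof -
  have "integrable std_normal_distribution (\<lambda>x. \<bar>norm (J \<phi>) * x\<bar> ^ n)" for n
  proof -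
    have "integrable std_normal_distribution (\<lambda>x. \<bar>norm (J \<phi>) ^ n * x ^ n\<bar>)"
      using integrable_std_normal_distribution_moment by (intro integrable_abs integrable_mult_right)
    then show ?thesis by (simp add: abs_mult power_abs power_mult_distrib)
  qed
  then have "integrable (distr \<mu> borel (blinfun_apply \<phi>)) (\<lambda>x. \<bar>x\<bar> ^ n)" for n
    unfolding functional_distr by (subst integrable_distr_eq) auto
  then have "integrable \<mu> (\<lambda>w. \<bar>blinfun_apply \<phi> w\<bar> ^ n)" for n
    by (subst (asm) integrable_distr_eq) auto
  then show ?thesis by (simp add: moments_def)
qed

lemma moments_const: "moments (\<lambda>w. c)"
  by (simp add: moments_def)

lemma moments_mult:
  assumes G: "moments G" and K: "moments K"
  shows "moments (\<lambda>w. G w * K w)"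
proof -
  note [measurable] = G[THEN moments_measurable] K[THEN moments_measurable]
  have "integrable \<mu> (\<lambda>w. \<bar>G w * K w\<bar> ^ n)" for n
  proof (rule Bochner_Integration.integrable_bound)
    show "integrable \<mu> (\<lambda>w. \<bar>G w\<bar> ^ (2 * n) + \<bar>K w\<bar> ^ (2 * n))"
      using G K by (auto simp: moments_def)
    have "norm (\<bar>a * b\<bar> ^ n) \<le> norm (\<bar>a\<bar> ^ (2 * n) + \<bar>b\<bar> ^ (2 * n))" for a b :: real
    proof -
      have "0 \<le> \<bar>a\<bar>^n * \<bar>b\<bar>^n" by simp
      moreover have "2 * \<bar>a\<bar>^n * \<bar>b\<bar>^n \<le> (\<bar>a\<bar>^n)\<^sup>2 + (\<bar>b\<bar>^n)\<^sup>2" by (rule sum_squares_bound)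
      ultimately have "\<bar>a\<bar>^n * \<bar>b\<bar>^n \<le> (\<bar>a\<bar>^n)\<^sup>2 + (\<bar>b\<bar>^n)\<^sup>2" by linarith
      moreover have "(\<bar>a\<bar>^n)\<^sup>2 = \<bar>a\<bar>^(2*n)" "(\<bar>b\<bar>^n)\<^sup>2 = \<bar>b\<bar>^(2*n)"
        by (simp_all add: power_mult[symmetric] mult.commute)
      ultimately show ?thesis by (simp add: abs_mult power_mult_distrib)
    qed
    then show "AE w in \<mu>. norm (\<bar>G w * K w\<bar> ^ n) \<le> norm (\<bar>G w\<bar> ^ (2 * n) + \<bar>K w\<bar> ^ (2 * n))"
      by (intro AE_I2)
  qed measurable
  then show ?thesis by (simp add: moments_def)
qed

lemma moments_add:
  assumes G: "moments G" and K: "moments K"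
  shows "moments (\<lambda>w. G w + K w)"
proof -
  note [measurable] = G[THEN moments_measurable] K[THEN moments_measurable]
  have "integrable \<mu> (\<lambda>w. \<bar>G w + K w\<bar> ^ n)" for n
  proof (rule Bochner_Integration.integrable_bound)
    show "integrable \<mu> (\<lambda>w. 2 ^ n * (\<bar>G w\<bar> ^ n + \<bar>K w\<bar> ^ n))"
      using G K by (auto simp: moments_def)
    have "norm (\<bar>a + b\<bar> ^ n) \<le> norm (2 ^ n * (\<bar>a\<bar> ^ n + \<bar>b\<bar> ^ n))" for a b :: real
    proof -
      have "\<bar>a + b\<bar> ^ n \<le> (2 * max \<bar>a\<bar> \<bar>b\<bar>) ^ n" by (intro power_mono) auto
      also have "\<dots> = 2 ^ n * (max \<bar>a\<bar> \<bar>b\<bar>) ^ n" by (rule power_mult_distrib)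
      also have "(max \<bar>a\<bar> \<bar>b\<bar>) ^ n \<le> \<bar>a\<bar> ^ n + \<bar>b\<bar> ^ n" by (simp add: max_def)
      finally show ?thesis by (simp add: mult_left_mono)
    qed
    then show "AE w in \<mu>. norm (\<bar>G w + K w\<bar> ^ n) \<le> norm (2 ^ n * (\<bar>G w\<bar> ^ n + \<bar>K w\<bar> ^ n))"
      by (intro AE_I2)
  qed measurable
  then show ?thesis by (simp add: moments_def)
qed

lemma moments_cmult: "moments G \<Longrightarrow> moments (\<lambda>w. c * G w)"
  by (rule moments_mult[OF moments_const])

lemma moments_diff: "moments G \<Longrightarrow> moments K \<Longrightarrow> moments (\<lambda>w. G w - K w)"
  using moments_add[of G "\<lambda>w. (-1) * K w"] moments_cmult[of K "-1"] by simp

lemma moments_integrable: "moments G \<Longrightarrow> integrable \<mu> G"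
  using integrable_abs_cancel[of \<mu> G] by (auto simp: moments_def dest: spec[of _ 1])

lemma moments_square_integrable: "moments G \<Longrightarrow> square_integrable \<mu> G"
  by (auto simp: moments_def square_integrable_def dest!: spec[of _ 2])

lemma moments_hermite: "moments (\<lambda>w. hermite k s (blinfun_apply \<phi> w))"
proof (induction k rule: induct_nat_012)
  case (ge2 n)
  then show ?case
    by (auto intro!: moments_diff moments_mult moments_functional moments_const)
qed (auto intro: moments_const moments_functional)

end

context abstract_wiener_space
begin

section \<open>Gaussian integration by parts\<close>

definition char_int :: "('w \<Rightarrow> real) \<Rightarrow> ('w \<Rightarrow>\<^sub>L real) \<Rightarrow> complex" where
  "char_int G \<eta> = (CLINT w|\<mu>. complex_of_real (G w) * iexp (blinfun_apply \<eta> w))"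

lemma char_int_integrable:
  "moments G \<Longrightarrow> integrable \<mu> (\<lambda>w. complex_of_real (G w) * iexp (blinfun_apply \<eta> w))"
proof (rule Bochner_Integration.integrable_bound[OF moments_integrable])
  assume m: "moments G"
  note [measurable] = moments_measurable[OF m]
  show "(\<lambda>w. complex_of_real (G w) * iexp (blinfun_apply \<eta> w)) \<in> borel_measurable \<mu>"
    by measurable
  show "AE w in \<mu>. norm (complex_of_real (G w) * iexp (blinfun_apply \<eta> w)) \<le> norm (G w)"
    by (rule AE_I2) (simp add: norm_mult)
qed

lemma char_int_lincomb:
  "moments G \<Longrightarrow> moments K \<Longrightarrow>
    char_int (\<lambda>w. a * G w + b * K w) \<eta> = of_real a * char_int G \<eta> + of_real b * char_int K \<eta>"
proof -
  assume m: "moments G" "moments K"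
  have "complex_of_real (a * G w + b * K w) * iexp (blinfun_apply \<eta> w)
      = of_real a * (complex_of_real (G w) * iexp (blinfun_apply \<eta> w))
        + of_real b * (complex_of_real (K w) * iexp (blinfun_apply \<eta> w))" for w
    by (simp only: of_real_add of_real_mult distrib_right mult.assoc)
  then have "char_int (\<lambda>w. a * G w + b * K w) \<eta>
      = (CLINT w|\<mu>. of_real a * (complex_of_real (G w) * iexp (blinfun_apply \<eta> w))
        + of_real b * (complex_of_real (K w) * iexp (blinfun_apply \<eta> w)))"
    unfolding char_int_def by (simp only:)
  also have "\<dots> = of_real a * char_int G \<eta> + of_real b * char_int K \<eta>"
    unfolding char_int_def
    by (simp only: Bochner_Integration.integral_add[OF integrable_mult_right[OF char_int_integrable[OF m(1)]]
        integrable_mult_right[OF char_int_integrable[OF m(2)]]] integral_mult_right_zero)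
  finally show ?thesis .
qed

lemma char_int_one: "char_int (\<lambda>w. 1) \<eta> = complex_of_real (exp (- (norm (J \<eta>))\<^sup>2 / 2))"
  by (simp add: char_int_def characteristic_functional)

lemma char_int_at_0: "char_int G 0 = complex_of_real (\<integral>w. G w \<partial>\<mu>)"
  by (simp add: char_int_def integral_complex_of_real)

lemma iexp_quotient_tendsto:
  "(\<lambda>n. (iexp (x / real (Suc n)) - 1) * real (Suc n)) \<longlonglongrightarrow> \<i> * complex_of_real x"
proof -
  have 1: "((\<lambda>h. (exp (c * h) - 1) / h) \<longlongrightarrow> c) (at 0)" for c :: complex
  proof -
    have "((\<lambda>z. exp (c * z)) has_field_derivative exp (c * 0) * c) (at 0)"
      by (rule DERIV_fun_exp[OF DERIV_cmult_Id])
    then show ?thesis using DERIV_D[of "\<lambda>z. exp (c * z)" _ 0] by simp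
  qed
  have "(\<lambda>n. complex_of_real (inverse (real (Suc n)))) \<longlonglongrightarrow> complex_of_real 0"
    by (rule tendsto_of_real[OF LIMSEQ_inverse_real_of_nat])
  then have 2: "filterlim (\<lambda>n. complex_of_real (inverse (real (Suc n)))) (at 0) sequentially"
    unfolding filterlim_at by (simp del: of_nat_Suc of_real_inverse)
  have "(exp (\<i> * complex_of_real x * complex_of_real (inverse (real (Suc n)))) - 1) / complex_of_real (inverse (real (Suc n)))
    = (iexp (x / real (Suc n)) - 1) * real (Suc n)" for n
    by (simp add: divide_inverse mult.assoc del: of_nat_Suc)
  with filterlim_compose[OF 1[of "\<i> * complex_of_real x"] 2] show ?thesis
    by (simp del: of_nat_Suc of_real_inverse)
qed

text \<open>
  Differentiation under the integral in the direction \<open>\<psi>\<close>: the difference quotients of the character are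
  dominated by \<open>\<bar>\<psi>\<bar>\<close>.
\<close>
lemma char_int_quotient:
  assumes G: "moments G"
  shows "(\<lambda>n. (char_int G (\<eta> + (1 / real (Suc n)) *\<^sub>R \<psi>) - char_int G \<eta>) * real (Suc n))
    \<longlonglongrightarrow> \<i> * char_int (\<lambda>w. blinfun_apply \<psi> w * G w) \<eta>"
proof -
  note [measurable] = moments_measurable[OF G]
  define s where "s n w = complex_of_real (G w) * iexp (blinfun_apply \<eta> w)
    * ((iexp (blinfun_apply \<psi> w / real (Suc n)) - 1) * real (Suc n))" for n w
  have "(\<lambda>n. CLINT w|\<mu>. s n w) \<longlonglongrightarrow> (CLINT w|\<mu>. complex_of_real (G w) * iexp (blinfun_apply \<eta> w) * (\<i> * complex_of_real (blinfun_apply \<psi> w)))"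
  proof (rule integral_dominated_convergence[where w="\<lambda>w. \<bar>blinfun_apply \<psi> w * G w\<bar>"])
    show "integrable \<mu> (\<lambda>w. \<bar>blinfun_apply \<psi> w * G w\<bar>)"
      by (intro integrable_abs moments_integrable moments_mult moments_functional G)
    show "AE w in \<mu>. (\<lambda>n. s n w) \<longlonglongrightarrow> complex_of_real (G w) * iexp (blinfun_apply \<eta> w) * (\<i> * complex_of_real (blinfun_apply \<psi> w))"
      unfolding s_def by (intro AE_I2 tendsto_mult tendsto_const iexp_quotient_tendsto)
    show "AE w in \<mu>. norm (s n w) \<le> \<bar>blinfun_apply \<psi> w * G w\<bar>" for n
    proof (intro AE_I2)
      fix w
      have "norm (iexp (blinfun_apply \<psi> w / real (Suc n)) - 1) \<le> \<bar>blinfun_apply \<psi> w / real (Suc n)\<bar>"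
        using iexp_approx1[of "blinfun_apply \<psi> w / real (Suc n)" 0] by simp
      then have "norm (iexp (blinfun_apply \<psi> w / real (Suc n)) - 1) * real (Suc n) \<le> \<bar>blinfun_apply \<psi> w\<bar>"
        by (simp add: field_simps del: of_nat_Suc)
      then have "\<bar>G w\<bar> * (norm (iexp (blinfun_apply \<psi> w / real (Suc n)) - 1) * real (Suc n)) \<le> \<bar>G w\<bar> * \<bar>blinfun_apply \<psi> w\<bar>"
        by (rule mult_left_mono) simp
      then show "norm (s n w) \<le> \<bar>blinfun_apply \<psi> w * G w\<bar>"
        unfolding s_def norm_mult by (simp add: abs_mult mult_ac del: of_nat_Suc)
    qed
  qed (auto simp: s_def)
  moreover have "(CLINT w|\<mu>. s n w) = (char_int G (\<eta> + (1 / real (Suc n)) *\<^sub>R \<psi>) - char_int G \<eta>) * real (Suc n)" for n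
  proof -
    have "s n w = (complex_of_real (G w) * iexp (blinfun_apply (\<eta> + (1 / real (Suc n)) *\<^sub>R \<psi>) w)
        - complex_of_real (G w) * iexp (blinfun_apply \<eta> w)) * real (Suc n)" for w
    proof -
      have "iexp (blinfun_apply (\<eta> + (1 / real (Suc n)) *\<^sub>R \<psi>) w)
          = iexp (blinfun_apply \<eta> w) * iexp (blinfun_apply \<psi> w / real (Suc n))"
        by (simp add: blinfun.add_left blinfun.scaleR_left distrib_left exp_add del: of_nat_Suc)
      moreover have "g * e * ((f - 1) * r) = (g * (e * f) - g * e) * r" for g e f r :: complex
        by (simp add: algebra_simps)
      ultimately show ?thesis unfolding s_def by simp
    qed
    then show ?thesis
      unfolding char_int_def using char_int_integrable[OF G] by (simp del: of_nat_Suc)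
  qed
  moreover have "(CLINT w|\<mu>. complex_of_real (G w) * iexp (blinfun_apply \<eta> w) * (\<i> * complex_of_real (blinfun_apply \<psi> w)))
      = \<i> * char_int (\<lambda>w. blinfun_apply \<psi> w * G w) \<eta>"
    unfolding char_int_def by (subst integral_mult_right_zero[symmetric]) (simp add: mult_ac)
  ultimately show ?thesis by simp
qed

lemma char_int_shift_tendsto:
  assumes G: "moments G"
  shows "(\<lambda>n. char_int G (\<eta> + (1 / real (Suc n)) *\<^sub>R \<psi>)) \<longlonglongrightarrow> char_int G \<eta>"
proof -
  have "(\<lambda>n. (char_int G (\<eta> + (1 / real (Suc n)) *\<^sub>R \<psi>) - char_int G \<eta>) * real (Suc n)
      * complex_of_real (inverse (real (Suc n)))) \<longlonglongrightarrow> \<i> * char_int (\<lambda>w. blinfun_apply \<psi> w * G w) \<eta> * of_real 0"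
    by (intro tendsto_intros char_int_quotient G LIMSEQ_inverse_real_of_nat)
  then have "(\<lambda>n. char_int G (\<eta> + (1 / real (Suc n)) *\<^sub>R \<psi>) - char_int G \<eta>) \<longlonglongrightarrow> 0"
  proof -
    have "complex_of_real (real (Suc n)) * complex_of_real (inverse (real (Suc n))) = 1" for n
      unfolding of_real_mult[symmetric] by (simp del: of_nat_Suc)
    with \<open>_ \<longlonglongrightarrow> _\<close> show ?thesis by (simp only: mult.assoc) simp
  qed
  then show ?thesis using LIM_zero_iff by blast
qed

text \<open>
  \<open>stein \<phi> G G'\<close> is Gaussian integration by parts for \<open>G\<close> in the direction \<open>\<phi>\<close>: \<open>G'\<close> is the
  derivative of \<open>G\<close> along \<open>J \<phi>\<close>. The character makes the class stable under multiplication by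
  functionals, because these arise by differentiation in \<open>\<eta>\<close>.
\<close>
definition stein :: "('w \<Rightarrow>\<^sub>L real) \<Rightarrow> ('w \<Rightarrow> real) \<Rightarrow> ('w \<Rightarrow> real) \<Rightarrow> bool" where
  "stein \<phi> G G' \<longleftrightarrow> moments G \<and> moments G' \<and>
     (\<forall>\<eta>. char_int (\<lambda>w. blinfun_apply \<phi> w * G w) \<eta>
        = char_int G' \<eta> + \<i> * of_real (inner (J \<phi>) (J \<eta>)) * char_int G \<eta>)"

text \<open>
  The derivative of \<open>char_int (\<lambda>w. 1)\<close> in the direction \<open>\<phi>\<close> is computed twice, from the integral and from
  the explicit Gaussian characteristic functional.
\<close>
lemma stein_one: "stein \<phi> (\<lambda>w. 1) (\<lambda>w. 0)"
proof -
  have "char_int (\<lambda>w. blinfun_apply \<phi> w * 1) \<eta> = \<i> * of_real (inner (J \<phi>) (J \<eta>)) * char_int (\<lambda>w. 1) \<eta>" for \<eta>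
  proof -
    define a b c where "a = (norm (J \<eta>))\<^sup>2" and "b = inner (J \<phi>) (J \<eta>)" and "c = (norm (J \<phi>))\<^sup>2"
    define e where "e s = exp (- (a + 2 * s * b + s\<^sup>2 * c) / 2)" for s
    have nrm: "(norm (J (\<eta> + s *\<^sub>R \<phi>)))\<^sup>2 = a + 2 * s * b + s\<^sup>2 * c" for s
      unfolding a_def b_def c_def power2_norm_eq_inner J_add J_scaleR inner_add_left inner_add_right
        inner_scaleR_left inner_scaleR_right inner_commute[of "J \<eta>" "J \<phi>"]
      by (simp add: power2_eq_square distrib_left mult.assoc)
    have "(e has_real_derivative - b * exp (- a / 2)) (at 0)"
      unfolding e_def by (auto intro!: derivative_eq_intros)
    then have 1: "((\<lambda>h. (e h - e 0) / h) \<longlongrightarrow> - b * exp (- a / 2)) (at 0)"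
      using DERIV_D[of e _ 0] by simp
    have 2: "filterlim (\<lambda>n. inverse (real (Suc n))) (at 0) sequentially"
      unfolding filterlim_at using LIMSEQ_inverse_real_of_nat by (simp del: of_nat_Suc)
    have q: "(e (inverse (real (Suc n))) - e 0) / inverse (real (Suc n)) = (e (1 / real (Suc n)) - e 0) * real (Suc n)" for n
      by (simp add: inverse_eq_divide del: of_nat_Suc)
    have "(\<lambda>n. (e (1 / real (Suc n)) - e 0) * real (Suc n)) \<longlonglongrightarrow> - b * exp (- a / 2)"
      using filterlim_compose[OF 1 2] unfolding q .
    then have "(\<lambda>n. complex_of_real ((e (1 / real (Suc n)) - e 0) * real (Suc n))) \<longlonglongrightarrow> complex_of_real (- b * exp (- a / 2))"
      by (rule tendsto_of_real)
    moreover have "(\<lambda>n. complex_of_real ((e (1 / real (Suc n)) - e 0) * real (Suc n))) \<longlonglongrightarrow> \<i> * char_int (\<lambda>w. blinfun_apply \<phi> w * 1) \<eta>"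
    proof -
      have "char_int (\<lambda>w. 1) (\<eta> + s *\<^sub>R \<phi>) = complex_of_real (e s)" for s
        unfolding char_int_one nrm e_def ..
      moreover have "char_int (\<lambda>w. 1) \<eta> = complex_of_real (e 0)"
        unfolding char_int_one e_def a_def by simp
      ultimately show ?thesis
        using char_int_quotient[OF moments_const[of 1], of \<eta> \<phi>]
        by (simp only: of_real_diff of_real_mult)
    qed
    ultimately have "complex_of_real (- b * exp (- a / 2)) = \<i> * char_int (\<lambda>w. blinfun_apply \<phi> w * 1) \<eta>"
      by (rule LIMSEQ_unique)
    then have "- \<i> * complex_of_real (- b * exp (- a / 2)) = - \<i> * (\<i> * char_int (\<lambda>w. blinfun_apply \<phi> w * 1) \<eta>)"
      by simp
    then show ?thesis by (simp add: char_int_one a_def b_def mult.assoc[symmetric])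
  qed
  moreover have "char_int (\<lambda>w. 0) \<eta> = 0" for \<eta> by (simp add: char_int_def)
  ultimately show ?thesis by (simp add: stein_def moments_const)
qed

lemma stein_lincomb:
  assumes "stein \<phi> G G'" "stein \<phi> K K'"
  shows "stein \<phi> (\<lambda>w. a * G w + b * K w) (\<lambda>w. a * G' w + b * K' w)"
proof -
  have m: "moments G" "moments G'" "moments K" "moments K'" using assms by (auto simp: stein_def)
  have "(\<lambda>w. blinfun_apply \<phi> w * (a * G w + b * K w)) = (\<lambda>w. a * (blinfun_apply \<phi> w * G w) + b * (blinfun_apply \<phi> w * K w))"
    by (auto simp: algebra_simps)
  then show ?thesis using assms m unfolding stein_def
    by (simp add: char_int_lincomb moments_add moments_cmult moments_mult moments_functional algebra_simps)
qed

text \<open>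
  Differentiate the identity for \<open>G\<close> in \<open>\<eta>\<close> along \<open>\<psi>\<close>. The inner product \<open>\<langle>J \<phi>, J \<eta>\<rangle>\<close> contributes the extra term
  \<open>\<langle>J \<phi>, J \<psi>\<rangle> G\<close>, as the product rule demands.
\<close>
lemma stein_mult_functional:
  assumes st: "stein \<phi> G G'"
  shows "stein \<phi> (\<lambda>w. blinfun_apply \<psi> w * G w) (\<lambda>w. blinfun_apply \<psi> w * G' w + inner (J \<phi>) (J \<psi>) * G w)"
proof -
  have m: "moments G" "moments G'" using st by (auto simp: stein_def)
  have m': "moments (\<lambda>w. blinfun_apply \<psi> w * G w)" "moments (\<lambda>w. blinfun_apply \<psi> w * G' w)"
    "moments (\<lambda>w. blinfun_apply \<phi> w * G w)"
    by (intro moments_mult moments_functional m)+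
  have "char_int (\<lambda>w. blinfun_apply \<phi> w * (blinfun_apply \<psi> w * G w)) \<eta>
    = char_int (\<lambda>w. blinfun_apply \<psi> w * G' w + inner (J \<phi>) (J \<psi>) * G w) \<eta>
      + \<i> * of_real (inner (J \<phi>) (J \<eta>)) * char_int (\<lambda>w. blinfun_apply \<psi> w * G w) \<eta>" for \<eta>
  proof -
    define Q where "Q K n = (char_int K (\<eta> + (1 / real (Suc n)) *\<^sub>R \<psi>) - char_int K \<eta>) * complex_of_real (real (Suc n))" for K n
    have Q: "Q K \<longlonglongrightarrow> \<i> * char_int (\<lambda>w. blinfun_apply \<psi> w * K w) \<eta>" if "moments K" for K
      using char_int_quotient[OF that, of \<eta> \<psi>] unfolding Q_def by simp
    have st': "char_int (\<lambda>w. blinfun_apply \<phi> w * G w) \<zeta> = char_int G' \<zeta> + \<i> * of_real (inner (J \<phi>) (J \<zeta>)) * char_int G \<zeta>" for \<zeta>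
      using st by (simp add: stein_def)
    have "Q (\<lambda>w. blinfun_apply \<phi> w * G w) n = Q G' n + \<i> * of_real (inner (J \<phi>) (J \<eta>)) * Q G n
        + \<i> * of_real (inner (J \<phi>) (J \<psi>)) * char_int G (\<eta> + (1 / real (Suc n)) *\<^sub>R \<psi>)" for n
    proof -
      define r where "r = real (Suc n)"
      have r: "r \<noteq> 0" by (simp add: r_def)
      have e: "complex_of_real (inner (J \<phi>) (J (\<eta> + (1 / r) *\<^sub>R \<psi>))) = of_real (inner (J \<phi>) (J \<eta>)) + of_real (inner (J \<phi>) (J \<psi>)) / of_real r"
        by (simp add: J_add J_scaleR inner_add_right)
      show ?thesis unfolding Q_def st' r_def[symmetric] e using r by (simp add: field_simps)
    qed
    moreover have "(\<lambda>n. Q G' n + \<i> * of_real (inner (J \<phi>) (J \<eta>)) * Q G n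
        + \<i> * of_real (inner (J \<phi>) (J \<psi>)) * char_int G (\<eta> + (1 / real (Suc n)) *\<^sub>R \<psi>))
      \<longlonglongrightarrow> \<i> * char_int (\<lambda>w. blinfun_apply \<psi> w * G' w) \<eta>
        + \<i> * of_real (inner (J \<phi>) (J \<eta>)) * (\<i> * char_int (\<lambda>w. blinfun_apply \<psi> w * G w) \<eta>)
        + \<i> * of_real (inner (J \<phi>) (J \<psi>)) * char_int G \<eta>"
      by (intro tendsto_intros Q m char_int_shift_tendsto)
    ultimately have "\<i> * char_int (\<lambda>w. blinfun_apply \<psi> w * (blinfun_apply \<phi> w * G w)) \<eta>
      = \<i> * char_int (\<lambda>w. blinfun_apply \<psi> w * G' w) \<eta>
        + \<i> * of_real (inner (J \<phi>) (J \<eta>)) * (\<i> * char_int (\<lambda>w. blinfun_apply \<psi> w * G w) \<eta>)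
        + \<i> * of_real (inner (J \<phi>) (J \<psi>)) * char_int G \<eta>"
      using Q[OF m'(3)] LIMSEQ_unique by (metis (no_types, lifting) ext)
    also have "\<dots> = \<i> * (char_int (\<lambda>w. blinfun_apply \<psi> w * G' w) \<eta> + of_real (inner (J \<phi>) (J \<psi>)) * char_int G \<eta>
        + \<i> * of_real (inner (J \<phi>) (J \<eta>)) * char_int (\<lambda>w. blinfun_apply \<psi> w * G w) \<eta>)"
      by (simp add: algebra_simps)
    finally show ?thesis
      using char_int_lincomb[OF m'(2) m(1), of 1 "inner (J \<phi>) (J \<psi>)" \<eta>]
      by (simp add: mult.left_commute)
  qed
  then show ?thesis using m m'
    by (simp add: stein_def moments_add moments_cmult)
qed

lemma hermite_Suc: "hermite (Suc k) s x = x * hermite k s x - real k * s * hermite (k - 1) s x"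
  by (cases k) auto

text \<open>
  The product rule, with \<open>k \<langle>J \<phi>, J \<psi>\<rangle> H \<psi> (k - 1)\<close> for the derivative of \<open>H \<psi> k\<close> along \<open>J \<phi>\<close>. It follows from
  the three-term recursion of the Hermite polynomials.
\<close>
lemma stein_hermite:
  assumes st: "stein \<phi> G G'"
  defines "H \<equiv> \<lambda>\<psi> k w. hermite k ((norm (J \<psi>))\<^sup>2) (blinfun_apply \<psi> w)"
  shows "stein \<phi> (\<lambda>w. H \<psi> k w * G w) (\<lambda>w. H \<psi> k w * G' w + real k * inner (J \<phi>) (J \<psi>) * (H \<psi> (k - 1) w * G w))"
proof (induction k rule: induct_nat_012)
  case 0
  then show ?case using st by (simp add: H_def)
next
  case 1
  then show ?case using stein_mult_functional[OF st, of \<psi>] by (simp add: H_def)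
next
  case (ge2 k)
  define b \<tau> where "b = inner (J \<phi>) (J \<psi>)" and "\<tau> = (norm (J \<psi>))\<^sup>2"
  have rec: "H \<psi> (Suc k) w = blinfun_apply \<psi> w * H \<psi> k w - real k * \<tau> * H \<psi> (k - 1) w" for k w
    unfolding H_def \<tau>_def by (rule hermite_Suc)
  have "stein \<phi> (\<lambda>w. 1 * (blinfun_apply \<psi> w * (H \<psi> (Suc k) w * G w)) + (- (real (Suc k) * \<tau>)) * (H \<psi> k w * G w))
    (\<lambda>w. 1 * (blinfun_apply \<psi> w * (H \<psi> (Suc k) w * G' w + real (Suc k) * inner (J \<phi>) (J \<psi>) * (H \<psi> (Suc k - 1) w * G w))
        + inner (J \<phi>) (J \<psi>) * (H \<psi> (Suc k) w * G w))
      + (- (real (Suc k) * \<tau>)) * (H \<psi> k w * G' w + real k * inner (J \<phi>) (J \<psi>) * (H \<psi> (k - 1) w * G w)))"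
    by (rule stein_lincomb[OF stein_mult_functional[OF ge2(2)] ge2(1)])
  moreover have "(\<lambda>w. 1 * (blinfun_apply \<psi> w * (H \<psi> (Suc k) w * G w)) + (- (real (Suc k) * \<tau>)) * (H \<psi> k w * G w))
      = (\<lambda>w. H \<psi> (Suc (Suc k)) w * G w)"
    unfolding rec[of "Suc k"] by (auto simp: algebra_simps)
  moreover have "(\<lambda>w. 1 * (blinfun_apply \<psi> w * (H \<psi> (Suc k) w * G' w + real (Suc k) * inner (J \<phi>) (J \<psi>) * (H \<psi> (Suc k - 1) w * G w))
        + inner (J \<phi>) (J \<psi>) * (H \<psi> (Suc k) w * G w))
      + (- (real (Suc k) * \<tau>)) * (H \<psi> k w * G' w + real k * inner (J \<phi>) (J \<psi>) * (H \<psi> (k - 1) w * G w)))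
    = (\<lambda>w. H \<psi> (Suc (Suc k)) w * G' w + real (Suc (Suc k)) * inner (J \<phi>) (J \<psi>) * (H \<psi> (Suc (Suc k) - 1) w * G w))"
  proof
    fix w
    define x h p where "x = blinfun_apply \<psi> w" and "h = H \<psi> k w" and "p = H \<psi> (k - 1) w"
    show "1 * (blinfun_apply \<psi> w * (H \<psi> (Suc k) w * G' w + real (Suc k) * inner (J \<phi>) (J \<psi>) * (H \<psi> (Suc k - 1) w * G w))
        + inner (J \<phi>) (J \<psi>) * (H \<psi> (Suc k) w * G w))
      + (- (real (Suc k) * \<tau>)) * (H \<psi> k w * G' w + real k * inner (J \<phi>) (J \<psi>) * (H \<psi> (k - 1) w * G w))
    = H \<psi> (Suc (Suc k)) w * G' w + real (Suc (Suc k)) * inner (J \<phi>) (J \<psi>) * (H \<psi> (Suc (Suc k) - 1) w * G w)"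
      unfolding rec[of "Suc k"] diff_Suc_1 rec[of k]
      unfolding x_def[symmetric] h_def[symmetric] p_def[symmetric] b_def[symmetric]
      by (simp add: algebra_simps)
  qed
  ultimately show ?case by simp
qed

text \<open>
  Integration by parts in the direction \<open>\<phi>\<close> itself: the derivative of \<open>H k\<close> cancels against the second term of
  the recursion for \<open>H (Suc k)\<close>, so that only \<open>G\<close> is differentiated.
\<close>
lemma hermite_raise:
  assumes st: "stein \<phi> G G'"
  defines "H \<equiv> \<lambda>k w. hermite k ((norm (J \<phi>))\<^sup>2) (blinfun_apply \<phi> w)"
  shows "char_int (\<lambda>w. H (Suc k) w * G w) \<eta>
    = char_int (\<lambda>w. H k w * G' w) \<eta> + \<i> * of_real (inner (J \<phi>) (J \<eta>)) * char_int (\<lambda>w. H k w * G w) \<eta>"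
proof -
  define \<sigma> where "\<sigma> = (norm (J \<phi>))\<^sup>2"
  have m: "moments G" "moments G'" using st by (auto simp: stein_def)
  have mH: "moments (H k)" for k unfolding H_def by (rule moments_hermite)
  have mHG: "moments (\<lambda>w. H k w * G w)" "moments (\<lambda>w. H k w * G' w)" for k
    by (intro moments_mult mH m)+
  have "stein \<phi> (\<lambda>w. H k w * G w) (\<lambda>w. H k w * G' w + real k * \<sigma> * (H (k - 1) w * G w))"
    using stein_hermite[OF st, where \<psi>=\<phi> and k=k] unfolding H_def \<sigma>_def by (simp add: power2_norm_eq_inner)
  then have *: "char_int (\<lambda>w. blinfun_apply \<phi> w * (H k w * G w)) \<eta>
      = char_int (\<lambda>w. H k w * G' w + real k * \<sigma> * (H (k - 1) w * G w)) \<eta>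
        + \<i> * of_real (inner (J \<phi>) (J \<eta>)) * char_int (\<lambda>w. H k w * G w) \<eta>"
    by (simp add: stein_def)
  have "(\<lambda>w. H (Suc k) w * G w) = (\<lambda>w. 1 * (blinfun_apply \<phi> w * (H k w * G w)) + (- (real k * \<sigma>)) * (H (k - 1) w * G w))"
    unfolding H_def hermite_Suc \<sigma>_def by (auto simp: algebra_simps)
  then have "char_int (\<lambda>w. H (Suc k) w * G w) \<eta>
      = char_int (\<lambda>w. blinfun_apply \<phi> w * (H k w * G w)) \<eta> - of_real (real k * \<sigma>) * char_int (\<lambda>w. H (k - 1) w * G w) \<eta>"
    using char_int_lincomb[OF moments_mult[OF moments_functional[of \<phi>] mHG(1)[of k]] mHG(1)[of "k - 1"], of 1 "- (real k * \<sigma>)" \<eta>]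
    by simp
  then show ?thesis unfolding *
    using char_int_lincomb[OF mHG(2)[of k] mHG(1)[of "k - 1"], of 1 "real k * \<sigma>" \<eta>] by simp
qed

lemma char_int_hermite:
  "char_int (\<lambda>w. hermite k ((norm (J \<phi>))\<^sup>2) (blinfun_apply \<phi> w)) \<eta>
    = (\<i> * of_real (inner (J \<phi>) (J \<eta>))) ^ k * of_real (exp (- (norm (J \<eta>))\<^sup>2 / 2))"
proof (induction k)
  case 0
  then show ?case by (simp add: char_int_one)
next
  case (Suc k)
  have "char_int (\<lambda>w. 0) \<eta> = 0" by (simp add: char_int_def)
  with hermite_raise[where \<phi>=\<phi> and k=k and \<eta>=\<eta>, OF stein_one] Suc show ?case by (simp add: mult_ac)
qed

text \<open>
  At \<open>\<eta> = 0\<close>, raising moves one degree of the first factor onto the second as a derivative. This gives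
  the integral for degrees \<open>k\<close> and \<open>l - 1\<close>, times \<open>l \<langle>J \<phi>, J \<psi>\<rangle>\<close>.
\<close>
theorem hermite_orthogonal:
  "(\<integral>w. hermite k ((norm (J \<phi>))\<^sup>2) (blinfun_apply \<phi> w) * hermite l ((norm (J \<psi>))\<^sup>2) (blinfun_apply \<psi> w) \<partial>\<mu>)
    = (if k = l then fact k * (inner (J \<phi>) (J \<psi>)) ^ k else 0)"
proof (induction k arbitrary: l)
  case 0
  have "complex_of_real (\<integral>w. hermite l ((norm (J \<psi>))\<^sup>2) (blinfun_apply \<psi> w) \<partial>\<mu>) = complex_of_real (if l = 0 then 1 else 0)"
    using char_int_hermite[of l \<psi> 0] unfolding char_int_at_0 by (auto simp: J_zero)
  then show ?case unfolding of_real_eq_iff by auto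
next
  case (Suc k)
  define H where "H \<zeta> k w = hermite k ((norm (J \<zeta>))\<^sup>2) (blinfun_apply \<zeta> w)" for \<zeta> k w
  have "stein \<phi> (\<lambda>w. H \<psi> l w) (\<lambda>w. real l * inner (J \<phi>) (J \<psi>) * H \<psi> (l - 1) w)"
    using stein_hermite[where \<phi>=\<phi> and \<psi>=\<psi> and k=l, OF stein_one] unfolding H_def by simp
  from hermite_raise[OF this, where k=k and \<eta>=0]
  have "complex_of_real (\<integral>w. H \<phi> (Suc k) w * H \<psi> l w \<partial>\<mu>)
      = complex_of_real (\<integral>w. real l * inner (J \<phi>) (J \<psi>) * (H \<phi> k w * H \<psi> (l - 1) w) \<partial>\<mu>)"
    unfolding char_int_at_0 H_def[symmetric] by (simp add: J_zero mult_ac)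
  then have "(\<integral>w. H \<phi> (Suc k) w * H \<psi> l w \<partial>\<mu>)
      = real l * inner (J \<phi>) (J \<psi>) * (\<integral>w. H \<phi> k w * H \<psi> (l - 1) w \<partial>\<mu>)"
    unfolding of_real_eq_iff by simp
  also have "(\<integral>w. H \<phi> k w * H \<psi> (l - 1) w \<partial>\<mu>) = (if k = l - 1 then fact k * (inner (J \<phi>) (J \<psi>)) ^ k else 0)"
    using Suc[of "l - 1"] by (simp add: H_def)
  finally show ?case unfolding H_def by (cases l) auto
qed

end

section \<open>Hilbert-Schmidt forms\<close>

text \<open>
  Tensors become square integrable functions on the tuples with counting measure, so that mean-square
  limits serve for tensors and for random variables alike.
\<close>
lemma infsum_eq_integral_count_space:
  fixes f :: "'a \<Rightarrow> real"
  shows "infsum f A = (\<integral>x. f x \<partial>count_space A)"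
    and "f summable_on A \<longleftrightarrow> integrable (count_space A) f"
proof -
  show 1: "f summable_on A \<longleftrightarrow> integrable (count_space A) f"
    using summable_on_iff_abs_summable_on_real[of f A] abs_summable_equivalent[of f A]
    by (simp add: abs_summable_on_def)
  show "infsum f A = (\<integral>x. f x \<partial>count_space A)"
  proof (cases "f summable_on A")
    case True
    then have "infsetsum f A = infsum f A"
      using 1 by (intro infsetsum_infsum) (simp add: abs_summable_on_def)
    then show ?thesis by (simp add: infsetsum_def)
  next
    case False
    with 1 show ?thesis by (simp add: infsum_not_exists not_integrable_integral_eq)
  qed
qed

lemma has_sum_product_real:
  fixes f :: "'a \<Rightarrow> real" and g :: "'b \<Rightarrow> real"
  assumes f: "(f has_sum a) A" and g: "(g has_sum b) C"
  shows "((\<lambda>(x, y). f x * g y) has_sum a * b) (A \<times> C)"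
proof (rule has_sum_SigmaI)
  show "((\<lambda>y. case (x, y) of (x, y) \<Rightarrow> f x * g y) has_sum f x * b) C" for x
    using has_sum_cmult_right[OF g, of "f x"] by simp
  show "((\<lambda>x. f x * b) has_sum a * b) A" by (rule has_sum_cmult_left[OF f])
  have fa: "(\<lambda>x. norm (f x)) summable_on A" and ga: "(\<lambda>y. norm (g y)) summable_on C"
    by (intro summable_on_iff_abs_summable_on_real[THEN iffD1] has_sum_imp_summable[OF f] has_sum_imp_summable[OF g])+
  have "(\<lambda>p. norm (case p of (x, y) \<Rightarrow> f x * g y)) summable_on (A \<times> C)"
    unfolding Infinite_Sum.abs_summable_on_Sigma_iff
  proof (intro conjI ballI)
    show "(\<lambda>y. norm (case (x, y) of (x, y) \<Rightarrow> f x * g y)) summable_on C" for x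
      using summable_on_cmult_right[OF ga, of "\<bar>f x\<bar>"] by (simp add: abs_mult)
    have "(\<lambda>x. \<bar>f x\<bar> * infsum (\<lambda>y. \<bar>g y\<bar>) C) summable_on A"
      using summable_on_cmult_left[OF fa] by simp
    then have "(\<lambda>x. norm (\<bar>f x\<bar> * infsum (\<lambda>y. \<bar>g y\<bar>) C)) summable_on A"
      by (rule summable_on_iff_abs_summable_on_real[THEN iffD1])
    then show "(\<lambda>x. norm (infsum (\<lambda>y. norm (case (x, y) of (x, y) \<Rightarrow> f x * g y)) C)) summable_on A"
      by (simp add: abs_mult infsum_cmult_right')
  qed
  then show "(\<lambda>(x, y). f x * g y) summable_on A \<times> C"
    by (rule summable_on_iff_abs_summable_on_real[THEN iffD2])
qed

abbreviation tuples :: "nat \<Rightarrow> 'h::real_inner list measure" where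
  "tuples k \<equiv> count_space (basis_tuples k)"

lemma tensor_inner_integral: "tensor_inner k u v = (\<integral>bs. u bs * v bs \<partial>tuples k)"
  by (simp add: tensor_inner_def infsum_eq_integral_count_space)

lemma tensor_space_square_integrable: "u \<in> tensor_space k \<Longrightarrow> square_integrable (tuples k) u"
  by (simp add: tensor_space_def square_integrable_def flip: infsum_eq_integral_count_space)

lemma tensor_space_length: "u \<in> tensor_space k \<Longrightarrow> length xs \<noteq> k \<Longrightarrow> u xs = 0"
  by (simp add: tensor_space_def)

lemma tensor_space_linear:
  "u \<in> tensor_space k \<Longrightarrow> length xs = k \<Longrightarrow> i < k \<Longrightarrow> linear (\<lambda>x. u (xs[i := x]))"
  by (simp add: tensor_space_def)

lemma tensor_space_bounded:
  assumes "u \<in> tensor_space k"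
  obtains C where "C \<ge> 0" "\<And>xs. length xs = k \<Longrightarrow> \<bar>u xs\<bar> \<le> C * (\<Prod>i<k. norm (xs ! i))"
proof -
  obtain C where C: "\<And>xs. length xs = k \<Longrightarrow> \<bar>u xs\<bar> \<le> C * (\<Prod>i<k. norm (xs ! i))"
    using assms unfolding tensor_space_def by blast
  have "\<bar>u xs\<bar> \<le> \<bar>C\<bar> * (\<Prod>i<k. norm (xs ! i))" if "length xs = k" for xs
    using C[OF that] mult_right_mono[OF abs_ge_self[of C], of "\<Prod>i<k. norm (xs ! i)"]
    by (simp add: prod_nonneg)
  then show ?thesis using that[of "\<bar>C\<bar>"] by simp
qed

lemma tensor_space_lincomb:
  assumes u: "u \<in> tensor_space k" and v: "v \<in> tensor_space k"
  shows "(\<lambda>xs. a * u xs + b * v xs) \<in> tensor_space k"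
proof -
  obtain C where C: "\<And>xs. length xs = k \<Longrightarrow> \<bar>u xs\<bar> \<le> C * (\<Prod>i<k. norm (xs ! i))"
    using tensor_space_bounded[OF u] by blast
  obtain D where D: "\<And>xs. length xs = k \<Longrightarrow> \<bar>v xs\<bar> \<le> D * (\<Prod>i<k. norm (xs ! i))"
    using tensor_space_bounded[OF v] by blast
  have "\<bar>a * u xs + b * v xs\<bar> \<le> (\<bar>a\<bar> * C + \<bar>b\<bar> * D) * (\<Prod>i<k. norm (xs ! i))" if "length xs = k" for xs
  proof -
    have "\<bar>a * u xs + b * v xs\<bar> \<le> \<bar>a\<bar> * \<bar>u xs\<bar> + \<bar>b\<bar> * \<bar>v xs\<bar>"
      by (rule order_trans[OF abs_triangle_ineq]) (simp add: abs_mult)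
    also have "\<dots> \<le> \<bar>a\<bar> * (C * (\<Prod>i<k. norm (xs ! i))) + \<bar>b\<bar> * (D * (\<Prod>i<k. norm (xs ! i)))"
      by (intro add_mono mult_left_mono C D that) simp_all
    finally show ?thesis by (simp add: distrib_right mult.assoc)
  qed
  moreover have "linear (\<lambda>x. a * u (xs[i := x]) + b * v (xs[i := x]))" if "length xs = k" "i < k" for xs i
    using linear_compose_add[OF linear_compose_scale_right[OF tensor_space_linear[OF u that], of a]
        linear_compose_scale_right[OF tensor_space_linear[OF v that], of b]] by simp
  moreover have "(\<lambda>bs. (a * u bs + b * v bs)\<^sup>2) summable_on basis_tuples k"
    using square_integrable_add[OF square_integrable_cmult square_integrable_cmult,
        OF tensor_space_square_integrable[OF u] tensor_space_square_integrable[OF v], of a b]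
    unfolding square_integrable_def infsum_eq_integral_count_space(2) by blast
  moreover have "a * u xs + b * v xs = 0" if "length xs \<noteq> k" for xs
    using tensor_space_length[OF u that] tensor_space_length[OF v that] by simp
  ultimately show ?thesis unfolding tensor_space_def by blast
qed

lemma basis_tuples_0: "basis_tuples 0 = {[]}"
  by (auto simp: basis_tuples_def)

lemma basis_tuples_append:
  "bij_betw (\<lambda>(as, bs). as @ bs) (basis_tuples m \<times> basis_tuples n) (basis_tuples (m + n))"
proof (rule bij_betwI[where g="\<lambda>bs. (take m bs, drop m bs)"])
  show "(\<lambda>bs. (take m bs, drop m bs)) \<in> basis_tuples (m + n) \<rightarrow> basis_tuples m \<times> basis_tuples n"
    by (auto simp: basis_tuples_def dest: in_set_takeD in_set_dropD)
qed (auto simp: basis_tuples_def)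

lemma basis_tuples_1: "basis_tuples 1 = (\<lambda>b. [b]) ` some_basis"
  by (auto simp: basis_tuples_def length_Suc_conv)

lemma has_sum_tuples_append:
  fixes u v :: "'h::real_inner list \<Rightarrow> real"
  assumes "(u has_sum a) (basis_tuples m)" "(v has_sum b) (basis_tuples n)"
  shows "((\<lambda>xs. u (take m xs) * v (drop m xs)) has_sum a * b) (basis_tuples (m + n))"
proof -
  have "((\<lambda>p. u (take m (case p of (as, bs) \<Rightarrow> as @ bs)) * v (drop m (case p of (as, bs) \<Rightarrow> as @ bs)))
      has_sum a * b) (basis_tuples m \<times> basis_tuples n)"
  proof (rule has_sum_cong[THEN iffD1, OF _ has_sum_product_real[OF assms]])
    show "(case p of (x, y) \<Rightarrow> u x * v y)
      = u (take m (case p of (as, bs) \<Rightarrow> as @ bs)) * v (drop m (case p of (as, bs) \<Rightarrow> as @ bs))"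
      if "p \<in> basis_tuples m \<times> basis_tuples n" for p
      using that by (auto simp: basis_tuples_def)
  qed
  then show ?thesis using has_sum_reindex_bij_betw[OF basis_tuples_append] by fastforce
qed

lemma pure_tensor_Cons:
  "length xs = length hs \<Longrightarrow> pure_tensor (h # hs) (x # xs) = inner h x * pure_tensor hs xs"
  by (simp add: pure_tensor_def prod.lessThan_Suc_shift del: prod.lessThan_Suc)

lemma pure_tensor_inner_has_sum:
  fixes hs gs :: "'h::real_inner list"
  assumes B: "orthonormal_basis (some_basis :: 'h set)"
    and "length hs = k" "length gs = k"
  shows "((\<lambda>bs. pure_tensor hs bs * pure_tensor gs bs) has_sum (\<Prod>i<k. inner (hs ! i) (gs ! i))) (basis_tuples k)"
  using assms(2,3)
proof (induction k arbitrary: hs gs)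
  case 0
  then show ?case by (simp add: basis_tuples_0 pure_tensor_def has_sum_finite_iff)
next
  case (Suc k)
  obtain h hs' g gs' where hg: "hs = h # hs'" "gs = g # gs'" "length hs' = k" "length gs' = k"
    using Suc.prems by (auto simp: length_Suc_conv)
  have 1: "((\<lambda>bs. inner h (hd bs) * inner g (hd bs)) has_sum inner h g) (basis_tuples 1)"
    using Parseval_has_sum[OF B, of h g] unfolding basis_tuples_1
    by (subst has_sum_reindex) (auto simp: inj_on_def o_def)
  have "((\<lambda>bs. pure_tensor hs bs * pure_tensor gs bs) has_sum inner h g * (\<Prod>i<k. inner (hs' ! i) (gs' ! i))) (basis_tuples (1 + k))"
  proof (rule has_sum_cong[THEN iffD1, OF _ has_sum_tuples_append[OF 1 Suc.IH[OF hg(3,4)]]])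
    fix bs :: "'h list" assume "bs \<in> basis_tuples (1 + k)"
    then obtain b bs' where "bs = b # bs'" "length bs' = k" by (auto simp: basis_tuples_def length_Suc_conv)
    then show "inner h (hd (take 1 bs)) * inner g (hd (take 1 bs)) * (pure_tensor hs' (drop 1 bs) * pure_tensor gs' (drop 1 bs))
      = pure_tensor hs bs * pure_tensor gs bs"
      using hg by (simp add: pure_tensor_Cons)
  qed
  moreover have "(\<Prod>i<Suc k. inner (hs ! i) (gs ! i)) = inner h g * (\<Prod>i<k. inner (hs' ! i) (gs' ! i))"
    using hg by (simp add: prod.lessThan_Suc_shift del: prod.lessThan_Suc)
  ultimately show ?case by simp
qed

lemma pure_tensor_inner:
  fixes hs gs :: "'h::real_inner list"
  assumes B: "orthonormal_basis (some_basis :: 'h set)" and "length hs = k" "length gs = k"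
  shows "tensor_inner k (pure_tensor hs) (pure_tensor gs) = (\<Prod>i<k. inner (hs ! i) (gs ! i))"
  unfolding tensor_inner_def by (rule infsumI[OF pure_tensor_inner_has_sum[OF assms]])

lemma pure_tensor_in_tensor_space:
  fixes hs :: "'h::real_inner list"
  assumes B: "orthonormal_basis (some_basis :: 'h set)"
  shows "pure_tensor hs \<in> tensor_space (length hs)"
  unfolding tensor_space_def
proof (intro CollectI conjI allI impI)
  show "length xs \<noteq> length hs \<Longrightarrow> pure_tensor hs xs = 0" for xs by (simp add: pure_tensor_def)
  show "(\<lambda>bs. (pure_tensor hs bs)\<^sup>2) summable_on basis_tuples (length hs)"
    using has_sum_imp_summable[OF pure_tensor_inner_has_sum[OF B, of hs "length hs" hs]]
    by (simp add: power2_eq_square)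
  have "\<bar>pure_tensor hs xs\<bar> \<le> (\<Prod>i<length hs. norm (hs ! i)) * (\<Prod>i<length hs. norm (xs ! i))"
    if "length xs = length hs" for xs
  proof -
    have "\<bar>pure_tensor hs xs\<bar> = (\<Prod>i<length hs. \<bar>inner (hs ! i) (xs ! i)\<bar>)"
      using that by (simp add: pure_tensor_def abs_prod)
    also have "\<dots> \<le> (\<Prod>i<length hs. norm (hs ! i) * norm (xs ! i))"
      by (intro prod_mono conjI Cauchy_Schwarz_ineq2) simp
    finally show ?thesis by (simp add: prod.distrib)
  qed
  then show "\<exists>C. \<forall>xs. length xs = length hs \<longrightarrow> \<bar>pure_tensor hs xs\<bar> \<le> C * (\<Prod>i<length hs. norm (xs ! i))"
    by blast
  fix xs :: "'h list" and i assume xs: "length xs = length hs" and i: "i < length hs"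
  have "pure_tensor hs (xs[i := x]) = inner (hs ! i) x * (\<Prod>j\<in>{..<length hs} - {i}. inner (hs ! j) (xs ! j))" for x
  proof -
    have "pure_tensor hs (xs[i := x]) = (\<Prod>j\<in>{..<length hs}. inner (hs ! j) (xs[i := x] ! j))"
      using xs by (simp add: pure_tensor_def)
    also have "\<dots> = inner (hs ! i) (xs[i := x] ! i) * (\<Prod>j\<in>{..<length hs} - {i}. inner (hs ! j) (xs[i := x] ! j))"
      using i by (intro prod.remove) auto
    also have "(\<Prod>j\<in>{..<length hs} - {i}. inner (hs ! j) (xs[i := x] ! j)) = (\<Prod>j\<in>{..<length hs} - {i}. inner (hs ! j) (xs ! j))"
      by (intro prod.cong) auto
    finally show ?thesis using xs i by simp
  qed
  then show "linear (\<lambda>x. pure_tensor hs (xs[i := x]))"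
    by (intro linearI) (simp_all add: inner_add_right distrib_right)
qed

section \<open>The reproducing property\<close>

text \<open>
  Linearity pulls the sums out of one argument after the other. If \<open>F\<close> is part of an orthonormal basis, the
  arguments on the left are projections to its span, and exhausting the basis expands the form itself.
\<close>
lemma multilinear_finite_expansion:
  fixes u :: "'h::real_inner list \<Rightarrow> real"
  assumes "\<And>xs i. length xs = k \<Longrightarrow> i < k \<Longrightarrow> linear (\<lambda>x. u (xs[i := x]))"
    and F: "finite F" and "length xs = k"
  shows "u (map (\<lambda>x. \<Sum>b\<in>F. inner x b *\<^sub>R b) xs)
    = (\<Sum>bs\<in>{bs. set bs \<subseteq> F \<and> length bs = k}. u bs * pure_tensor xs bs)"
  using assms(1,3)
proof (induction k arbitrary: u xs)
  case 0
  then have "{bs :: 'h list. set bs \<subseteq> F \<and> length bs = 0} = {[]}" by auto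
  with 0 show ?case by (simp add: pure_tensor_def)
next
  case (Suc k)
  define P where "P x = (\<Sum>b\<in>F. inner x b *\<^sub>R b)" for x
  obtain x ys where xs: "xs = x # ys" "length ys = k" using Suc.prems(2) by (auto simp: length_Suc_conv)
  have lin0: "linear (\<lambda>z. u (z # zs))" if "length zs = k" for zs
    using Suc.prems(1)[of "x # zs" 0] that by simp
  have lin: "linear (\<lambda>y. u (z # zs[i := y]))" if "length zs = k" "i < k" for z zs i
    using Suc.prems(1)[of "z # zs" "Suc i"] that by simp
  have "u (map P xs) = u (P x # map P ys)" using xs by simp
  also have "\<dots> = (\<Sum>b\<in>F. inner x b * u (b # map P ys))"
    unfolding P_def[of x] using xs linear_sum[OF lin0[of "map P ys"], of "\<lambda>b. inner x b *\<^sub>R b" F]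
      linear_scale[OF lin0[of "map P ys"]] by simp
  also have "\<dots> = (\<Sum>b\<in>F. inner x b * (\<Sum>bs\<in>{bs. set bs \<subseteq> F \<and> length bs = k}. u (b # bs) * pure_tensor ys bs))"
    unfolding P_def by (intro sum.cong refl arg_cong2[of _ _ _ _ "(*)"] Suc.IH xs(2) lin)
  also have "\<dots> = (\<Sum>b\<in>F. \<Sum>bs\<in>{bs. set bs \<subseteq> F \<and> length bs = k}. u (b # bs) * pure_tensor xs (b # bs))"
    unfolding sum_distrib_left using xs by (intro sum.cong refl) (simp add: pure_tensor_Cons)
  also have "\<dots> = (\<Sum>(bs, b)\<in>{bs. set bs \<subseteq> F \<and> length bs = k} \<times> F. u (b # bs) * pure_tensor xs (b # bs))"
    by (subst sum.swap) (simp add: sum.cartesian_product)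
  also have "\<dots> = (\<Sum>bs\<in>{bs. set bs \<subseteq> F \<and> length bs = Suc k}. u bs * pure_tensor xs bs)"
    unfolding lists_length_Suc_eq
    by (subst sum.reindex) (auto simp: inj_on_def intro!: sum.cong)
  finally show ?case unfolding P_def .
qed

text \<open>
  The arguments are replaced one by one. The bound makes each replacement cost little, because the
  arguments replaced already converge and thus stay bounded.
\<close>
lemma multilinear_tendsto:
  fixes u :: "'h::real_inner list \<Rightarrow> real"
  assumes "\<And>xs i. length xs = k \<Longrightarrow> i < k \<Longrightarrow> linear (\<lambda>x. u (xs[i := x]))"
    and "\<And>xs. length xs = k \<Longrightarrow> \<bar>u xs\<bar> \<le> C * (\<Prod>i<k. norm (xs ! i))"
    and P: "\<And>x. ((\<lambda>F. P F x) \<longlongrightarrow> x) net" and "length xs = k"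
  shows "((\<lambda>F. u (map (P F) xs)) \<longlongrightarrow> u xs) net"
  using assms(1,2,4)
proof (induction k arbitrary: u xs C)
  case 0
  then show ?case by simp
next
  case (Suc k)
  obtain x ys where xs: "xs = x # ys" "length ys = k" using Suc.prems(3) by (auto simp: length_Suc_conv)
  have lin0: "linear (\<lambda>z. u (z # zs))" if "length zs = k" for zs
    using Suc.prems(1)[of "x # zs" 0] that by simp
  have lin: "linear (\<lambda>y. u (x # zs[i := y]))" if "length zs = k" "i < k" for zs i
    using Suc.prems(1)[of "x # zs" "Suc i"] that by simp
  have bnd: "\<bar>u (z # zs)\<bar> \<le> (C * norm z) * (\<Prod>i<k. norm (zs ! i))" if "length zs = k" for z zs
    using Suc.prems(2)[of "z # zs"] that
    by (simp add: prod.lessThan_Suc_shift mult.assoc del: prod.lessThan_Suc)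
  have 1: "((\<lambda>F. u (x # map (P F) ys)) \<longlongrightarrow> u (x # ys)) net"
    by (rule Suc.IH[of "\<lambda>zs. u (x # zs)", OF lin bnd xs(2)])
  have 2: "((\<lambda>F. u ((P F x - x) # map (P F) ys)) \<longlongrightarrow> 0) net"
  proof (rule Lim_null_comparison)
    show "\<forall>\<^sub>F F in net. norm (u ((P F x - x) # map (P F) ys)) \<le> (C * norm (P F x - x)) * (\<Prod>i<k. norm (P F (ys ! i)))"
      using bnd[of "map (P _) ys"] xs(2) by (intro always_eventually allI) simp
    have "((\<lambda>F. (C * norm (P F x - x)) * (\<Prod>i<k. norm (P F (ys ! i)))) \<longlongrightarrow> (C * norm (x - x)) * (\<Prod>i<k. norm (ys ! i))) net"
      by (intro tendsto_intros P)
    then show "((\<lambda>F. (C * norm (P F x - x)) * (\<Prod>i<k. norm (P F (ys ! i)))) \<longlongrightarrow> 0) net" by simp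
  qed
  have "u ((P F x - x) # map (P F) ys) + u (x # map (P F) ys) = u (map (P F) xs)" for F
    using linear_add[OF lin0[of "map (P F) ys"], of "P F x - x" x] xs by simp
  with tendsto_add[OF 2 1] show ?case using xs by simp
qed

text \<open>
  The partial sums of the inner product over the tuples from a finite set \<open>F\<close> are values of \<open>u\<close> at projected
  arguments, which converge to \<open>u xs\<close> by continuity.
\<close>
theorem tensor_reproducing:
  fixes u :: "'h::real_inner list \<Rightarrow> real"
  assumes B: "orthonormal_basis (some_basis :: 'h set)" and u: "u \<in> tensor_space k" and xs: "length xs = k"
  shows "tensor_inner k u (pure_tensor xs) = u xs"
proof -
  define B :: "'h set" where "B = some_basis"
  define P where "P F x = (\<Sum>b\<in>F. inner x b *\<^sub>R b)" for F and x :: 'h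
  define L where "L F = {bs :: 'h list. set bs \<subseteq> F \<and> length bs = k}" for F
  have P: "((\<lambda>F. P F x) \<longlongrightarrow> x) (finite_subsets_at_top B)" for x
    using basis_expansion_has_sum[OF B, of x] unfolding has_sum_def P_def B_def .
  obtain C where C: "\<And>xs. length xs = k \<Longrightarrow> \<bar>u xs\<bar> \<le> C * (\<Prod>i<k. norm (xs ! i))"
    using tensor_space_bounded[OF u] by blast
  have 1: "((\<lambda>F. u (map (P F) xs)) \<longlongrightarrow> u xs) (finite_subsets_at_top B)"
    by (rule multilinear_tendsto[OF tensor_space_linear[OF u] C P xs])
  have sm: "(\<lambda>bs. u bs * pure_tensor xs bs) summable_on basis_tuples k"
    unfolding infsum_eq_integral_count_space(2)
    using tensor_space_square_integrable[OF u] tensor_space_square_integrable[OF pure_tensor_in_tensor_space[OF B, of xs]] xs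
    by (intro square_integrable_mult) simp_all
  have "filterlim L (finite_subsets_at_top (basis_tuples k)) (finite_subsets_at_top B)"
    unfolding filterlim_finite_subsets_at_top
  proof (intro allI impI)
    fix S :: "'h list set" assume S: "finite S \<and> S \<subseteq> basis_tuples k"
    have "\<forall>\<^sub>F F in finite_subsets_at_top B. finite F \<and> (\<Union>bs\<in>S. set bs) \<subseteq> F \<and> F \<subseteq> B"
      using S unfolding basis_tuples_def B_def eventually_finite_subsets_at_top
      by (intro exI[of _ "\<Union>bs\<in>S. set bs"]) auto
    then show "\<forall>\<^sub>F F in finite_subsets_at_top B. finite (L F) \<and> S \<subseteq> L F \<and> L F \<subseteq> basis_tuples k"
    proof eventually_elim
      case (elim F)
      then have "finite (L F)" unfolding L_def by (intro finite_lists_length_eq) simp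
      moreover have "S \<subseteq> L F" "L F \<subseteq> basis_tuples k"
        using elim S unfolding L_def basis_tuples_def B_def by auto
      ultimately show ?case by simp
    qed
  qed
  from filterlim_compose[OF infsum_tendsto[OF sm] this]
  have 2: "((\<lambda>F. \<Sum>bs\<in>L F. u bs * pure_tensor xs bs) \<longlongrightarrow> tensor_inner k u (pure_tensor xs)) (finite_subsets_at_top B)"
    unfolding tensor_inner_def .
  have "\<forall>\<^sub>F F in finite_subsets_at_top B. u (map (P F) xs) = (\<Sum>bs\<in>L F. u bs * pure_tensor xs bs)"
  proof (rule eventually_finite_subsets_at_top_weakI)
    show "finite F \<Longrightarrow> F \<subseteq> B \<Longrightarrow> u (map (P F) xs) = (\<Sum>bs\<in>L F. u bs * pure_tensor xs bs)" for F
      unfolding P_def L_def by (rule multilinear_finite_expansion[OF tensor_space_linear[OF u] _ xs])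
  qed
  then have "((\<lambda>F. u (map (P F) xs)) \<longlongrightarrow> tensor_inner k u (pure_tensor xs)) (finite_subsets_at_top B)"
    by (rule tendsto_cong[THEN iffD2, OF _ 2])
  from tendsto_unique[OF finite_subsets_at_top_neq_bot this 1] show ?thesis .
qed

section \<open>Symmetrization\<close>

lemma permute_list_update:
  assumes p: "p permutes {..<length xs}" and i: "i < length xs"
  shows "permute_list p (xs[i := x]) = (permute_list p xs)[inv p i := x]"
proof (rule nth_equalityI)
  fix j assume "j < length (permute_list p (xs[i := x]))"
  then have j: "j < length xs" by simp
  have "p j < length xs" using permutes_in_image[OF p, of j] j by simp
  have e: "p j = i \<longleftrightarrow> inv p i = j" using permutes_inv_eq[OF p, of i j] by auto
  have "permute_list p (xs[i := x]) ! j = xs[i := x] ! p j"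
    using p j by (intro permute_list_nth) simp_all
  also have "\<dots> = (permute_list p xs)[inv p i := x] ! j"
    using e j \<open>p j < length xs\<close> permute_list_nth[OF p j] i by (cases "p j = i") auto
  finally show "permute_list p (xs[i := x]) ! j = (permute_list p xs)[inv p i := x] ! j" .
qed simp

lemma permute_list_basis_tuples:
  assumes p: "p permutes {..<k}"
  shows "bij_betw (permute_list p) (basis_tuples k) (basis_tuples k)"
proof (rule bij_betwI[where g="permute_list (inv p)"])
  have mem: "permute_list q \<in> basis_tuples k \<rightarrow> basis_tuples k" if "q permutes {..<k}" for q
    using that by (auto simp: basis_tuples_def)
  show "permute_list p \<in> basis_tuples k \<rightarrow> basis_tuples k" by (rule mem[OF p])
  show "permute_list (inv p) \<in> basis_tuples k \<rightarrow> basis_tuples k" by (rule mem[OF permutes_inv[OF p]])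
  fix bs :: "'a list" assume "bs \<in> basis_tuples k"
  then have l: "length bs = k" by (simp add: basis_tuples_def)
  show "permute_list (inv p) (permute_list p bs) = bs"
    using permute_list_compose[of "inv p" bs p] permutes_inv[OF p] l permutes_inv_o(1)[OF p] by simp
  show "permute_list p (permute_list (inv p) bs) = bs"
    using permute_list_compose[of p bs "inv p"] p l permutes_inv_o(2)[OF p] by simp
qed

lemma tensor_space_permute:
  assumes u: "u \<in> tensor_space k" and p: "p permutes {..<k}"
  shows "(\<lambda>xs. u (permute_list p xs)) \<in> tensor_space k"
  unfolding tensor_space_def
proof (intro CollectI conjI allI impI)
  show "length xs \<noteq> k \<Longrightarrow> u (permute_list p xs) = 0" for xs
    by (intro tensor_space_length[OF u]) simp
  show "linear (\<lambda>x. u (permute_list p (xs[i := x])))" if "length xs = k" "i < k" for xs i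
  proof -
    have "inv p i < k" using permutes_in_image[OF permutes_inv[OF p], of i] that by simp
    then show ?thesis
      using that p tensor_space_linear[OF u, of "permute_list p xs" "inv p i"]
      by (simp add: permute_list_update)
  qed
  show "(\<lambda>bs. (u (permute_list p bs))\<^sup>2) summable_on basis_tuples k"
    using u summable_on_reindex_bij_betw[OF permute_list_basis_tuples[OF p], of "\<lambda>bs. (u bs)\<^sup>2"]
    by (simp add: tensor_space_def)
  obtain C where C: "\<And>xs. length xs = k \<Longrightarrow> \<bar>u xs\<bar> \<le> C * (\<Prod>i<k. norm (xs ! i))"
    using tensor_space_bounded[OF u] by blast
  have "\<bar>u (permute_list p xs)\<bar> \<le> C * (\<Prod>i<k. norm (xs ! i))" if "length xs = k" for xs
  proof -
    have "(\<Prod>i<k. norm (permute_list p xs ! i)) = (\<Prod>i<k. norm (xs ! p i))"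
      using that p by (intro prod.cong) (simp_all add: permute_list_nth)
    also have "\<dots> = (\<Prod>i<k. norm (xs ! i))"
      by (rule prod.reindex_bij_betw[OF permutes_imp_bij[OF p]])
    finally show ?thesis using C[of "permute_list p xs"] that by simp
  qed
  then show "\<exists>C. \<forall>xs. length xs = k \<longrightarrow> \<bar>u (permute_list p xs)\<bar> \<le> C * (\<Prod>i<k. norm (xs ! i))" by blast
qed

lemma tensor_space_zero: "(\<lambda>_. 0) \<in> tensor_space k"
  unfolding tensor_space_def by (auto intro!: linearI exI[of _ 0])

lemma tensor_space_sum:
  "(\<And>i. i \<in> I \<Longrightarrow> u i \<in> tensor_space k) \<Longrightarrow> (\<lambda>xs. \<Sum>i\<in>I. u i xs) \<in> tensor_space k"
proof (induction I rule: infinite_finite_induct)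
  case (insert i I)
  then show ?case using tensor_space_lincomb[of "u i" k "\<lambda>xs. \<Sum>i\<in>I. u i xs" 1 1] by simp
qed (simp_all add: tensor_space_zero)

lemma symmetrize_alt:
  assumes u: "u \<in> tensor_space k"
  shows "symmetrize k u = (\<lambda>xs. (1 / fact k) * (\<Sum>p | p permutes {..<k}. u (permute_list p xs)) + 0 * u xs)"
proof
  fix xs
  show "symmetrize k u xs = (1 / fact k) * (\<Sum>p | p permutes {..<k}. u (permute_list p xs)) + 0 * u xs"
    using tensor_space_length[OF u] by (cases "length xs = k") (simp_all add: symmetrize_def)
qed

lemma symmetrize_in_tensor_space:
  "u \<in> tensor_space k \<Longrightarrow> symmetrize k u \<in> tensor_space k"
  using tensor_space_lincomb[OF tensor_space_sum[of "{p. p permutes {..<k}}" "\<lambda>p xs. u (permute_list p xs)" k],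
      of u "1 / fact k" 0]
  by (simp only: symmetrize_alt tensor_space_permute mem_Collect_eq)

text \<open>
  Permuting the arguments permutes the basis tuples and preserves the norm; an average of vectors of
  equal norm is not longer.
\<close>
lemma symmetrize_norm_le:
  assumes u: "u \<in> tensor_space k"
  shows "tensor_inner k (symmetrize k u) (symmetrize k u) \<le> tensor_inner k u u"
proof -
  define S where "S = {p. p permutes {..<k}}"
  have S: "finite S" "card S = fact k"
    unfolding S_def by (simp_all add: finite_permutations card_permutations)
  have sq: "(symmetrize k u xs)\<^sup>2 \<le> (\<Sum>p\<in>S. (u (permute_list p xs))\<^sup>2 / fact k)" for xs
  proof -
    have "(symmetrize k u xs)\<^sup>2 = (\<Sum>p\<in>S. u (permute_list p xs))\<^sup>2 / (fact k)\<^sup>2"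
      unfolding symmetrize_alt[OF u] S_def by (simp add: power_divide)
    also have "\<dots> \<le> ((\<Sum>p\<in>S. (u (permute_list p xs))\<^sup>2) * real (card S)) / (fact k)\<^sup>2"
      by (intro divide_right_mono sum_squared_le_sum_of_squares) simp
    also have "\<dots> = (\<Sum>p\<in>S. (u (permute_list p xs))\<^sup>2 / fact k)"
      using S by (simp add: sum_divide_distrib power2_eq_square)
    finally show ?thesis .
  qed
  have int: "integrable (tuples k) (\<lambda>xs. (v xs)\<^sup>2)" if "v \<in> tensor_space k" for v
    using square_integrableD(2)[OF tensor_space_square_integrable[OF that]] .
  have perm: "(\<integral>bs. (u (permute_list p bs))\<^sup>2 \<partial>tuples k) = tensor_inner k u u" if "p \<in> S" for p
    using infsum_reindex_bij_betw[OF permute_list_basis_tuples, of p k "\<lambda>bs. (u bs)\<^sup>2"] that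
    unfolding tensor_inner_def S_def by (simp add: power2_eq_square flip: infsum_eq_integral_count_space(1))
  have "tensor_inner k (symmetrize k u) (symmetrize k u) = (\<integral>bs. (symmetrize k u bs)\<^sup>2 \<partial>tuples k)"
    by (simp add: tensor_inner_integral power2_eq_square)
  also have "\<dots> \<le> (\<integral>bs. (\<Sum>p\<in>S. (u (permute_list p bs))\<^sup>2 / fact k) \<partial>tuples k)"
    using sq by (intro integral_mono int symmetrize_in_tensor_space u Bochner_Integration.integrable_sum
        integrable_divide_zero impI tensor_space_permute) (simp_all add: S_def)
  also have "\<dots> = (\<Sum>p\<in>S. (\<integral>bs. (u (permute_list p bs))\<^sup>2 \<partial>tuples k) / fact k)"
    using int[OF tensor_space_permute[OF u]]
    by (subst Bochner_Integration.integral_sum) (simp_all add: S_def)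
  also have "\<dots> = tensor_inner k u u" using S by (simp add: perm)
  finally show ?thesis .
qed

lemma symmetrize_replicate:
  "symmetrize k u (replicate k h) = u (replicate k h)"
proof -
  have "permute_list p (replicate k h) = replicate k h" if "p permutes {..<k}" for p
    using that by (intro nth_equalityI) (simp_all add: permute_list_nth permutes_in_image[of _ "{..<k}", unfolded lessThan_iff])
  moreover have "card {p. p permutes {..<k}} = fact k" by (rule card_permutations) simp_all
  ultimately show ?thesis by (simp add: symmetrize_def)
qed

lemma symmetrize_lincomb:
  "symmetrize k (\<lambda>xs. a * u xs + b * v xs) xs = a * symmetrize k u xs + b * symmetrize k v xs"
  by (simp add: symmetrize_def sum.distrib sum_distrib_left add_divide_distrib)

lemma symmetrize_sum:
  "symmetrize k (\<lambda>xs. \<Sum>i\<in>I. c i * u i xs) xs = (\<Sum>i\<in>I. c i * symmetrize k (u i) xs)"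
proof (induction I rule: infinite_finite_induct)
  case (insert i I)
  then show ?case using symmetrize_lincomb[of k "c i" "u i" 1 "\<lambda>xs. \<Sum>i\<in>I. c i * u i xs" xs] by simp
qed (simp_all add: symmetrize_def)

text \<open>
  Averaging over signs keeps exactly the index maps that hit every position an odd number of times;
  on a set of \<open>k\<close> positions these are the permutations.
\<close>
lemma sign_average:
  assumes f: "f \<in> {..<k} \<rightarrow> {..<k::nat}"
  shows "(\<Sum>\<epsilon>\<in>PiE {..<k} (\<lambda>_. {-1, 1}). (\<Prod>i<k. \<epsilon> i) * (\<Prod>m<k. \<epsilon> (f m)))
    = (if bij_betw f {..<k} {..<k} then 2 ^ k else 0 :: real)"
proof -
  define c where "c i = card {m \<in> {..<k}. f m = i}" for i
  have "(\<Prod>i<k. \<epsilon> i) * (\<Prod>m<k. \<epsilon> (f m)) = (\<Prod>i<k. \<epsilon> i ^ Suc (c i))" for \<epsilon> :: "nat \<Rightarrow> real"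
  proof -
    have "(\<Prod>m<k. \<epsilon> (f m)) = (\<Prod>i<k. \<Prod>m\<in>{m \<in> {..<k}. f m = i}. \<epsilon> (f m))"
      using f by (intro prod.group[symmetric]) auto
    also have "\<dots> = (\<Prod>i<k. \<Prod>m\<in>{m \<in> {..<k}. f m = i}. \<epsilon> i)"
      by (intro prod.cong refl) simp
    also have "\<dots> = (\<Prod>i<k. \<epsilon> i ^ c i)" by (simp add: c_def)
    finally show ?thesis by (simp add: prod.distrib)
  qed
  then have "(\<Sum>\<epsilon>\<in>PiE {..<k} (\<lambda>_. {-1, 1}). (\<Prod>i<k. \<epsilon> i) * (\<Prod>m<k. \<epsilon> (f m)))
      = (\<Sum>\<epsilon>\<in>PiE {..<k} (\<lambda>_. {-1, 1 :: real}). (\<Prod>i<k. \<epsilon> i ^ Suc (c i)))"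
    by (simp only:)
  also have "(\<Sum>\<epsilon>\<in>PiE {..<k} (\<lambda>_. {-1, 1}). (\<Prod>i<k. \<epsilon> i ^ Suc (c i))) = (\<Prod>i<k. \<Sum>e\<in>{-1, 1::real}. e ^ Suc (c i))"
    by (rule prod_sum_PiE[symmetric]) simp_all
  also have "\<dots> = (if bij_betw f {..<k} {..<k} then 2 ^ k else 0)"
  proof (cases "bij_betw f {..<k} {..<k}")
    case True
    have "c i = 1" if "i < k" for i
    proof -
      have "i \<in> f ` {..<k}" using bij_betw_imp_surj_on[OF True] that by simp
      then obtain m where m: "m < k" "f m = i" by auto
      have "m' = m" if "m' < k" "f m' = i" for m'
        using inj_on_eq_iff[OF bij_betw_imp_inj_on[OF True], of m' m] m that by simp
      with m have "{m \<in> {..<k}. f m = i} = {m}" by blast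
      then show ?thesis by (simp add: c_def)
    qed
    then have "(\<Prod>i<k. \<Sum>e\<in>{-1, 1::real}. e ^ Suc (c i)) = (\<Prod>i<k. 2)"
      by (intro prod.cong) simp_all
    with True show ?thesis by simp
  next
    case False
    have "\<not> {..<k} \<subseteq> f ` {..<k}"
    proof
      assume "{..<k} \<subseteq> f ` {..<k}"
      then have "f ` {..<k} = {..<k}" using f by auto
      then show False using False eq_card_imp_inj_on[of "{..<k}" f] by (simp add: bij_betw_def)
    qed
    then obtain i where i: "i < k" "i \<notin> f ` {..<k}" by auto
    then have "{m \<in> {..<k}. f m = i} = {}" by auto
    then have "c i = 0" by (simp only: c_def card.empty)
    then have "(\<Sum>e\<in>{-1, 1::real}. e ^ Suc (c i)) = 0" by simp
    then have "(\<Prod>i<k. \<Sum>e\<in>{-1, 1::real}. e ^ Suc (c i)) = 0" using i by (intro prod_zero) auto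
    with False show ?thesis by simp
  qed
  finally show ?thesis .
qed

lemma sum_permutations_eq_sum_bij:
  fixes G :: "(nat \<Rightarrow> nat) \<Rightarrow> real"
  assumes G: "\<And>f g. (\<And>i. i < k \<Longrightarrow> f i = g i) \<Longrightarrow> G f = G g"
  shows "(\<Sum>p | p permutes {..<k}. G p) = (\<Sum>f\<in>{f \<in> PiE {..<k} (\<lambda>_. {..<k}). bij_betw f {..<k} {..<k}}. G f)"
proof (rule sum.reindex_bij_witness[where i="\<lambda>f i. if i < k then f i else i" and j="\<lambda>p. restrict p {..<k}"])
  fix p assume "p \<in> {p. p permutes {..<k}}"
  then have p: "p permutes {..<k}" by simp
  show "(\<lambda>i. if i < k then restrict p {..<k} i else i) = p"
    using permutes_not_in[OF p] by (auto simp: fun_eq_iff)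
  have "bij_betw (restrict p {..<k}) {..<k} {..<k}"
    using permutes_imp_bij[OF p] by (subst bij_betw_cong[of _ _ p]) simp_all
  then show "restrict p {..<k} \<in> {f \<in> PiE {..<k} (\<lambda>_. {..<k}). bij_betw f {..<k} {..<k}}"
    using permutes_in_image[OF p] by auto
  show "G (restrict p {..<k}) = G p" by (rule G) simp
next
  fix f assume f: "f \<in> {f \<in> PiE {..<k} (\<lambda>_. {..<k}). bij_betw f {..<k} {..<k}}"
  show "restrict (\<lambda>i. if i < k then f i else i) {..<k} = f"
    using f by (auto simp: fun_eq_iff PiE_def extensional_def)
  have "bij_betw (\<lambda>i. if i < k then f i else i) {..<k} {..<k}"
    using f by (subst bij_betw_cong[of _ _ f]) simp_all
  then show "(\<lambda>i. if i < k then f i else i) \<in> {p. p permutes {..<k}}"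
    using bij_imp_permutes[of "\<lambda>i. if i < k then f i else i" "{..<k}"] by simp
qed

text \<open>
  The polarization identity. Expanding the powers gives a sum over all maps from the positions to the
  factors, of which the average over signs keeps the permutations.
\<close>
lemma symmetrize_pure_tensor:
  assumes hs: "length hs = k"
  shows "symmetrize k (pure_tensor hs) xs = (\<Sum>\<epsilon>\<in>PiE {..<k} (\<lambda>_. {-1, 1}).
    (\<Prod>i<k. \<epsilon> i) / (2 ^ k * fact k) * pure_tensor (replicate k (\<Sum>i<k. \<epsilon> i *\<^sub>R hs ! i)) xs)"
proof (cases "length xs = k")
  case False
  then show ?thesis using hs by (simp add: symmetrize_def pure_tensor_def)
next
  case xs: True
  define E where "E = PiE {..<k} (\<lambda>_. {-1, 1 :: real})"
  define T where "T f = (\<Prod>m<k. inner (hs ! f m) (xs ! m))" for f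
  have pt: "pure_tensor (replicate k (\<Sum>i<k. \<epsilon> i *\<^sub>R hs ! i)) xs
      = (\<Sum>f\<in>PiE {..<k} (\<lambda>_. {..<k}). (\<Prod>m<k. \<epsilon> (f m)) * T f)" for \<epsilon>
  proof -
    have "pure_tensor (replicate k (\<Sum>i<k. \<epsilon> i *\<^sub>R hs ! i)) xs = (\<Prod>m<k. \<Sum>i<k. \<epsilon> i * inner (hs ! i) (xs ! m))"
      using xs by (simp add: pure_tensor_def inner_sum_left)
    also have "\<dots> = (\<Sum>f\<in>PiE {..<k} (\<lambda>_. {..<k}). \<Prod>m<k. \<epsilon> (f m) * inner (hs ! f m) (xs ! m))"
      by (rule prod_sum_PiE) simp_all
    finally show ?thesis by (simp add: prod.distrib T_def)
  qed
  have "(\<Sum>\<epsilon>\<in>E. (\<Prod>i<k. \<epsilon> i) / (2 ^ k * fact k) * pure_tensor (replicate k (\<Sum>i<k. \<epsilon> i *\<^sub>R hs ! i)) xs)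
      = (\<Sum>\<epsilon>\<in>E. \<Sum>f\<in>PiE {..<k} (\<lambda>_. {..<k}). (\<Prod>i<k. \<epsilon> i) * (\<Prod>m<k. \<epsilon> (f m)) * (T f / (2 ^ k * fact k)))"
    unfolding pt sum_distrib_left by (intro sum.cong refl) simp
  also have "\<dots> = (\<Sum>f\<in>PiE {..<k} (\<lambda>_. {..<k}). (\<Sum>\<epsilon>\<in>E. (\<Prod>i<k. \<epsilon> i) * (\<Prod>m<k. \<epsilon> (f m))) * (T f / (2 ^ k * fact k)))"
    by (subst sum.swap) (simp add: sum_distrib_right sum_divide_distrib)
  also have "\<dots> = (\<Sum>f\<in>PiE {..<k} (\<lambda>_. {..<k}). (if bij_betw f {..<k} {..<k} then 2 ^ k else 0) * (T f / (2 ^ k * fact k)))"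
    unfolding E_def by (intro sum.cong refl arg_cong2[of _ _ _ _ "(*)"] sign_average) (auto simp: PiE_def)
  also have "\<dots> = (\<Sum>f\<in>PiE {..<k} (\<lambda>_. {..<k}). if bij_betw f {..<k} {..<k} then T f / fact k else 0)"
    by (intro sum.cong refl) simp
  also have "\<dots> = (\<Sum>f\<in>{f \<in> PiE {..<k} (\<lambda>_. {..<k}). bij_betw f {..<k} {..<k}}. T f / fact k)"
    by (intro sum.inter_filter[symmetric] finite_PiE) simp_all
  also have "\<dots> = (\<Sum>p | p permutes {..<k}. T p / fact k)"
    by (rule sum_permutations_eq_sum_bij[symmetric]) (simp add: T_def)
  also have "\<dots> = (\<Sum>p | p permutes {..<k}. pure_tensor hs (permute_list p xs) / fact k)"
  proof (subst sum_permutations_inverse, intro sum.cong refl)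
    fix p assume "p \<in> {p. p permutes {..<k}}"
    then have p: "p permutes {..<k}" by simp
    have "pure_tensor hs (permute_list p xs) = (\<Prod>m<k. inner (hs ! m) (xs ! p m))"
      using hs xs p by (auto simp: pure_tensor_def permute_list_nth intro!: prod.cong)
    also have "\<dots> = (\<Prod>m<k. inner (hs ! inv p (p m)) (xs ! p m))"
      by (simp add: permutes_inverses[OF p])
    also have "\<dots> = T (inv p)" unfolding T_def
      by (rule prod.reindex_bij_betw[OF permutes_imp_bij[OF p], of "\<lambda>m. inner (hs ! inv p m) (xs ! m)"])
    finally show "T (inv p) / fact k = pure_tensor hs (permute_list p xs) / fact k" by simp
  qed
  also have "\<dots> = symmetrize k (pure_tensor hs) xs"
    using xs by (simp add: symmetrize_def sum_divide_distrib)
  finally show ?thesis unfolding E_def by simp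
qed

section \<open>Powers are total in the symmetric tensors\<close>

definition power_combination :: "'h::real_inner set \<Rightarrow> nat \<Rightarrow> ('h list \<Rightarrow> real) \<Rightarrow> bool" where
  "power_combination A k U \<longleftrightarrow> (\<exists>(N::nat) c h. (\<forall>i<N. h i \<in> A) \<and>
     U = (\<lambda>xs. \<Sum>i<N. c i * pure_tensor (replicate k (h i)) xs))"

lemma power_combination_zero: "power_combination A k (\<lambda>_. 0)"
  unfolding power_combination_def by (intro exI[of _ 0]) simp

lemma power_combination_power: "h \<in> A \<Longrightarrow> power_combination A k (\<lambda>xs. c * pure_tensor (replicate k h) xs)"
  unfolding power_combination_def
  by (intro exI[of _ 1] exI[of _ "\<lambda>_. c"] exI[of _ "\<lambda>_. h"]) simp

lemma sum_lessThan_add: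
  fixes f :: "nat \<Rightarrow> 'a::comm_monoid_add"
  shows "(\<Sum>i<m + n. f i) = (\<Sum>i<m. f i) + (\<Sum>i<n. f (m + i))"
  by (induction n) (simp_all add: add.assoc)

lemma power_combination_add:
  assumes "power_combination A k U" "power_combination A k V"
  shows "power_combination A k (\<lambda>xs. U xs + V xs)"
proof -
  obtain N c h where U: "\<And>i. i < N \<Longrightarrow> h i \<in> A" "U = (\<lambda>xs. \<Sum>i<(N::nat). c i * pure_tensor (replicate k (h i)) xs)"
    using assms(1) unfolding power_combination_def by blast
  obtain M d g where V: "\<And>i. i < M \<Longrightarrow> g i \<in> A" "V = (\<lambda>xs. \<Sum>i<(M::nat). d i * pure_tensor (replicate k (g i)) xs)"
    using assms(2) unfolding power_combination_def by blast
  define c' where "c' i = (if i < N then c i else d (i - N))" for i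
  define h' where "h' i = (if i < N then h i else g (i - N))" for i
  have "(\<lambda>xs. U xs + V xs) = (\<lambda>xs. \<Sum>i<N + M. c' i * pure_tensor (replicate k (h' i)) xs)"
    unfolding sum_lessThan_add U(2) V(2) c'_def h'_def by simp
  moreover have "h' i \<in> A" if "i < N + M" for i
    using U(1)[of i] V(1)[of "i - N"] that by (simp add: h'_def)
  ultimately show ?thesis unfolding power_combination_def
    by (intro exI[of _ "N + M"] exI[of _ c'] exI[of _ h'] conjI) simp_all
qed

lemma power_combination_cmult:
  assumes "power_combination A k U"
  shows "power_combination A k (\<lambda>xs. a * U xs)"
proof -
  obtain N c h where U: "\<forall>i<N. h i \<in> A" "U = (\<lambda>xs. \<Sum>i<(N::nat). c i * pure_tensor (replicate k (h i)) xs)"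
    using assms unfolding power_combination_def by blast
  have "(\<lambda>xs. a * U xs) = (\<lambda>xs. \<Sum>i<N. (a * c i) * pure_tensor (replicate k (h i)) xs)"
    unfolding U(2) sum_distrib_left by (simp add: mult.assoc)
  with U(1) show ?thesis unfolding power_combination_def
    by (intro exI[of _ N] exI[of _ "\<lambda>i. a * c i"] exI[of _ h] conjI)
qed

lemma power_combination_sum:
  "(\<And>i. i \<in> I \<Longrightarrow> power_combination A k (U i)) \<Longrightarrow> power_combination A k (\<lambda>xs. \<Sum>i\<in>I. U i xs)"
proof (induction I rule: infinite_finite_induct)
  case (insert i I)
  then show ?case using power_combination_add[of A k "U i" "\<lambda>xs. \<Sum>i\<in>I. U i xs"] by simp
qed (simp_all add: power_combination_zero)

lemma power_combination_symmetrize: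
  assumes "length hs = k"
  shows "power_combination UNIV k (symmetrize k (pure_tensor hs))"
proof -
  have "symmetrize k (pure_tensor hs) = (\<lambda>xs. \<Sum>\<epsilon>\<in>PiE {..<k} (\<lambda>_. {-1, 1}).
    (\<Prod>i<k. \<epsilon> i) / (2 ^ k * fact k) * pure_tensor (replicate k (\<Sum>i<k. \<epsilon> i *\<^sub>R hs ! i)) xs)"
    by (rule ext) (rule symmetrize_pure_tensor[OF assms])
  then show ?thesis by (simp only:) (intro power_combination_sum power_combination_power UNIV_I)
qed

lemma pure_tensor_basis_tuples:
  fixes bs cs :: "'h::real_inner list"
  assumes B: "orthonormal_basis (some_basis :: 'h set)" and "bs \<in> basis_tuples k" "cs \<in> basis_tuples k"
  shows "pure_tensor bs cs = (if bs = cs then 1 else 0)"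
proof -
  have l: "length bs = k" "length cs = k" and m: "\<And>i. i < k \<Longrightarrow> bs ! i \<in> some_basis" "\<And>i. i < k \<Longrightarrow> cs ! i \<in> some_basis"
    using assms(2,3) by (auto simp: basis_tuples_def)
  have on: "inner (bs ! i) (cs ! i) = (if bs ! i = cs ! i then 1 else 0)" if "i < k" for i
    using orthonormal_basis_inner[OF B m(1)[OF that] m(2)[OF that]] .
  have pt: "pure_tensor bs cs = (\<Prod>i<k. if bs ! i = cs ! i then 1 else 0)"
    using l on by (simp add: pure_tensor_def)
  show ?thesis
  proof (cases "bs = cs")
    case True
    then show ?thesis unfolding pt by simp
  next
    case False
    then obtain i where "i < k" "bs ! i \<noteq> cs ! i" using l nth_equalityI[of bs cs] by auto
    then have "(\<Prod>i<k. if bs ! i = cs ! i then 1 else 0 :: real) = 0" by (intro prod_zero) auto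
    with False pt show ?thesis by simp
  qed
qed

text \<open>
  Truncate the basis expansion, symmetrize the truncation, which does not increase the error, and
  polarize.
\<close>
lemma powers_approximate_symmetric:
  fixes u :: "'h::real_inner list \<Rightarrow> real"
  assumes B: "orthonormal_basis (some_basis :: 'h set)"
    and u: "u \<in> tensor_space k" and "e > 0"
  shows "\<exists>U. power_combination UNIV k U \<and> (\<integral>bs. (U bs - symmetrize k u bs)\<^sup>2 \<partial>tuples k) < e"
proof -
  have sm: "(\<lambda>bs. (u bs)\<^sup>2) summable_on basis_tuples k" using u by (simp add: tensor_space_def)
  obtain S where S: "finite S" "S \<subseteq> basis_tuples k"
    "dist (\<Sum>bs\<in>S. (u bs)\<^sup>2) (infsum (\<lambda>bs. (u bs)\<^sup>2) (basis_tuples k)) \<le> e / 2"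
    using infsum_finite_approximation[OF sm, of "e/2"] \<open>e > 0\<close> by auto
  define V where "V = (\<lambda>xs. \<Sum>bs\<in>S. u bs * pure_tensor bs xs)"
  have pS: "pure_tensor bs \<in> tensor_space k" if "bs \<in> S" for bs
    using pure_tensor_in_tensor_space[OF B, of bs] that S(2) by (auto simp: basis_tuples_def)
  have "(\<lambda>xs. \<Sum>bs\<in>S. u bs * pure_tensor bs xs + 0 * u xs) \<in> tensor_space k"
    by (intro tensor_space_sum tensor_space_lincomb pS u)
  then have V: "V \<in> tensor_space k" by (simp add: V_def)
  have Vu: "V cs = (if cs \<in> S then u cs else 0)" if cs: "cs \<in> basis_tuples k" for cs
  proof -
    have "V cs = (\<Sum>bs\<in>S. u bs * (if bs = cs then 1 else 0))"
      unfolding V_def using S(2) cs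
      by (intro sum.cong refl arg_cong2[of _ _ _ _ "(*)"] pure_tensor_basis_tuples[OF B]) auto
    also have "\<dots> = (\<Sum>bs\<in>S. if bs = cs then u bs else 0)" by (intro sum.cong refl) simp
    also have "\<dots> = (if cs \<in> S then u cs else 0)" using S(1) by (simp add: sum.delta)
    finally show ?thesis .
  qed
  have D: "(\<lambda>xs. 1 * V xs + (-1) * u xs) \<in> tensor_space k" by (rule tensor_space_lincomb[OF V u])
  have "infsum (\<lambda>bs. (u bs)\<^sup>2) (basis_tuples k)
      = infsum (\<lambda>bs. (u bs)\<^sup>2) S + infsum (\<lambda>bs. (u bs)\<^sup>2) (basis_tuples k - S)"
    using infsum_Un_disjoint[of "\<lambda>bs. (u bs)\<^sup>2" S "basis_tuples k - S"] S
      summable_on_subset_banach[OF sm, of "basis_tuples k - S"] by (simp add: Un_absorb1)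
  then have "infsum (\<lambda>bs. (u bs)\<^sup>2) (basis_tuples k - S) \<le> e / 2"
    using S(1,3) by (simp add: dist_real_def abs_le_iff)
  also have "infsum (\<lambda>bs. (u bs)\<^sup>2) (basis_tuples k - S) = infsum (\<lambda>bs. (V bs - u bs)\<^sup>2) (basis_tuples k)"
    by (rule infsum_cong_neutral) (auto simp: Vu)
  finally have err: "tensor_inner k (\<lambda>xs. 1 * V xs + (-1) * u xs) (\<lambda>xs. 1 * V xs + (-1) * u xs) < e"
    using \<open>e > 0\<close> by (simp add: tensor_inner_def power2_eq_square)
  have "symmetrize k (\<lambda>xs. 1 * V xs + (-1) * u xs) = (\<lambda>xs. symmetrize k V xs - symmetrize k u xs)"
    by (rule ext) (subst symmetrize_lincomb, simp)
  then have "tensor_inner k (\<lambda>xs. symmetrize k V xs - symmetrize k u xs) (\<lambda>xs. symmetrize k V xs - symmetrize k u xs) < e"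
    using order.strict_trans1[OF symmetrize_norm_le[OF D] err] by (simp only:)
  moreover have "power_combination UNIV k (symmetrize k V)"
  proof -
    have "symmetrize k V = (\<lambda>xs. \<Sum>bs\<in>S. u bs * symmetrize k (pure_tensor bs) xs)"
      unfolding V_def by (rule ext) (rule symmetrize_sum)
    moreover have "length bs = k" if "bs \<in> S" for bs using that S(2) by (auto simp: basis_tuples_def)
    ultimately show ?thesis
      by (simp only:) (intro power_combination_sum power_combination_cmult power_combination_symmetrize)
  qed
  ultimately show ?thesis
    unfolding tensor_inner_integral power2_eq_square by blast
qed

lemma L2_lim_sum:
  assumes "\<And>i. i \<in> I \<Longrightarrow> L2_lim M (F i) (f i)"
  shows "L2_lim M (\<lambda>n x. \<Sum>i\<in>I. F i n x) (\<lambda>x. \<Sum>i\<in>I. f i x)"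
  using assms
proof (induction I rule: infinite_finite_induct)
  case (insert i I)
  then show ?case using L2_lim_add[of M "F i" "f i" "\<lambda>n x. \<Sum>i\<in>I. F i n x" "\<lambda>x. \<Sum>i\<in>I. f i x"] by simp
qed (simp_all add: L2_lim_const square_integrable_zero)

lemma pure_tensor_square_integrable:
  fixes hs :: "'h::real_inner list"
  assumes "orthonormal_basis (some_basis :: 'h set)" and "length hs = k"
  shows "square_integrable (tuples k) (pure_tensor hs)"
  using tensor_space_square_integrable[OF pure_tensor_in_tensor_space[OF assms(1), of hs]] assms(2) by simp

lemma pure_tensor_power_L2_lim:
  fixes h :: "'h::real_inner"
  assumes B: "orthonormal_basis (some_basis :: 'h set)" and h: "g \<longlonglongrightarrow> h"
  shows "L2_lim (tuples k) (\<lambda>n. pure_tensor (replicate k (g n))) (pure_tensor (replicate k h))"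
  unfolding L2_lim_def
proof (intro conjI allI)
  note sq = pure_tensor_square_integrable[OF B, of "replicate k _" k, simplified]
  show "square_integrable (tuples k) (pure_tensor (replicate k (g n)))" for n by (rule sq)
  show "square_integrable (tuples k) (pure_tensor (replicate k h))" by (rule sq)
  have ip: "(\<integral>bs. pure_tensor (replicate k x) bs * pure_tensor (replicate k y) bs \<partial>tuples k) = inner x y ^ k" for x y :: 'h
    using pure_tensor_inner[OF B, of "replicate k x" k "replicate k y"] by (simp add: tensor_inner_integral)
  have "(\<integral>bs. (pure_tensor (replicate k x) bs - pure_tensor (replicate k y) bs)\<^sup>2 \<partial>tuples k)
      = inner x x ^ k - 2 * inner x y ^ k + inner y y ^ k" for x y :: 'h
  proof -
    note i = square_integrable_mult[OF sq sq]
    have "(\<lambda>bs. (pure_tensor (replicate k x) bs - pure_tensor (replicate k y) bs)\<^sup>2)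
      = (\<lambda>bs. pure_tensor (replicate k x) bs * pure_tensor (replicate k x) bs
          - 2 * (pure_tensor (replicate k x) bs * pure_tensor (replicate k y) bs)
          + pure_tensor (replicate k y) bs * pure_tensor (replicate k y) bs)"
      by (rule ext) (simp add: power2_eq_square algebra_simps)
    then show ?thesis
      by (simp only: Bochner_Integration.integral_add[OF Bochner_Integration.integrable_diff[OF i integrable_mult_right[OF i]] i]
          Bochner_Integration.integral_diff[OF i integrable_mult_right[OF i]] integral_mult_right_zero ip)
  qed
  moreover have "(\<lambda>n. inner (g n) (g n) ^ k - 2 * inner (g n) h ^ k + inner h h ^ k) \<longlonglongrightarrow> inner h h ^ k - 2 * inner h h ^ k + inner h h ^ k"
    by (intro tendsto_intros h)
  ultimately show "(\<lambda>n. \<integral>bs. (pure_tensor (replicate k (g n)) bs - pure_tensor (replicate k h) bs)\<^sup>2 \<partial>tuples k) \<longlonglongrightarrow> 0"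
    by simp
qed

text \<open>
  A power depends continuously on its base vector, since the inner products of powers are powers of inner
  products. The base vectors may therefore be moved into a dense set.
\<close>
theorem dense_powers_approximate_symmetric:
  fixes v :: "'h::real_inner list \<Rightarrow> real"
  assumes B: "orthonormal_basis (some_basis :: 'h set)" and A: "closure A = (UNIV :: 'h set)"
    and v: "v \<in> tensor_space k"
  shows "\<exists>U. (\<forall>n. power_combination A k (U n)) \<and> L2_lim (tuples k) U (symmetrize k v)"
proof -
  define u where "u = symmetrize k v"
  have u: "u \<in> tensor_space k" unfolding u_def by (rule symmetrize_in_tensor_space[OF v])
  have step: "\<exists>U. power_combination A k U \<and> square_integrable (tuples k) U \<and> (\<integral>bs. (U bs - u bs)\<^sup>2 \<partial>tuples k) < e" if "e > 0" for e
  proof -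
    obtain V where V: "power_combination UNIV k V" "(\<integral>bs. (V bs - u bs)\<^sup>2 \<partial>tuples k) < e / 4"
      using powers_approximate_symmetric[OF B v, of "e/4"] \<open>e > 0\<close> unfolding u_def by auto
    obtain N c h where Vc: "V = (\<lambda>xs. \<Sum>i<(N::nat). c i * pure_tensor (replicate k (h i)) xs)"
      using V(1) unfolding power_combination_def by blast
    have "\<forall>i. \<exists>g. (\<forall>n. g n \<in> A) \<and> g \<longlonglongrightarrow> h i" using A unfolding closure_sequential[symmetric] by simp
    then obtain g where g: "\<And>i n. g i n \<in> A" "\<And>i. g i \<longlonglongrightarrow> h i" by metis
    define W where "W n = (\<lambda>xs. \<Sum>i<N. c i * pure_tensor (replicate k (g i n)) xs)" for n
    have lim: "L2_lim (tuples k) W V"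
      unfolding W_def Vc by (intro L2_lim_sum L2_lim_cmult pure_tensor_power_L2_lim[OF B] g)
    obtain n where n: "(\<integral>bs. (W n bs - V bs)\<^sup>2 \<partial>tuples k) < e / 4"
    proof -
      have "\<forall>\<^sub>F n in sequentially. (\<integral>bs. (W n bs - V bs)\<^sup>2 \<partial>tuples k) < e / 4"
        using order_tendstoD(2)[OF L2_limD(3)[OF lim], of "e/4"] \<open>e > 0\<close> by simp
      then show ?thesis using that eventually_happens'[OF sequentially_bot] by blast
    qed
    have sq: "square_integrable (tuples k) (W n)" "square_integrable (tuples k) V" "square_integrable (tuples k) u"
      using L2_limD(1,2)[OF lim] tensor_space_square_integrable[OF u] by auto
    have "(\<integral>bs. (W n bs - u bs)\<^sup>2 \<partial>tuples k) = (\<integral>bs. ((W n bs - V bs) + (V bs - u bs))\<^sup>2 \<partial>tuples k)" by simp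
    also have "\<dots> \<le> 2 * (\<integral>bs. (W n bs - V bs)\<^sup>2 \<partial>tuples k) + 2 * (\<integral>bs. (V bs - u bs)\<^sup>2 \<partial>tuples k)"
      by (intro integral_square_add_le square_integrable_diff sq)
    also have "\<dots> < e" using n V(2) by simp
    finally have "(\<integral>bs. (W n bs - u bs)\<^sup>2 \<partial>tuples k) < e" .
    moreover have "power_combination A k (W n)"
      unfolding W_def by (intro power_combination_sum power_combination_power g)
    ultimately show ?thesis using sq(1) by blast
  qed
  have "\<forall>n::nat. \<exists>U. power_combination A k U \<and> square_integrable (tuples k) U
      \<and> (\<integral>bs. (U bs - u bs)\<^sup>2 \<partial>tuples k) < 1 / real (Suc n)"
    by (intro allI step) simp
  then obtain U where U: "\<And>n::nat. power_combination A k (U n)" "\<And>n. square_integrable (tuples k) (U n)"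
    "\<And>n. (\<integral>bs. (U n bs - u bs)\<^sup>2 \<partial>tuples k) < 1 / real (Suc n)" by metis
  have z: "(\<lambda>n. 1 / real (Suc n)) \<longlonglongrightarrow> 0" using LIMSEQ_inverse_real_of_nat by (simp only: inverse_eq_divide)
  have "(\<lambda>n. \<integral>bs. (U n bs - u bs)\<^sup>2 \<partial>tuples k) \<longlonglongrightarrow> 0"
  proof (rule tendsto_sandwich[OF _ _ tendsto_const z])
    show "\<forall>\<^sub>F n in sequentially. 0 \<le> (\<integral>bs. (U n bs - u bs)\<^sup>2 \<partial>tuples k)" by simp
    show "\<forall>\<^sub>F n in sequentially. (\<integral>bs. (U n bs - u bs)\<^sup>2 \<partial>tuples k) \<le> 1 / real (Suc n)"
      by (intro always_eventually allI less_imp_le U(3))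
  qed
  then have "L2_lim (tuples k) U u"
    unfolding L2_lim_def using U(2) tensor_space_square_integrable[OF u] by blast
  with U(1) show ?thesis unfolding u_def by blast
qed

section \<open>Tensor products\<close>

lemma prod_lessThan_add:
  fixes f :: "nat \<Rightarrow> 'a::comm_monoid_mult"
  shows "(\<Prod>i<m + n. f i) = (\<Prod>i<m. f i) * (\<Prod>i<n. f (m + i))"
  by (induction n) (simp_all add: mult.assoc)

lemma tensor_prod_in_tensor_space:
  assumes u: "u \<in> tensor_space m" and v: "v \<in> tensor_space n"
  shows "tensor_prod m u v \<in> tensor_space (m + n)"
  unfolding tensor_space_def
proof (intro CollectI conjI allI impI)
  show "tensor_prod m u v xs = 0" if "length xs \<noteq> m + n" for xs
  proof (cases "length xs < m")
    case True
    then show ?thesis using tensor_space_length[OF u, of "take m xs"] by (simp add: tensor_prod_def)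
  next
    case False
    then show ?thesis using tensor_space_length[OF v, of "drop m xs"] that by (simp add: tensor_prod_def)
  qed
  show "linear (\<lambda>x. tensor_prod m u v (xs[i := x]))" if xs: "length xs = m + n" and i: "i < m + n" for xs i
  proof (cases "i < m")
    case True
    then have "linear (\<lambda>x. v (drop m xs) *\<^sub>R u ((take m xs)[i := x]))"
      using xs by (intro linear_compose_scale_right tensor_space_linear[OF u]) simp_all
    then show ?thesis using True by (simp add: tensor_prod_def take_update_swap mult.commute)
  next
    case False
    then have "linear (\<lambda>x. u (take m xs) *\<^sub>R v ((drop m xs)[i - m := x]))"
      using xs i by (intro linear_compose_scale_right tensor_space_linear[OF v]) simp_all
    then show ?thesis using False by (simp add: tensor_prod_def drop_update_swap)
  qed
  obtain C where C: "C \<ge> 0" "\<And>xs. length xs = m \<Longrightarrow> \<bar>u xs\<bar> \<le> C * (\<Prod>i<m. norm (xs ! i))"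
    using tensor_space_bounded[OF u] by blast
  obtain D where D: "D \<ge> 0" "\<And>xs. length xs = n \<Longrightarrow> \<bar>v xs\<bar> \<le> D * (\<Prod>i<n. norm (xs ! i))"
    using tensor_space_bounded[OF v] by blast
  have "\<bar>tensor_prod m u v xs\<bar> \<le> (C * D) * (\<Prod>i<m + n. norm (xs ! i))" if xs: "length xs = m + n" for xs
  proof -
    have "\<bar>tensor_prod m u v xs\<bar> = \<bar>u (take m xs)\<bar> * \<bar>v (drop m xs)\<bar>"
      by (simp add: tensor_prod_def abs_mult)
    also have "\<dots> \<le> (C * (\<Prod>i<m. norm (take m xs ! i))) * (D * (\<Prod>i<n. norm (drop m xs ! i)))"
      using xs C(1) by (intro mult_mono C D mult_nonneg_nonneg prod_nonneg) simp_all
    also have "(\<Prod>i<m. norm (take m xs ! i)) = (\<Prod>i<m. norm (xs ! i))"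
      by (intro prod.cong) simp_all
    also have "(\<Prod>i<n. norm (drop m xs ! i)) = (\<Prod>i<n. norm (xs ! (m + i)))"
      using xs by (intro prod.cong) simp_all
    finally show ?thesis by (simp add: prod_lessThan_add mult_ac)
  qed
  then show "\<exists>C. \<forall>xs. length xs = m + n \<longrightarrow> \<bar>tensor_prod m u v xs\<bar> \<le> C * (\<Prod>i<m + n. norm (xs ! i))" by blast
  have "((\<lambda>xs. (u (take m xs))\<^sup>2 * (v (drop m xs))\<^sup>2) has_sum
      infsum (\<lambda>xs. (u xs)\<^sup>2) (basis_tuples m) * infsum (\<lambda>xs. (v xs)\<^sup>2) (basis_tuples n)) (basis_tuples (m + n))"
    using u v unfolding tensor_space_def
    by (intro has_sum_tuples_append[where u="\<lambda>xs. (u xs)\<^sup>2" and v="\<lambda>xs. (v xs)\<^sup>2"] has_sum_infsum) blast+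
  then show "(\<lambda>bs. (tensor_prod m u v bs)\<^sup>2) summable_on basis_tuples (m + n)"
    unfolding tensor_prod_def power_mult_distrib by (rule has_sum_imp_summable)
qed

lemma tensor_prod_norm:
  assumes u: "u \<in> tensor_space m" and v: "v \<in> tensor_space n"
  shows "tensor_inner (m + n) (tensor_prod m u v) (tensor_prod m u v) = tensor_inner m u u * tensor_inner n v v"
proof -
  have "((\<lambda>xs. (u (take m xs))\<^sup>2 * (v (drop m xs))\<^sup>2) has_sum
      infsum (\<lambda>xs. (u xs)\<^sup>2) (basis_tuples m) * infsum (\<lambda>xs. (v xs)\<^sup>2) (basis_tuples n)) (basis_tuples (m + n))"
    using u v unfolding tensor_space_def
    by (intro has_sum_tuples_append[where u="\<lambda>xs. (u xs)\<^sup>2" and v="\<lambda>xs. (v xs)\<^sup>2"] has_sum_infsum) blast+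
  from infsumI[OF this] show ?thesis
    unfolding tensor_inner_def power2_eq_square[symmetric] tensor_prod_def power_mult_distrib .
qed

lemma pure_tensor_Nil_norm: "tensor_inner 0 (pure_tensor []) (pure_tensor []) = 1"
  by (simp add: tensor_inner_def basis_tuples_0 pure_tensor_def)

lemma tensor_power_2:
  fixes g :: "'h::real_inner list \<Rightarrow> real"
  assumes B: "orthonormal_basis (some_basis :: 'h set)" and g: "g \<in> tensor_space 2"
  shows "tensor_power 2 g k \<in> tensor_space (2 * k)"
    and "tensor_inner (2 * k) (tensor_power 2 g k) (tensor_power 2 g k) = (tensor_inner 2 g g) ^ k"
    and "tensor_power 2 g k (replicate (2 * k) h) = (g [h, h]) ^ k"
proof (induction k)
  case 0
  {
    case 1 show ?case using pure_tensor_in_tensor_space[OF B, of "[]"] by simp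
    case 2 show ?case by (simp add: pure_tensor_Nil_norm)
    case 3 show ?case by (simp add: pure_tensor_def)
  }
next
  case (Suc k)
  {
    case 1 show ?case using tensor_prod_in_tensor_space[OF g Suc(1)] by simp
    case 2 show ?case using tensor_prod_norm[OF g Suc(1)] Suc(2) by simp
    case 3 show ?case using Suc(3) by (simp add: tensor_prod_def numeral_2_eq_2)
  }
qed

section \<open>Multiple integrals\<close>

lemma symmetrize_power:
  "symmetrize k (pure_tensor (replicate k h)) = pure_tensor (replicate k h)"
proof
  fix xs
  show "symmetrize k (pure_tensor (replicate k h)) xs = pure_tensor (replicate k h) xs"
  proof (cases "length xs = k")
    case True
    have "pure_tensor (replicate k h) (permute_list p xs) = pure_tensor (replicate k h) xs" if p: "p permutes {..<k}" for p
    proof -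
      have "pure_tensor (replicate k h) (permute_list p xs) = (\<Prod>i<k. inner h (xs ! p i))"
        using True p by (simp add: pure_tensor_def permute_list_nth)
      also have "\<dots> = (\<Prod>i<k. inner h (xs ! i))"
        by (rule prod.reindex_bij_betw[OF permutes_imp_bij[OF p]])
      finally show ?thesis using True by (simp add: pure_tensor_def)
    qed
    moreover have "card {p. p permutes {..<k}} = fact k" by (rule card_permutations) simp_all
    ultimately show ?thesis using True by (simp add: symmetrize_def)
  qed (simp add: symmetrize_def pure_tensor_def)
qed

lemma integral_sum_mult_sum:
  fixes c d :: "nat \<Rightarrow> real"
  assumes "\<And>i j. integrable M (\<lambda>x. f i x * g j x)"
  shows "(\<integral>x. (\<Sum>i<(N::nat). c i * f i x) * (\<Sum>j<(L::nat). d j * g j x) \<partial>M)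
    = (\<Sum>i<N. \<Sum>j<L. c i * d j * (\<integral>x. f i x * g j x \<partial>M))"
proof -
  have "(\<Sum>i<N. c i * f i x) * (\<Sum>j<L. d j * g j x) = (\<Sum>i<N. \<Sum>j<L. c i * d j * (f i x * g j x))" for x
    unfolding sum_product by (intro sum.cong refl) simp
  then have "(\<integral>x. (\<Sum>i<N. c i * f i x) * (\<Sum>j<L. d j * g j x) \<partial>M)
      = (\<integral>x. (\<Sum>i<N. \<Sum>j<L. c i * d j * (f i x * g j x)) \<partial>M)" by simp
  also have "\<dots> = (\<Sum>i<N. \<integral>x. (\<Sum>j<L. c i * d j * (f i x * g j x)) \<partial>M)"
    by (rule Bochner_Integration.integral_sum)
      (intro Bochner_Integration.integrable_sum integrable_mult_right assms)
  also have "\<dots> = (\<Sum>i<N. \<Sum>j<L. \<integral>x. c i * d j * (f i x * g j x) \<partial>M)"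
    by (intro sum.cong refl Bochner_Integration.integral_sum integrable_mult_right assms)
  finally show ?thesis by simp
qed

lemma L2_lim_Cauchy:
  assumes L: "L2_lim M F f" and "e > 0"
  shows "\<exists>N. \<forall>m\<ge>N. \<forall>n\<ge>N. (\<integral>x. (F m x - F n x)\<^sup>2 \<partial>M) < e"
proof -
  have "\<forall>\<^sub>F n in sequentially. (\<integral>x. (F n x - f x)\<^sup>2 \<partial>M) < e / 4"
    using order_tendstoD(2)[OF L2_limD(3)[OF L], of "e/4"] \<open>e > 0\<close> by simp
  then obtain N where N: "\<And>n. n \<ge> N \<Longrightarrow> (\<integral>x. (F n x - f x)\<^sup>2 \<partial>M) < e / 4"
    unfolding eventually_sequentially by blast
  have "(\<integral>x. (F m x - F n x)\<^sup>2 \<partial>M) < e" if mn: "m \<ge> N" "n \<ge> N" for m n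
  proof -
    have "(\<integral>x. (F m x - F n x)\<^sup>2 \<partial>M) = (\<integral>x. ((F m x - f x) + (f x - F n x))\<^sup>2 \<partial>M)" by simp
    also have "\<dots> \<le> 2 * (\<integral>x. (F m x - f x)\<^sup>2 \<partial>M) + 2 * (\<integral>x. (f x - F n x)\<^sup>2 \<partial>M)"
      by (intro integral_square_add_le square_integrable_diff L2_limD[OF L])
    also have "(\<integral>x. (f x - F n x)\<^sup>2 \<partial>M) = (\<integral>x. (F n x - f x)\<^sup>2 \<partial>M)"
      by (simp add: power2_commute)
    finally show ?thesis using N[OF mn(1)] N[OF mn(2)] by linarith
  qed
  then show ?thesis by blast
qed

text \<open>
  Inner products of tensors are computed in \<open>some_basis\<close>, a choice that is an orthonormal basis as soon as
  one exists. Assuming the latter separates the chaos from the existence of bases.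
\<close>
locale wiener_chaos = abstract_wiener_space \<iota> \<mu>
  for \<iota> :: "'h::{real_inner, complete_space, second_countable_topology}
               \<Rightarrow> 'w::{banach, second_countable_topology}" and \<mu> +
  assumes basis: "orthonormal_basis (some_basis :: 'h set)"
begin

text \<open>
  The multiple integral of order \<open>k\<close> of the tensor \<open>power_sum k N c \<phi>\<close>.
\<close>
definition hermite_sum :: "nat \<Rightarrow> nat \<Rightarrow> (nat \<Rightarrow> real) \<Rightarrow> (nat \<Rightarrow> 'w \<Rightarrow>\<^sub>L real) \<Rightarrow> 'w \<Rightarrow> real" where
  "hermite_sum k N c \<phi> w = (\<Sum>i<N. c i * hermite k ((norm (J (\<phi> i)))\<^sup>2) (blinfun_apply (\<phi> i) w))"

definition power_sum :: "nat \<Rightarrow> nat \<Rightarrow> (nat \<Rightarrow> real) \<Rightarrow> (nat \<Rightarrow> 'w \<Rightarrow>\<^sub>L real) \<Rightarrow> 'h list \<Rightarrow> real" where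
  "power_sum k N c \<phi> xs = (\<Sum>i<N. c i * pure_tensor (replicate k (J (\<phi> i))) xs)"

lemma hermite_sum_square_integrable: "square_integrable \<mu> (hermite_sum k N c \<phi>)"
  unfolding hermite_sum_def
  by (intro square_integrable_sum square_integrable_cmult moments_square_integrable moments_hermite)

lemma power_square_integrable: "square_integrable (tuples k) (pure_tensor (replicate k (h :: 'h)))"
  by (rule pure_tensor_square_integrable[OF basis]) simp

lemma power_sum_square_integrable: "square_integrable (tuples k) (power_sum k N c \<phi>)"
  unfolding power_sum_def by (intro square_integrable_sum square_integrable_cmult power_square_integrable)

text \<open>
  Both sides are bilinear, and on single powers the identity is the orthogonality of the Hermite
  polynomials, as \<open>\<langle>x, y\<rangle>\<^sup>k\<close> is the inner product of the \<open>k\<close>-th powers of \<open>x\<close> and \<open>y\<close>.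
\<close>
lemma hermite_sum_inner:
  "(\<integral>w. hermite_sum k N c \<phi> w * hermite_sum l L d \<psi> w \<partial>\<mu>)
    = (if k = l then fact k * (\<integral>bs. power_sum k N c \<phi> bs * power_sum l L d \<psi> bs \<partial>tuples k) else 0)"
proof -
  have 1: "(\<integral>w. hermite_sum k N c \<phi> w * hermite_sum l L d \<psi> w \<partial>\<mu>)
    = (\<Sum>i<N. \<Sum>j<L. c i * d j * (if k = l then fact k * (inner (J (\<phi> i)) (J (\<psi> j))) ^ k else 0))"
    unfolding hermite_sum_def hermite_orthogonal[symmetric]
    by (rule integral_sum_mult_sum) (intro moments_integrable moments_mult moments_hermite)
  show ?thesis
  proof (cases "k = l")
    case True
    have "(\<integral>bs. power_sum k N c \<phi> bs * power_sum k L d \<psi> bs \<partial>tuples k)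
      = (\<Sum>i<N. \<Sum>j<L. c i * d j * (\<integral>bs. pure_tensor (replicate k (J (\<phi> i))) bs * pure_tensor (replicate k (J (\<psi> j))) bs \<partial>tuples k))"
      unfolding power_sum_def
      by (rule integral_sum_mult_sum) (intro square_integrable_mult power_square_integrable)
    also have "\<dots> = (\<Sum>i<N. \<Sum>j<L. c i * d j * (inner (J (\<phi> i)) (J (\<psi> j))) ^ k)"
      unfolding tensor_inner_integral[symmetric]
      by (intro sum.cong refl arg_cong2[of _ _ _ _ "(*)"]) (simp add: pure_tensor_inner[OF basis])
    finally show ?thesis using True unfolding 1 by (simp add: sum_distrib_left mult_ac)
  next
    case False
    then show ?thesis unfolding 1 by simp
  qed
qed

lemma hermite_sum_dist:
  "(\<integral>w. (hermite_sum k N c \<phi> w - hermite_sum k L d \<psi> w)\<^sup>2 \<partial>\<mu>)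
    = fact k * (\<integral>bs. (power_sum k N c \<phi> bs - power_sum k L d \<psi> bs)\<^sup>2 \<partial>tuples k)"
proof -
  have expand: "(\<integral>x. (f x - g x)\<^sup>2 \<partial>M) = (\<integral>x. f x * f x \<partial>M) - 2 * (\<integral>x. f x * g x \<partial>M) + (\<integral>x. g x * g x \<partial>M)"
    if f: "square_integrable M f" and g: "square_integrable M g" for M :: "'z measure" and f g
  proof -
    have "(\<lambda>x. (f x - g x)\<^sup>2) = (\<lambda>x. f x * f x - 2 * (f x * g x) + g x * g x)"
      by (rule ext) (simp add: power2_eq_square algebra_simps)
    then show ?thesis
      by (simp only: Bochner_Integration.integral_add[OF Bochner_Integration.integrable_diff[OF square_integrable_mult[OF f f]
            integrable_mult_right[OF square_integrable_mult[OF f g]]] square_integrable_mult[OF g g]]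
          Bochner_Integration.integral_diff[OF square_integrable_mult[OF f f] integrable_mult_right[OF square_integrable_mult[OF f g]]]
          integral_mult_right_zero)
  qed
  show ?thesis
    unfolding expand[OF hermite_sum_square_integrable hermite_sum_square_integrable]
      expand[OF power_sum_square_integrable power_sum_square_integrable] hermite_sum_inner
    by (simp add: algebra_simps)
qed

lemma is_multiple_integral_iff:
  assumes u: "u \<in> tensor_space k"
  shows "is_multiple_integral \<iota> \<mu> k u D \<longleftrightarrow> (\<exists>N c \<phi>.
    L2_lim (tuples k) (\<lambda>n. power_sum k (N n) (c n) (\<phi> n)) (symmetrize k u) \<and>
    L2_lim \<mu> (\<lambda>n. hermite_sum k (N n) (c n) (\<phi> n)) D)"
proof -
  have sq: "square_integrable (tuples k) (symmetrize k u)"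
    by (rule tensor_space_square_integrable[OF symmetrize_in_tensor_space[OF u]])
  show ?thesis
  proof
    assume "is_multiple_integral \<iota> \<mu> k u D"
    then obtain N c \<phi> U where U: "\<And>n xs. U n xs = power_sum k (N n) (c n) (\<phi> n) xs"
      "(\<lambda>n. tensor_inner k (\<lambda>xs. U n xs - symmetrize k u xs) (\<lambda>xs. U n xs - symmetrize k u xs)) \<longlonglongrightarrow> 0"
      "L2_lim \<mu> (\<lambda>n. hermite_sum k (N n) (c n) (\<phi> n)) D"
      unfolding is_multiple_integral_def power_sum_def hermite_sum_def by blast
    have "L2_lim (tuples k) (\<lambda>n. power_sum k (N n) (c n) (\<phi> n)) (symmetrize k u)"
      using U(2) sq power_sum_square_integrable
      unfolding L2_lim_def tensor_inner_integral U(1) power2_eq_square by blast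
    with U(3) show "\<exists>N c \<phi>. L2_lim (tuples k) (\<lambda>n. power_sum k (N n) (c n) (\<phi> n)) (symmetrize k u) \<and>
        L2_lim \<mu> (\<lambda>n. hermite_sum k (N n) (c n) (\<phi> n)) D" by blast
  next
    assume "\<exists>N c \<phi>. L2_lim (tuples k) (\<lambda>n. power_sum k (N n) (c n) (\<phi> n)) (symmetrize k u) \<and>
        L2_lim \<mu> (\<lambda>n. hermite_sum k (N n) (c n) (\<phi> n)) D"
    then obtain N c \<phi> where L: "L2_lim (tuples k) (\<lambda>n. power_sum k (N n) (c n) (\<phi> n)) (symmetrize k u)"
      "L2_lim \<mu> (\<lambda>n. hermite_sum k (N n) (c n) (\<phi> n)) D" by blast
    show "is_multiple_integral \<iota> \<mu> k u D"
      unfolding is_multiple_integral_def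
    proof (intro exI conjI allI)
      show "power_sum k (N n) (c n) (\<phi> n) xs
          = (\<Sum>i<N n. c n i * pure_tensor (replicate k (dual_embed \<iota> (\<phi> n i))) xs)" for n xs
        by (simp add: power_sum_def)
      show "(\<lambda>n. tensor_inner k (\<lambda>xs. power_sum k (N n) (c n) (\<phi> n) xs - symmetrize k u xs)
          (\<lambda>xs. power_sum k (N n) (c n) (\<phi> n) xs - symmetrize k u xs)) \<longlonglongrightarrow> 0"
        using L2_limD(3)[OF L(1)] unfolding tensor_inner_integral power2_eq_square .
      show "L2_lim \<mu> (\<lambda>n w. \<Sum>i<N n. c n i * hermite k ((norm (dual_embed \<iota> (\<phi> n i)))\<^sup>2) (blinfun_apply (\<phi> n i) w)) D"
        using L(2) unfolding hermite_sum_def .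
    qed
  qed
qed

text \<open>
  Up to the factor \<open>k!\<close> the map from powers to Hermite polynomials is an isometry, so it carries an
  approximating sequence of tensors to a Cauchy sequence.
\<close>
theorem multiple_integral_exists:
  assumes u: "u \<in> tensor_space k"
  shows "is_multiple_integral \<iota> \<mu> k u (multiple_integral \<iota> \<mu> k u)"
proof -
  obtain U where U: "\<And>n. power_combination (range J) k (U n)" "L2_lim (tuples k) U (symmetrize k u)"
    using dense_powers_approximate_symmetric[OF basis J_dense u] by blast
  have "\<exists>N c \<phi>. U n = power_sum k N c \<phi>" for n
  proof -
    obtain N c h where h: "\<forall>i<N. h i \<in> range J" "U n = (\<lambda>xs. \<Sum>i<(N::nat). c i * pure_tensor (replicate k (h i)) xs)"
      using U(1)[of n] unfolding power_combination_def by blast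
    have "\<forall>i. \<exists>\<phi>. i < N \<longrightarrow> h i = J \<phi>" using h(1) by blast
    then obtain \<phi> where "\<And>i. i < N \<Longrightarrow> h i = J (\<phi> i)" by metis
    then have "U n = power_sum k N c \<phi>"
      unfolding h(2) power_sum_def by (intro ext sum.cong refl) simp
    then show ?thesis by blast
  qed
  then obtain N c \<phi> where Ueq: "\<And>n. U n = power_sum k (N n) (c n) (\<phi> n)" by metis
  have L: "L2_lim (tuples k) (\<lambda>n. power_sum k (N n) (c n) (\<phi> n)) (symmetrize k u)"
    using U(2) unfolding Ueq[abs_def] .
  have "\<exists>D. L2_lim \<mu> (\<lambda>n. hermite_sum k (N n) (c n) (\<phi> n)) D"
  proof (rule mu.L2_complete[OF hermite_sum_square_integrable])
    fix e :: real assume "e > 0"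
    then show "\<exists>M. \<forall>m\<ge>M. \<forall>n\<ge>M. (\<integral>w. (hermite_sum k (N m) (c m) (\<phi> m) w - hermite_sum k (N n) (c n) (\<phi> n) w)\<^sup>2 \<partial>\<mu>) < e"
      using L2_lim_Cauchy[OF L, of "e / fact k"] unfolding hermite_sum_dist by (simp add: field_simps)
  qed
  with L have "\<exists>D. is_multiple_integral \<iota> \<mu> k u D"
    unfolding is_multiple_integral_iff[OF u] by blast
  then show ?thesis unfolding multiple_integral_def by (rule someI_ex)
qed

lemma multiple_integral_inner:
  assumes "u \<in> tensor_space k" "v \<in> tensor_space l"
    and "is_multiple_integral \<iota> \<mu> k u D" "is_multiple_integral \<iota> \<mu> l v E"
  shows "(\<integral>w. D w * E w \<partial>\<mu>) = (if k = l then fact k * tensor_inner k (symmetrize k u) (symmetrize l v) else 0)"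
proof -
  obtain N c \<phi> where D: "L2_lim (tuples k) (\<lambda>n. power_sum k (N n) (c n) (\<phi> n)) (symmetrize k u)"
    "L2_lim \<mu> (\<lambda>n. hermite_sum k (N n) (c n) (\<phi> n)) D"
    using assms(3) unfolding is_multiple_integral_iff[OF assms(1)] by blast
  obtain L d \<psi> where E: "L2_lim (tuples l) (\<lambda>n. power_sum l (L n) (d n) (\<psi> n)) (symmetrize l v)"
    "L2_lim \<mu> (\<lambda>n. hermite_sum l (L n) (d n) (\<psi> n)) E"
    using assms(4) unfolding is_multiple_integral_iff[OF assms(2)] by blast
  have 1: "(\<lambda>n. if k = l then fact k * (\<integral>bs. power_sum k (N n) (c n) (\<phi> n) bs * power_sum l (L n) (d n) (\<psi> n) bs \<partial>tuples k) else 0)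
      \<longlonglongrightarrow> (\<integral>w. D w * E w \<partial>\<mu>)"
    using L2_lim_integral_mult[OF D(2) E(2)] unfolding hermite_sum_inner .
  show ?thesis
  proof (cases "k = l")
    case True
    from 1 True have l1: "(\<lambda>n. fact k * (\<integral>bs. power_sum k (N n) (c n) (\<phi> n) bs * power_sum l (L n) (d n) (\<psi> n) bs \<partial>tuples k))
      \<longlonglongrightarrow> (\<integral>w. D w * E w \<partial>\<mu>)" by (simp only: if_True refl)
    have l2: "(\<lambda>n. fact k * (\<integral>bs. power_sum k (N n) (c n) (\<phi> n) bs * power_sum l (L n) (d n) (\<psi> n) bs \<partial>tuples k))
      \<longlonglongrightarrow> fact k * tensor_inner k (symmetrize k u) (symmetrize l v)"
      unfolding tensor_inner_integral using D(1) E(1) True by (intro tendsto_mult tendsto_const L2_lim_integral_mult) simp_all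
    from LIMSEQ_unique[OF l1 l2] True show ?thesis by simp
  next
    case False
    with 1 show ?thesis by (simp add: LIMSEQ_const_iff)
  qed
qed

lemma multiple_integral_square_integrable:
  "u \<in> tensor_space k \<Longrightarrow> square_integrable \<mu> (multiple_integral \<iota> \<mu> k u)"
  using multiple_integral_exists[of u k] is_multiple_integral_iff[of u k] L2_limD(2) by blast

text \<open>
  For a power this is the characteristic integral of a Hermite polynomial. The value of a tensor at
  \<open>J \<eta>, \<dots>, J \<eta>\<close> is an inner product by the reproducing property, which makes it continuous in the tensor,
  and symmetrization does not change it.
\<close>
lemma multiple_integral_char:
  assumes u: "u \<in> tensor_space k" and D: "is_multiple_integral \<iota> \<mu> k u D"
  shows "char_int D \<eta> = \<i> ^ k * of_real (u (replicate k (J \<eta>)) * exp (- (norm (J \<eta>))\<^sup>2 / 2))"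
proof -
  obtain N c \<phi> where D: "L2_lim (tuples k) (\<lambda>n. power_sum k (N n) (c n) (\<phi> n)) (symmetrize k u)"
    "L2_lim \<mu> (\<lambda>n. hermite_sum k (N n) (c n) (\<phi> n)) D"
    using D unfolding is_multiple_integral_iff[OF u] by blast
  define x where "x = replicate k (J \<eta>)"
  have lim1: "(\<lambda>n. char_int (hermite_sum k (N n) (c n) (\<phi> n)) \<eta>) \<longlonglongrightarrow> char_int D \<eta>"
    unfolding char_int_def
    by (rule L2_lim_integral_complex[OF D(2)]) (simp_all add: mu.square_integrable_const)
  have eq: "char_int (hermite_sum k (N n) (c n) (\<phi> n)) \<eta>
      = \<i> ^ k * of_real (tensor_inner k (power_sum k (N n) (c n) (\<phi> n)) (pure_tensor x) * exp (- (norm (J \<eta>))\<^sup>2 / 2))" for n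
  proof -
    define E where "E = complex_of_real (exp (- (norm (J \<eta>))\<^sup>2 / 2))"
    define H where "H i w = hermite k ((norm (J (\<phi> n i)))\<^sup>2) (blinfun_apply (\<phi> n i) w)" for i w
    have mH: "moments (H i)" for i unfolding H_def by (rule moments_hermite)
    have "char_int (hermite_sum k (N n) (c n) (\<phi> n)) \<eta>
        = (CLINT w|\<mu>. (\<Sum>i<N n. of_real (c n i) * (complex_of_real (H i w) * iexp (blinfun_apply \<eta> w))))"
      unfolding char_int_def hermite_sum_def H_def[symmetric] of_real_sum of_real_mult sum_distrib_right mult.assoc ..
    also have "\<dots> = (\<Sum>i<N n. CLINT w|\<mu>. of_real (c n i) * (complex_of_real (H i w) * iexp (blinfun_apply \<eta> w)))"
      by (intro Bochner_Integration.integral_sum integrable_mult_right char_int_integrable mH)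
    also have "\<dots> = (\<Sum>i<N n. of_real (c n i) * char_int (H i) \<eta>)"
      unfolding char_int_def by (simp only: integral_mult_right_zero)
    also have "\<dots> = (\<Sum>i<N n. of_real (c n i) * ((\<i> * of_real (inner (J (\<phi> n i)) (J \<eta>))) ^ k * E))"
      unfolding H_def char_int_hermite E_def ..
    also have "\<dots> = \<i> ^ k * of_real (\<Sum>i<N n. c n i * inner (J (\<phi> n i)) (J \<eta>) ^ k) * E"
      by (simp add: sum_distrib_left sum_distrib_right power_mult_distrib mult_ac)
    also have "(\<Sum>i<N n. c n i * inner (J (\<phi> n i)) (J \<eta>) ^ k) = power_sum k (N n) (c n) (\<phi> n) x"
      unfolding power_sum_def x_def by (simp add: pure_tensor_def)
    also have "power_sum k (N n) (c n) (\<phi> n) x = tensor_inner k (power_sum k (N n) (c n) (\<phi> n)) (pure_tensor x)"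
    proof (rule tensor_reproducing[OF basis, symmetric])
      have "(\<lambda>xs. \<Sum>i<N n. c n i * pure_tensor (replicate k (J (\<phi> n i))) xs + 0 * u xs) \<in> tensor_space k"
        using pure_tensor_in_tensor_space[OF basis, of "replicate k _"]
        by (intro tensor_space_sum tensor_space_lincomb u) simp
      then show "power_sum k (N n) (c n) (\<phi> n) \<in> tensor_space k" by (simp add: power_sum_def[abs_def])
    qed (simp add: x_def)
    finally show ?thesis unfolding E_def by (simp add: mult.assoc)
  qed
  have "(\<lambda>n. tensor_inner k (power_sum k (N n) (c n) (\<phi> n)) (pure_tensor x)) \<longlonglongrightarrow> u x"
  proof -
    have "(\<lambda>n. tensor_inner k (power_sum k (N n) (c n) (\<phi> n)) (pure_tensor x)) \<longlonglongrightarrow> tensor_inner k (symmetrize k u) (pure_tensor x)"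
      unfolding tensor_inner_integral x_def
      by (intro L2_lim_integral_mult D L2_lim_const power_square_integrable)
    also have "tensor_inner k (symmetrize k u) (pure_tensor x) = symmetrize k u x"
      by (rule tensor_reproducing[OF basis symmetrize_in_tensor_space[OF u]]) (simp add: x_def)
    finally show ?thesis unfolding x_def symmetrize_replicate .
  qed
  then have lim2: "(\<lambda>n. \<i> ^ k * of_real (tensor_inner k (power_sum k (N n) (c n) (\<phi> n)) (pure_tensor x) * exp (- (norm (J \<eta>))\<^sup>2 / 2)))
      \<longlonglongrightarrow> \<i> ^ k * of_real (u x * exp (- (norm (J \<eta>))\<^sup>2 / 2))"
    by (intro tendsto_intros)
  show ?thesis using LIMSEQ_unique[OF lim1[unfolded eq] lim2] unfolding x_def .
qed

lemma hermite_is_multiple_integral: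
  "is_multiple_integral \<iota> \<mu> k (pure_tensor (replicate k (J \<psi>))) (\<lambda>w. hermite k ((norm (J \<psi>))\<^sup>2) (blinfun_apply \<psi> w))"
proof -
  have ts: "pure_tensor (replicate k (J \<psi>)) \<in> tensor_space k"
    using pure_tensor_in_tensor_space[OF basis, of "replicate k (J \<psi>)"] by simp
  have 1: "power_sum k 1 (\<lambda>_. 1) (\<lambda>_. \<psi>) = pure_tensor (replicate k (J \<psi>))"
    by (rule ext) (simp add: power_sum_def)
  have 2: "hermite_sum k 1 (\<lambda>_. 1) (\<lambda>_. \<psi>) = (\<lambda>w. hermite k ((norm (J \<psi>))\<^sup>2) (blinfun_apply \<psi> w))"
    by (rule ext) (simp add: hermite_sum_def)
  show ?thesis unfolding is_multiple_integral_iff[OF ts]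
    by (rule exI[of _ "\<lambda>_. 1"], rule exI[of _ "\<lambda>_ _. 1"], rule exI[of _ "\<lambda>_ _. \<psi>"])
      (simp only: 1 2 symmetrize_power L2_lim_const power_square_integrable
        moments_square_integrable[OF moments_hermite] simp_thms)
qed

text \<open>
  The Hermite polynomial is itself the multiple integral of a power, against which a tensor is evaluated
  by the reproducing property.
\<close>
lemma multiple_integral_hermite:
  assumes u: "u \<in> tensor_space k" and D: "is_multiple_integral \<iota> \<mu> k u D"
  shows "(\<integral>w. D w * hermite l ((norm (J \<psi>))\<^sup>2) (blinfun_apply \<psi> w) \<partial>\<mu>)
    = (if k = l then fact k * u (replicate k (J \<psi>)) else 0)"
proof -
  have ts: "pure_tensor (replicate l (J \<psi>)) \<in> tensor_space l"
    using pure_tensor_in_tensor_space[OF basis, of "replicate l (J \<psi>)"] by simp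
  have "tensor_inner k (symmetrize k u) (pure_tensor (replicate k (J \<psi>))) = u (replicate k (J \<psi>))"
    using tensor_reproducing[OF basis symmetrize_in_tensor_space[OF u], of "replicate k (J \<psi>)"]
    by (simp add: symmetrize_replicate)
  then show ?thesis
    using multiple_integral_inner[OF u ts D hermite_is_multiple_integral] unfolding symmetrize_power
    by (cases "k = l") simp_all
qed

lemma chaos_kernels_hermite:
  assumes f: "chaos_kernels \<iota> \<mu> f F"
  shows "(\<integral>w. f w * hermite l ((norm (J \<psi>))\<^sup>2) (blinfun_apply \<psi> w) \<partial>\<mu>) = fact l * F l (replicate l (J \<psi>))"
proof -
  define H where "H w = hermite l ((norm (J \<psi>))\<^sup>2) (blinfun_apply \<psi> w)" for w
  have F: "F k \<in> tensor_space k" for k using f by (simp add: chaos_kernels_def sym_tensor_space_def)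
  have H: "square_integrable \<mu> H" unfolding H_def by (rule moments_square_integrable[OF moments_hermite])
  have "L2_lim \<mu> (\<lambda>N w. \<Sum>k<N. multiple_integral \<iota> \<mu> k (F k) w) f"
    using f by (simp add: chaos_kernels_def L2_sums_def)
  from L2_lim_integral_mult[OF this L2_lim_const[OF H]]
  have "(\<lambda>N. \<integral>w. (\<Sum>k<N. multiple_integral \<iota> \<mu> k (F k) w) * H w \<partial>\<mu>) \<longlonglongrightarrow> (\<integral>w. f w * H w \<partial>\<mu>)" .
  moreover have "(\<integral>w. (\<Sum>k<N. multiple_integral \<iota> \<mu> k (F k) w) * H w \<partial>\<mu>) = fact l * F l (replicate l (J \<psi>))"
    if "N > l" for N
  proof -
    have "(\<integral>w. (\<Sum>k<N. multiple_integral \<iota> \<mu> k (F k) w) * H w \<partial>\<mu>)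
        = (\<Sum>k<N. \<integral>w. multiple_integral \<iota> \<mu> k (F k) w * H w \<partial>\<mu>)"
      unfolding sum_distrib_right
      by (intro Bochner_Integration.integral_sum square_integrable_mult multiple_integral_square_integrable F H)
    also have "\<dots> = (\<Sum>k<N. if k = l then fact k * F k (replicate k (J \<psi>)) else 0)"
      unfolding H_def by (intro sum.cong refl multiple_integral_hermite[OF F multiple_integral_exists[OF F]])
    also have "\<dots> = fact l * F l (replicate l (J \<psi>))" using that by simp
    finally show ?thesis .
  qed
  then have "\<forall>\<^sub>F N in sequentially. (\<integral>w. (\<Sum>k<N. multiple_integral \<iota> \<mu> k (F k) w) * H w \<partial>\<mu>) = fact l * F l (replicate l (J \<psi>))"
    by (intro eventually_sequentiallyI[of "Suc l"]) simp
  then have "(\<lambda>N. \<integral>w. (\<Sum>k<N. multiple_integral \<iota> \<mu> k (F k) w) * H w \<partial>\<mu>) \<longlonglongrightarrow> fact l * F l (replicate l (J \<psi>))"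
    by (rule tendsto_eventually)
  ultimately show ?thesis unfolding H_def by (rule LIMSEQ_unique)
qed

end

section \<open>Basis independence of the Hilbert-Schmidt norm\<close>

lemma tensor_space_2:
  assumes g: "g \<in> tensor_space 2"
  shows "linear (\<lambda>x. g [x, y])" "linear (\<lambda>y. g [x, y])"
    "\<exists>C\<ge>0. \<forall>x y. \<bar>g [x, y]\<bar> \<le> C * norm x * norm y"
proof -
  show "linear (\<lambda>x. g [x, y])" using tensor_space_linear[OF g, of "[0, y]" 0] by simp
  show "linear (\<lambda>y. g [x, y])" using tensor_space_linear[OF g, of "[x, 0]" 1] by simp
  obtain C where "C \<ge> 0" and C: "\<And>xs. length xs = 2 \<Longrightarrow> \<bar>g xs\<bar> \<le> C * (\<Prod>i<2. norm (xs ! i))"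
    using tensor_space_bounded[OF g] by blast
  have "\<bar>g [x, y]\<bar> \<le> C * norm x * norm y" for x y
    using C[of "[x, y]"] by (simp add: numeral_2_eq_2 mult.assoc)
  with \<open>C \<ge> 0\<close> show "\<exists>C\<ge>0. \<forall>x y. \<bar>g [x, y]\<bar> \<le> C * norm x * norm y" by blast
qed

lemma tensor_2_Riesz:
  fixes g :: "'h::{real_inner, complete_space} list \<Rightarrow> real"
  assumes g: "g \<in> tensor_space 2"
  obtains G where "\<And>x y. g [x, y] = inner (G x) y"
proof -
  obtain C where C: "\<And>x y. \<bar>g [x, y]\<bar> \<le> C * norm x * norm y" using tensor_space_2(3)[OF g] by blast
  have "\<exists>u. \<forall>y. g [x, y] = inner y u" for x
  proof (rule Riesz_representation)
    show "bounded_linear (\<lambda>y. g [x, y])"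
      using linear_add[OF tensor_space_2(2)[OF g, of x]] linear_scale[OF tensor_space_2(2)[OF g, of x]] C[of x]
      by (intro bounded_linear_intro[where K="C * norm x"]) (simp_all add: mult.commute)
  qed
  then obtain G where "\<And>x y. g [x, y] = inner y (G x)" by metis
  then show ?thesis using that[of G] by (simp add: inner_commute)
qed

lemma basis_tuples_2: "bij_betw (\<lambda>(b, c). [b, c]) (some_basis \<times> some_basis) (basis_tuples 2)"
  by (rule bij_betwI[where g="\<lambda>bs. (bs ! 0, bs ! 1)"])
    (auto simp: basis_tuples_def length_Suc_conv numeral_2_eq_2)

text \<open>
  Parseval in one variable exchanges one copy of the basis; by symmetry the other one follows.
\<close>
lemma Hilbert_Schmidt_norm_basis:
  fixes g :: "'h::{real_inner, complete_space} list \<Rightarrow> real"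
  assumes S: "orthonormal_basis (some_basis :: 'h set)" and B: "orthonormal_basis B"
    and g: "g \<in> tensor_space 2" and sym: "\<And>x y. g [x, y] = g [y, x]"
    and sm: "(\<lambda>(d, e). (g [d, e])\<^sup>2) summable_on B \<times> B"
  shows "infsum (\<lambda>(d, e). (g [d, e])\<^sup>2) (B \<times> B) = tensor_inner 2 g g"
proof -
  obtain G where G: "\<And>x y. g [x, y] = inner (G x) y" using tensor_2_Riesz[OF g] by blast
  have P: "((\<lambda>b. (g [x, b])\<^sup>2) has_sum (norm (G x))\<^sup>2) C" if "orthonormal_basis C" for C x
    unfolding G by (rule Parseval_norm_has_sum[OF that])
  have iB: "infsum (\<lambda>b. (g [x, b])\<^sup>2) B = (norm (G x))\<^sup>2" for x by (rule infsumI[OF P[OF B]])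
  have iS: "infsum (\<lambda>b. (g [x, b])\<^sup>2) some_basis = (norm (G x))\<^sup>2" for x by (rule infsumI[OF P[OF S]])
  have 1: "infsum (\<lambda>(d, e). (g [d, e])\<^sup>2) (B \<times> B) = infsum (\<lambda>d. (norm (G d))\<^sup>2) B"
    using infsum_Sigma_banach[OF sm] by (simp add: iB)
  have outer: "(\<lambda>d. (norm (G d))\<^sup>2) summable_on B"
    using summable_on_Sigma_banach[OF sm] by (simp add: iB)
  have mixed: "(\<lambda>(d, b). (g [d, b])\<^sup>2) summable_on B \<times> some_basis"
  proof (rule summable_on_iff_abs_summable_on_real[THEN iffD2])
    show "(\<lambda>p. norm (case p of (d, b) \<Rightarrow> (g [d, b])\<^sup>2)) summable_on B \<times> some_basis"
      unfolding Infinite_Sum.abs_summable_on_Sigma_iff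
      using has_sum_imp_summable[OF P[OF S]] outer by (simp add: iS)
  qed
  have "infsum (\<lambda>d. (norm (G d))\<^sup>2) B = infsum (\<lambda>d. infsum (\<lambda>b. (g [d, b])\<^sup>2) some_basis) B"
    by (simp only: iS)
  also have "\<dots> = infsum (\<lambda>b. infsum (\<lambda>d. (g [d, b])\<^sup>2) B) some_basis"
    by (rule infsum_swap_banach[OF mixed])
  also have "\<dots> = infsum (\<lambda>b. infsum (\<lambda>c. (g [b, c])\<^sup>2) some_basis) some_basis"
    by (simp only: sym[of _ "_ :: 'h"] iB iS)
  finally have 2: "infsum (\<lambda>d. (norm (G d))\<^sup>2) B = infsum (\<lambda>b. infsum (\<lambda>c. (g [b, c])\<^sup>2) some_basis) some_basis" .
  have "(\<lambda>bs. (g bs)\<^sup>2) summable_on basis_tuples 2" using g by (simp add: tensor_space_def)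
  then have s2: "(\<lambda>(b, c). (g [b, c])\<^sup>2) summable_on some_basis \<times> some_basis"
    unfolding summable_on_reindex_bij_betw[OF basis_tuples_2, symmetric] by (simp add: case_prod_unfold)
  have "tensor_inner 2 g g = infsum (\<lambda>(b, c). (g [b, c])\<^sup>2) (some_basis \<times> some_basis)"
    unfolding tensor_inner_def infsum_reindex_bij_betw[OF basis_tuples_2, symmetric]
    by (simp add: case_prod_unfold power2_eq_square)
  also have "\<dots> = infsum (\<lambda>b. infsum (\<lambda>c. (g [b, c])\<^sup>2) some_basis) some_basis"
    using infsum_Sigma_banach[OF s2] by simp
  finally show ?thesis using 1 2 by simp
qed

lemma symmetric_2:
  assumes "symmetrize 2 u = u"
  shows "u [x, y] = u [y, x]"
proof -
  have P: "{p. p permutes {..<2}} = {id, Transposition.transpose 0 (1::nat)}"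
  proof -
    have "{..<2} = {0, 1 :: nat}" by auto
    then show ?thesis using permutes_doubleton_iff[of _ "0::nat" 1] by auto
  qed
  have ne: "id \<noteq> Transposition.transpose 0 (1::nat)" by (metis id_apply transpose_apply_first zero_neq_one)
  have "symmetrize 2 u [x, y] = (u [x, y] + u [y, x]) / 2" for x y
    using ne unfolding symmetrize_def P
    by (simp add: permute_list_def Transposition.transpose_def upt_rec numeral_2_eq_2)
  from this[of x y] this[of y x] show ?thesis using assms by simp
qed

section \<open>The Wick exponential of a second order kernel\<close>

lemma central_binomial_le: "(2 * k) choose k \<le> 4 ^ k"
proof -
  have "(2 * k) choose k \<le> (\<Sum>i\<le>2 * k. (2 * k) choose i)" by (rule member_le_sum) auto
  also have "\<dots> = 4 ^ k" by (simp add: choose_row_sum power_mult)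
  finally show ?thesis .
qed

context wiener_chaos
begin

definition wick_term :: "('h list \<Rightarrow> real) \<Rightarrow> nat \<Rightarrow> 'w \<Rightarrow> real" where
  "wick_term g k w = multiple_integral \<iota> \<mu> (2 * k) (tensor_power 2 g k) w / fact k"

lemma wick_term_square_integrable:
  assumes g: "g \<in> tensor_space 2"
  shows "square_integrable \<mu> (wick_term g k)"
  using square_integrable_cmult[OF multiple_integral_square_integrable[OF tensor_power_2(1)[OF basis g]], of "1 / fact k"]
  by (simp add: wick_term_def[abs_def])

text \<open>
  The isometry contributes \<open>(2 k)!\<close> and the normalization of the terms \<open>1 / (k!)\<^sup>2\<close>. Their product is a
  central binomial coefficient, whence the factor \<open>4\<close>.
\<close>
lemma wick_term_inner:
  assumes g: "g \<in> tensor_space 2"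
  shows "k \<noteq> l \<Longrightarrow> (\<integral>w. wick_term g k w * wick_term g l w \<partial>\<mu>) = 0"
    and "(\<integral>w. (wick_term g k w)\<^sup>2 \<partial>\<mu>) \<le> (4 * tensor_inner 2 g g) ^ k"
proof -
  note ts = tensor_power_2(1)[OF basis g]
  have ip: "(\<integral>w. wick_term g k w * wick_term g l w \<partial>\<mu>)
    = (if 2 * k = 2 * l then fact (2 * k) * tensor_inner (2 * k) (symmetrize (2 * k) (tensor_power 2 g k))
        (symmetrize (2 * l) (tensor_power 2 g l)) else 0) / (fact k * fact l)" for k l
    unfolding multiple_integral_inner[OF ts ts multiple_integral_exists[OF ts] multiple_integral_exists[OF ts], symmetric]
    by (simp add: wick_term_def)
  show "k \<noteq> l \<Longrightarrow> (\<integral>w. wick_term g k w * wick_term g l w \<partial>\<mu>) = 0" by (simp add: ip)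
  have q: "0 \<le> tensor_inner 2 g g" unfolding tensor_inner_integral by simp
  have "(\<integral>w. (wick_term g k w)\<^sup>2 \<partial>\<mu>)
      = fact (2 * k) / (fact k * fact k) * tensor_inner (2 * k) (symmetrize (2 * k) (tensor_power 2 g k)) (symmetrize (2 * k) (tensor_power 2 g k))"
    by (simp add: power2_eq_square ip)
  also have "\<dots> \<le> fact (2 * k) / (fact k * fact k) * tensor_inner (2 * k) (tensor_power 2 g k) (tensor_power 2 g k)"
    by (intro mult_left_mono symmetrize_norm_le ts) simp
  also have "fact (2 * k) / (fact k * fact k) = real ((2 * k) choose k)"
    by (subst binomial_fact) simp_all
  also have "tensor_inner (2 * k) (tensor_power 2 g k) (tensor_power 2 g k) = tensor_inner 2 g g ^ k"
    by (rule tensor_power_2(2)[OF basis g])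
  also have "real ((2 * k) choose k) * tensor_inner 2 g g ^ k \<le> real (4 ^ k) * tensor_inner 2 g g ^ k"
    using q by (intro mult_right_mono of_nat_mono central_binomial_le) simp
  finally show "(\<integral>w. (wick_term g k w)\<^sup>2 \<partial>\<mu>) \<le> (4 * tensor_inner 2 g g) ^ k"
    by (simp add: power_mult_distrib)
qed

text \<open>
  The terms are orthogonal and their squared norms are dominated by a geometric series of ratio
  \<open>4 \<bar>g\<bar>\<^sup>2\<close>.
\<close>
theorem wick_exponential_exists:
  assumes g: "g \<in> tensor_space 2" and lt: "tensor_inner 2 g g < 1 / 4"
  shows "\<exists>\<xi>. L2_sums \<mu> (wick_term g) \<xi>"
  unfolding L2_sums_def
proof (rule mu.L2_complete)
  note sq = wick_term_square_integrable[OF g]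
  show "square_integrable \<mu> (\<lambda>w. \<Sum>k<n. wick_term g k w)" for n by (intro square_integrable_sum sq)
  define q where "q = 4 * tensor_inner 2 g g"
  have q: "0 \<le> q" "q < 1" using lt unfolding q_def by (simp_all add: tensor_inner_integral)
  have block: "(\<integral>w. (\<Sum>k\<in>I. wick_term g k w)\<^sup>2 \<partial>\<mu>) \<le> (\<Sum>k\<in>I. q ^ k)" if "finite I" for I
  proof -
    have "(\<integral>w. (\<Sum>k\<in>I. wick_term g k w)\<^sup>2 \<partial>\<mu>) = (\<integral>w. (\<Sum>k\<in>I. \<Sum>l\<in>I. wick_term g k w * wick_term g l w) \<partial>\<mu>)"
      unfolding power2_eq_square sum_product ..
    also have "\<dots> = (\<Sum>k\<in>I. \<integral>w. (\<Sum>l\<in>I. wick_term g k w * wick_term g l w) \<partial>\<mu>)"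
      by (intro Bochner_Integration.integral_sum Bochner_Integration.integrable_sum square_integrable_mult sq)
    also have "\<dots> = (\<Sum>k\<in>I. \<Sum>l\<in>I. \<integral>w. wick_term g k w * wick_term g l w \<partial>\<mu>)"
      by (intro sum.cong refl Bochner_Integration.integral_sum square_integrable_mult sq)
    also have "\<dots> = (\<Sum>k\<in>I. \<Sum>l\<in>I. if l = k then \<integral>w. (wick_term g k w)\<^sup>2 \<partial>\<mu> else 0)"
      using wick_term_inner(1)[OF g] by (intro sum.cong refl) (auto simp: power2_eq_square)
    also have "\<dots> = (\<Sum>k\<in>I. \<integral>w. (wick_term g k w)\<^sup>2 \<partial>\<mu>)" using that by simp
    also have "\<dots> \<le> (\<Sum>k\<in>I. q ^ k)" unfolding q_def by (intro sum_mono wick_term_inner(2) g)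
    finally show ?thesis .
  qed
  fix e :: real assume "e > 0"
  have "summable (\<lambda>k. q ^ k)" using q by (simp add: summable_geometric)
  then obtain N where N: "\<And>m n. m \<ge> N \<Longrightarrow> norm (\<Sum>k\<in>{m..<n}. q ^ k) < e"
    using \<open>e > 0\<close> unfolding summable_Cauchy by blast
  have le: "(\<integral>w. ((\<Sum>k<n. wick_term g k w) - (\<Sum>k<m. wick_term g k w))\<^sup>2 \<partial>\<mu>) < e" if "N \<le> m" "m \<le> n" for m n
  proof -
    have "(\<Sum>k<n. wick_term g k w) - (\<Sum>k<m. wick_term g k w) = (\<Sum>k\<in>{m..<n}. wick_term g k w)" for w
      using sum_diff_nat_ivl[of 0 m n "\<lambda>k. wick_term g k w"] that by (simp add: atLeast0LessThan)
    then have "(\<integral>w. ((\<Sum>k<n. wick_term g k w) - (\<Sum>k<m. wick_term g k w))\<^sup>2 \<partial>\<mu>) \<le> (\<Sum>k\<in>{m..<n}. q ^ k)"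
      using block[of "{m..<n}"] by simp
    also have "\<dots> < e" using N[OF that(1), of n] by simp
    finally show ?thesis .
  qed
  have "(\<integral>w. ((\<Sum>k<m. wick_term g k w) - (\<Sum>k<n. wick_term g k w))\<^sup>2 \<partial>\<mu>) < e" if "N \<le> m" "N \<le> n" for m n
  proof (cases "m \<le> n")
    case True
    then show ?thesis using le[of m n] that by (simp add: power2_commute)
  next
    case False
    then show ?thesis using le[of n m] that by simp
  qed
  then show "\<exists>N. \<forall>m\<ge>N. \<forall>n\<ge>N. (\<integral>w. ((\<Sum>k<m. wick_term g k w) - (\<Sum>k<n. wick_term g k w))\<^sup>2 \<partial>\<mu>) < e" by blast
qed

text \<open>
  On the diagonal, the tensor power of \<open>g\<close> is a power of \<open>g [J \<eta>, J \<eta>]\<close>, and \<open>\<i>\<close> to an even power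
  is a sign. Termwise integration against the character thus produces an exponential series.
\<close>
theorem wick_exponential_char:
  assumes g: "g \<in> tensor_space 2" and \<xi>: "L2_sums \<mu> (wick_term g) \<xi>"
  shows "char_int \<xi> \<eta> = complex_of_real (exp (- g [J \<eta>, J \<eta>] - (norm (J \<eta>))\<^sup>2 / 2))"
proof -
  note ts = tensor_power_2(1)[OF basis g]
  define E where "E = exp (- (norm (J \<eta>))\<^sup>2 / 2)"
  define z where "z = - g [J \<eta>, J \<eta>]"
  have i: "integrable \<mu> (\<lambda>w. complex_of_real (wick_term g k w) * iexp (blinfun_apply \<eta> w))" for k
  proof (rule Bochner_Integration.integrable_bound[OF mu.square_integrable_integrable[OF wick_term_square_integrable[OF g]]])
    note [measurable] = square_integrableD(1)[OF wick_term_square_integrable[OF g]]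
    show "(\<lambda>w. complex_of_real (wick_term g k w) * iexp (blinfun_apply \<eta> w)) \<in> borel_measurable \<mu>" by measurable
    show "AE w in \<mu>. norm (complex_of_real (wick_term g k w) * iexp (blinfun_apply \<eta> w)) \<le> norm (wick_term g k w)"
      by (rule AE_I2) (simp add: norm_mult)
  qed
  have term_char: "char_int (wick_term g k) \<eta> = complex_of_real (z ^ k / fact k * E)" for k
  proof -
    have "char_int (wick_term g k) \<eta> = (1 / fact k) * char_int (multiple_integral \<iota> \<mu> (2 * k) (tensor_power 2 g k)) \<eta>"
      unfolding char_int_def wick_term_def by (subst integral_mult_right_zero[symmetric]) (simp add: mult_ac)
    also have "\<dots> = (1 / fact k) * (\<i> ^ (2 * k) * of_real ((g [J \<eta>, J \<eta>]) ^ k * E))"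
      unfolding multiple_integral_char[OF ts multiple_integral_exists[OF ts]] tensor_power_2(3)[OF basis g] E_def ..
    also have "\<i> ^ (2 * k) = (-1) ^ k" by (simp add: power_mult)
    also have "(1 / fact k) * ((-1) ^ k * complex_of_real ((g [J \<eta>, J \<eta>]) ^ k * E)) = complex_of_real (z ^ k / fact k * E)"
      unfolding z_def power_minus[of "g [J \<eta>, J \<eta>]"] by simp
    finally show ?thesis .
  qed
  have "(\<lambda>N. char_int (\<lambda>w. \<Sum>k<N. wick_term g k w) \<eta>) \<longlonglongrightarrow> char_int \<xi> \<eta>"
    using \<xi> unfolding L2_sums_def char_int_def
    by (intro L2_lim_integral_complex) (simp_all add: mu.square_integrable_const)
  moreover have "char_int (\<lambda>w. \<Sum>k<N. wick_term g k w) \<eta> = complex_of_real ((\<Sum>k<N. z ^ k / fact k) * E)" for N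
  proof -
    have "char_int (\<lambda>w. \<Sum>k<N. wick_term g k w) \<eta> = (\<Sum>k<N. char_int (wick_term g k) \<eta>)"
      unfolding char_int_def of_real_sum sum_distrib_right by (rule Bochner_Integration.integral_sum[OF i])
    then show ?thesis by (simp only: term_char of_real_sum sum_distrib_right)
  qed
  ultimately have lim: "(\<lambda>N. complex_of_real ((\<Sum>k<N. z ^ k / fact k) * E)) \<longlonglongrightarrow> char_int \<xi> \<eta>" by simp
  have "(\<lambda>N. \<Sum>k<N. z ^ k / fact k) \<longlonglongrightarrow> exp z"
    using exp_converges[of z] unfolding sums_def by (simp add: divide_inverse mult.commute)
  then have "(\<lambda>N. complex_of_real ((\<Sum>k<N. z ^ k / fact k) * E)) \<longlonglongrightarrow> complex_of_real (exp z * E)"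
    by (intro tendsto_of_real tendsto_mult tendsto_const)
  from LIMSEQ_unique[OF lim this] show ?thesis
    unfolding z_def E_def exp_add[symmetric] by simp
qed

end

section \<open>Pairings with vectors of the Hilbert space\<close>

context abstract_wiener_space
begin

text \<open>
  The bound makes \<open>\<phi> \<mapsto> \<langle>X, \<phi>\<rangle>\<close> continuous from the norm of \<open>H\<close> to the mean-square norm. Hence the limit exists
  and is the same for all sequences, which is what the choice in \<open>wiener_pairing\<close> asks for.
\<close>
lemma wiener_pairing_L2_lim:
  assumes M: "prob_space M"
    and sq: "\<And>\<phi>. square_integrable M (\<lambda>x. blinfun_apply \<phi> (X x))"
    and bnd: "\<And>\<phi>. (\<integral>x. (blinfun_apply \<phi> (X x))\<^sup>2 \<partial>M) \<le> C * (norm (J \<phi>))\<^sup>2"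
    and h: "(\<lambda>n. J (\<phi> n)) \<longlonglongrightarrow> h"
  shows "L2_lim M (\<lambda>n x. blinfun_apply (\<phi> n) (X x)) (wiener_pairing \<iota> M X h)"
proof -
  have diff: "(\<integral>x. (blinfun_apply \<psi> (X x) - blinfun_apply \<chi>' (X x))\<^sup>2 \<partial>M) \<le> C * (norm (J \<psi> - J \<chi>'))\<^sup>2" for \<psi> \<chi>'
    using bnd[of "\<psi> - \<chi>'"] by (simp only: blinfun.diff_left J_diff)
  obtain Y where Y: "L2_lim M (\<lambda>n x. blinfun_apply (\<phi> n) (X x)) Y"
  proof -
    have "\<exists>Y. L2_lim M (\<lambda>n x. blinfun_apply (\<phi> n) (X x)) Y"
    proof (rule prob_space.L2_complete[OF M sq])
      fix e :: real assume "e > 0"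
      define d where "d = sqrt (e / (\<bar>C\<bar> + 1))"
      have "0 < e / (\<bar>C\<bar> + 1)" using \<open>e > 0\<close> by simp
      then have d: "d > 0" "(\<bar>C\<bar> + 1) * d\<^sup>2 = e" by (simp_all add: d_def)
      have "Cauchy (\<lambda>n. J (\<phi> n))" using h by (rule LIMSEQ_imp_Cauchy)
      then obtain N where N: "\<And>m n. m \<ge> N \<Longrightarrow> n \<ge> N \<Longrightarrow> norm (J (\<phi> m) - J (\<phi> n)) < d"
        using d(1) unfolding Cauchy_def dist_norm by blast
      have "(\<integral>x. (blinfun_apply (\<phi> m) (X x) - blinfun_apply (\<phi> n) (X x))\<^sup>2 \<partial>M) < e" if "m \<ge> N" "n \<ge> N" for m n
      proof -
        have lt: "(norm (J (\<phi> m) - J (\<phi> n)))\<^sup>2 < d\<^sup>2" using N[OF that] by (intro power_strict_mono) simp_all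
        have "(\<integral>x. (blinfun_apply (\<phi> m) (X x) - blinfun_apply (\<phi> n) (X x))\<^sup>2 \<partial>M) \<le> C * (norm (J (\<phi> m) - J (\<phi> n)))\<^sup>2"
          by (rule diff)
        also have "\<dots> \<le> (\<bar>C\<bar> + 1) * (norm (J (\<phi> m) - J (\<phi> n)))\<^sup>2" by (intro mult_right_mono) simp_all
        also have "\<dots> < (\<bar>C\<bar> + 1) * d\<^sup>2" using lt by (intro mult_strict_left_mono) simp_all
        finally show ?thesis using d(2) by simp
      qed
      then show "\<exists>N. \<forall>m\<ge>N. \<forall>n\<ge>N. (\<integral>x. (blinfun_apply (\<phi> m) (X x) - blinfun_apply (\<phi> n) (X x))\<^sup>2 \<partial>M) < e" by blast
    qed
    then show ?thesis using that by blast
  qed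
  have "\<exists>Y. \<forall>\<psi>. (\<lambda>n. J (\<psi> n)) \<longlonglongrightarrow> h \<longrightarrow> L2_lim M (\<lambda>n x. blinfun_apply (\<psi> n) (X x)) Y"
  proof (intro exI allI impI)
    fix \<psi> assume \<psi>: "(\<lambda>n. J (\<psi> n)) \<longlonglongrightarrow> h"
    show "L2_lim M (\<lambda>n x. blinfun_apply (\<psi> n) (X x)) Y"
    proof (rule L2_lim_perturb[OF Y sq])
      have "(\<lambda>n. C * (norm (J (\<psi> n) - J (\<phi> n)))\<^sup>2) \<longlonglongrightarrow> C * (norm (h - h))\<^sup>2"
        by (intro tendsto_intros h \<psi>)
      then have z: "(\<lambda>n. C * (norm (J (\<psi> n) - J (\<phi> n)))\<^sup>2) \<longlonglongrightarrow> 0" by simp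
      show "(\<lambda>n. \<integral>x. (blinfun_apply (\<psi> n) (X x) - blinfun_apply (\<phi> n) (X x))\<^sup>2 \<partial>M) \<longlonglongrightarrow> 0"
        by (rule tendsto_sandwich[OF _ _ tendsto_const z])
          (intro always_eventually allI diff integral_nonneg_AE AE_I2 zero_le_power2)+
    qed
  qed
  from someI_ex[OF this] show ?thesis using h unfolding wiener_pairing_def by blast
qed

lemma functional_second_moment: "(\<integral>w. (blinfun_apply \<phi> w)\<^sup>2 \<partial>\<mu>) = (norm (J \<phi>))\<^sup>2"
  using hermite_orthogonal[of 1 \<phi> 1 \<phi>] by (simp add: power2_eq_square dot_square_norm)

text \<open>
  With \<open>H = x\<^sup>2 - \<sigma>\<close> the second Hermite polynomial, \<open>x\<^sup>4 = H\<^sup>2 + 2 \<sigma> H + \<sigma>\<^sup>2\<close>.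
\<close>
lemma functional_fourth_moment: "(\<integral>w. ((blinfun_apply \<phi> w)\<^sup>2)\<^sup>2 \<partial>\<mu>) = 3 * ((norm (J \<phi>))\<^sup>2)\<^sup>2"
proof -
  define \<sigma> where "\<sigma> = (norm (J \<phi>))\<^sup>2"
  define H where "H w = hermite 2 \<sigma> (blinfun_apply \<phi> w)" for w
  have H: "H w = (blinfun_apply \<phi> w)\<^sup>2 - \<sigma>" for w
    by (simp add: H_def numeral_2_eq_2 power2_eq_square)
  have mH: "moments H" unfolding H_def by (rule moments_hermite)
  have HH: "(\<integral>w. H w * H w \<partial>\<mu>) = 2 * \<sigma>\<^sup>2"
    using hermite_orthogonal[of 2 \<phi> 2 \<phi>] unfolding H_def \<sigma>_def by (simp add: dot_square_norm)
  have H0: "(\<integral>w. H w \<partial>\<mu>) = 0"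
    using hermite_orthogonal[of 2 \<phi> 0 \<phi>] unfolding H_def \<sigma>_def by simp
  have "((blinfun_apply \<phi> w)\<^sup>2)\<^sup>2 = H w * H w + 2 * \<sigma> * H w + \<sigma>\<^sup>2" for w
    unfolding H by (simp add: power2_eq_square algebra_simps)
  then have "(\<integral>w. ((blinfun_apply \<phi> w)\<^sup>2)\<^sup>2 \<partial>\<mu>) = (\<integral>w. H w * H w + 2 * \<sigma> * H w + \<sigma>\<^sup>2 \<partial>\<mu>)" by simp
  also have "\<dots> = (\<integral>w. H w * H w \<partial>\<mu>) + 2 * \<sigma> * (\<integral>w. H w \<partial>\<mu>) + \<sigma>\<^sup>2"
    using moments_integrable[OF mH] moments_integrable[OF moments_mult[OF mH mH]]
    by (simp add: mu.prob_space)
  finally show ?thesis by (simp add: HH H0 \<sigma>_def)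
qed

lemma law_integral:
  assumes X: "X \<in> measurable M borel" and d: "has_density (distr M borel X) \<mu> f"
    and f: "square_integrable \<mu> f" and G: "moments G"
  shows "integrable M (\<lambda>x. G (X x))" "(\<integral>x. G (X x) \<partial>M) = (\<integral>w. f w * G w \<partial>\<mu>)"
proof -
  have Gm: "G \<in> borel_measurable borel"
    using moments_measurable[OF G] by (subst (asm) measurable_cong_sets[OF sets_mu refl])
  have fd: "f \<in> borel_measurable \<mu>" "AE w in \<mu>. 0 \<le> f w" "distr M borel X = density \<mu> (\<lambda>w. ennreal (f w))"
    using d by (auto simp: has_density_def)
  have "integrable \<mu> (\<lambda>w. f w * G w)"
    by (rule square_integrable_mult[OF f moments_square_integrable[OF G]])
  then have "integrable (density \<mu> (\<lambda>w. ennreal (f w))) G"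
    using integrable_real_density[OF fd(1,2) moments_measurable[OF G]] by simp
  then show "integrable M (\<lambda>x. G (X x))"
    unfolding fd(3)[symmetric] by (subst (asm) integrable_distr_eq[OF X Gm])
  have "(\<integral>x. G (X x) \<partial>M) = (\<integral>w. G w \<partial>distr M borel X)" by (rule integral_distr[OF X Gm, symmetric])
  also have "\<dots> = (\<integral>w. f w * G w \<partial>\<mu>)"
    unfolding fd(3) by (rule integral_real_density[OF fd(1,2) moments_measurable[OF G]])
  finally show "(\<integral>x. G (X x) \<partial>M) = (\<integral>w. f w * G w \<partial>\<mu>)" .
qed

text \<open>
  Cauchy-Schwarz against the density leaves a Gaussian fourth moment, which is three times the square of
  the variance.
\<close>
lemma law_second_moment:
  assumes X: "X \<in> measurable M borel" and d: "has_density (distr M borel X) \<mu> f"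
    and f: "square_integrable \<mu> f"
  shows "square_integrable M (\<lambda>x. blinfun_apply \<phi> (X x))"
    and "(\<integral>x. (blinfun_apply \<phi> (X x))\<^sup>2 \<partial>M) \<le> (sqrt (\<integral>w. (f w)\<^sup>2 \<partial>\<mu>) * sqrt 3) * (norm (J \<phi>))\<^sup>2"
proof -
  have m2: "moments (\<lambda>w. (blinfun_apply \<phi> w)\<^sup>2)"
    unfolding power2_eq_square by (intro moments_mult moments_functional)
  show "square_integrable M (\<lambda>x. blinfun_apply \<phi> (X x))"
    unfolding square_integrable_def
    using law_integral(1)[OF X d f m2] measurable_compose[OF X blinfun_borel_measurable] by blast
  have "(\<integral>x. (blinfun_apply \<phi> (X x))\<^sup>2 \<partial>M) = (\<integral>w. f w * (blinfun_apply \<phi> w)\<^sup>2 \<partial>\<mu>)"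
    by (rule law_integral(2)[OF X d f m2])
  also have "\<dots> \<le> sqrt (\<integral>w. (f w)\<^sup>2 \<partial>\<mu>) * sqrt (\<integral>w. ((blinfun_apply \<phi> w)\<^sup>2)\<^sup>2 \<partial>\<mu>)"
    using L2_Cauchy_Schwarz[OF f moments_square_integrable[OF m2]] by (rule order_trans[OF abs_ge_self])
  also have "\<dots> = (sqrt (\<integral>w. (f w)\<^sup>2 \<partial>\<mu>) * sqrt 3) * (norm (J \<phi>))\<^sup>2"
    unfolding functional_fourth_moment
    by (simp only: real_sqrt_mult real_sqrt_abs abs_of_nonneg[OF zero_le_power2] mult.assoc)
  finally show "(\<integral>x. (blinfun_apply \<phi> (X x))\<^sup>2 \<partial>M) \<le> (sqrt (\<integral>w. (f w)\<^sup>2 \<partial>\<mu>) * sqrt 3) * (norm (J \<phi>))\<^sup>2" .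
qed

end

section \<open>Densities determined by their characteristic functional\<close>

text \<open>
  Moving the negative part of \<open>\<xi>\<close> to the other side, the hypothesis compares the characteristic functionals of
  two finite measures, the positive part of \<open>\<xi> \<mu>\<close> and the sum of the negative part and \<open>\<nu>\<close>. These are
  therefore equal. The first one does not charge the set where \<open>\<xi>\<close> is negative, so the negative part vanishes.
\<close>
lemma density_nonneg_of_characteristic_functional:
  fixes \<mu> \<nu> :: "'w::{real_normed_vector, second_countable_topology} measure" and \<xi> :: "'w \<Rightarrow> real"
  assumes \<mu>: "prob_space \<mu>" "sets \<mu> = sets borel" and \<nu>: "prob_space \<nu>" "sets \<nu> = sets borel"
    and \<xi>: "integrable \<mu> \<xi>"
    and char: "\<And>\<phi>::'w \<Rightarrow>\<^sub>L real. (CLINT w|\<mu>. complex_of_real (\<xi> w) * iexp (blinfun_apply \<phi> w))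
        = (CLINT w|\<nu>. iexp (blinfun_apply \<phi> w))"
  shows "AE w in \<mu>. 0 \<le> \<xi> w" "\<nu> = density \<mu> (\<lambda>w. ennreal (\<xi> w))"
proof -
  interpret \<mu>: prob_space \<mu> by fact
  interpret \<nu>: prob_space \<nu> by fact
  interpret Q: pair_prob_space \<mu> \<nu> ..
  define Q where "Q = \<mu> \<Otimes>\<^sub>M \<nu>"
  interpret QQ: prob_space Q unfolding Q_def by (rule Q.prob_space_axioms)
  interpret C: finite_measure "count_space (UNIV :: bool set)" by (rule finite_measure_count_space) simp
  interpret K: pair_sigma_finite "count_space (UNIV :: bool set)" Q ..
  define K where "K = count_space (UNIV :: bool set) \<Otimes>\<^sub>M Q"
  \<comment> \<open>The first component selects which of the two measures is looked at, so that one signed weight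
    on one space carries both sides of the hypothesis.\<close>
  define G :: "bool \<times> 'w \<times> 'w \<Rightarrow> real" where "G = (\<lambda>(b, w, v). if b then \<xi> w else - 1)"
  define X :: "bool \<times> 'w \<times> 'w \<Rightarrow> 'w" where "X = (\<lambda>(b, w, v). if b then w else v)"
  have fst_m: "(\<lambda>q. h (fst q)) \<in> measurable Q N" if "h \<in> measurable \<mu> N" for h and N :: "'z measure"
    unfolding Q_def by (rule measurable_compose[OF measurable_fst that])
  have snd_m: "(\<lambda>q. h (snd q)) \<in> measurable Q N" if "h \<in> measurable \<nu> N" for h and N :: "'z measure"
    unfolding Q_def by (rule measurable_compose[OF measurable_snd that])
  have id_m: "(\<lambda>w. w) \<in> measurable \<mu> borel" "(\<lambda>w. w) \<in> measurable \<nu> borel"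
    by (simp_all add: measurable_ident_sets \<mu>(2) \<nu>(2))
  have \<xi>m: "\<xi> \<in> borel_measurable \<mu>" using \<xi> by auto
  have Km: "f \<in> measurable K N"
    if "(\<lambda>q. f (True, q)) \<in> measurable Q N" "(\<lambda>q. f (False, q)) \<in> measurable Q N" for f and N :: "'z measure"
    unfolding K_def
  proof (rule measurable_pair_measure_countable1)
    show "(\<lambda>q. f (b, q)) \<in> measurable Q N" for b using that by (cases b) simp_all
  qed simp
  have Gm: "G \<in> borel_measurable K"
    by (rule Km) (simp_all add: G_def case_prod_unfold fst_m[OF \<xi>m])
  have Xm: "X \<in> measurable K borel"
    by (rule Km) (simp_all add: X_def case_prod_unfold fst_m[OF id_m(1)] snd_m[OF id_m(2)])
  have nnK: "(\<integral>\<^sup>+p. f p \<partial>K) = (\<integral>\<^sup>+q. f (True, q) \<partial>Q) + (\<integral>\<^sup>+q. f (False, q) \<partial>Q)"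
    if "f \<in> borel_measurable K" for f
  proof -
    have "(\<integral>\<^sup>+p. f p \<partial>K) = (\<integral>\<^sup>+b. \<integral>\<^sup>+q. f (b, q) \<partial>Q \<partial>count_space UNIV)"
      unfolding K_def using that by (intro QQ.nn_integral_fst[symmetric]) (simp add: K_def)
    also have "\<dots> = (\<Sum>b\<in>UNIV. \<integral>\<^sup>+q. f (b, q) \<partial>Q)" by (rule nn_integral_count_space_finite) simp
    finally show ?thesis by (simp add: UNIV_bool add.commute)
  qed
  have clK: "(\<integral>p. f p \<partial>K) = (\<integral>q. f (True, q) \<partial>Q) + (\<integral>q. f (False, q) \<partial>Q)"
    if "integrable K f" for f :: "bool \<times> 'w \<times> 'w \<Rightarrow> complex"
  proof -
    have "(\<integral>p. f p \<partial>K) = (\<integral>b. \<integral>q. f (b, q) \<partial>Q \<partial>count_space UNIV)"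
      unfolding K_def using that by (intro K.integral_fst'[symmetric]) (simp add: K_def)
    also have "\<dots> = (\<Sum>b\<in>UNIV. \<integral>q. f (b, q) \<partial>Q)" by (rule lebesgue_integral_count_space_finite) simp
    finally show ?thesis by (simp add: UNIV_bool add.commute)
  qed
  have nnfst: "(\<integral>\<^sup>+q. h (fst q) \<partial>Q) = (\<integral>\<^sup>+w. h w \<partial>\<mu>)" if "h \<in> borel_measurable \<mu>" for h
  proof -
    have "(\<integral>\<^sup>+q. h (fst q) \<partial>Q) = (\<integral>\<^sup>+w. \<integral>\<^sup>+v. h (fst (w, v)) \<partial>\<nu> \<partial>\<mu>)"
      unfolding Q_def using fst_m[OF that] by (intro \<nu>.nn_integral_fst[symmetric]) (simp add: Q_def)
    then show ?thesis by (simp add: \<nu>.emeasure_space_1)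
  qed
  have nnsnd: "(\<integral>\<^sup>+q. h (snd q) \<partial>Q) = (\<integral>\<^sup>+v. h v \<partial>\<nu>)" if "h \<in> borel_measurable \<nu>" for h
  proof -
    have "(\<integral>\<^sup>+q. h (snd q) \<partial>Q) = (\<integral>\<^sup>+w. \<integral>\<^sup>+v. h (snd (w, v)) \<partial>\<nu> \<partial>\<mu>)"
      unfolding Q_def using snd_m[OF that] by (intro \<nu>.nn_integral_fst[symmetric]) (simp add: Q_def)
    then show ?thesis by (simp add: \<mu>.emeasure_space_1)
  qed
  have dfst: "distr Q \<mu> fst = \<mu>"
  proof (rule measure_eqI)
    fix S assume "S \<in> sets (distr Q \<mu> fst)"
    then have S: "S \<in> sets \<mu>" by simp
    have "(\<integral>\<^sup>+w. indicator S w \<partial>distr Q \<mu> fst) = (\<integral>\<^sup>+q. indicator S (fst q) \<partial>Q)"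
      by (rule nn_integral_distr[OF _ borel_measurable_indicator]) (simp_all add: Q_def S)
    also have "\<dots> = (\<integral>\<^sup>+w. indicator S w \<partial>\<mu>)" by (rule nnfst[OF borel_measurable_indicator[OF S]])
    finally show "emeasure (distr Q \<mu> fst) S = emeasure \<mu> S" using S by simp
  qed simp
  have dsnd: "distr Q \<nu> snd = \<nu>"
  proof (rule measure_eqI)
    fix S assume "S \<in> sets (distr Q \<nu> snd)"
    then have S: "S \<in> sets \<nu>" by simp
    have "(\<integral>\<^sup>+w. indicator S w \<partial>distr Q \<nu> snd) = (\<integral>\<^sup>+q. indicator S (snd q) \<partial>Q)"
      by (rule nn_integral_distr[OF _ borel_measurable_indicator]) (simp_all add: Q_def S)
    also have "\<dots> = (\<integral>\<^sup>+w. indicator S w \<partial>\<nu>)" by (rule nnsnd[OF borel_measurable_indicator[OF S]])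
    finally show "emeasure (distr Q \<nu> snd) S = emeasure \<nu> S" using S by simp
  qed simp
  have clfst: "(\<integral>q. h (fst q) \<partial>Q) = (\<integral>w. h w \<partial>\<mu>)" if "h \<in> borel_measurable \<mu>" for h :: "'w \<Rightarrow> complex"
    using integral_distr[of fst Q \<mu> h] that unfolding dfst by (simp add: Q_def)
  have clsnd: "(\<integral>q. h (snd q) \<partial>Q) = (\<integral>v. h v \<partial>\<nu>)" if "h \<in> borel_measurable \<nu>" for h :: "'w \<Rightarrow> complex"
    using integral_distr[of snd Q \<nu> h] that unfolding dsnd by (simp add: Q_def)
  have "(\<integral>\<^sup>+p. ennreal (norm (G p)) \<partial>K) = (\<integral>\<^sup>+w. ennreal (norm (\<xi> w)) \<partial>\<mu>) + (\<integral>\<^sup>+q. 1 \<partial>Q)"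
    using Gm nnfst[of "\<lambda>w. ennreal (norm (\<xi> w))"] \<xi>m
    by (subst nnK) (simp_all add: G_def case_prod_unfold)
  also have "\<dots> < \<infinity>"
    using \<xi> by (simp add: integrable_iff_bounded QQ.emeasure_space_1)
  finally have Gi: "integrable K G" using Gm by (intro integrableI_bounded)
  \<comment> \<open>\<open>N 1\<close> is the positive part of \<open>\<xi> \<mu>\<close>, and \<open>N (-1)\<close> is its negative part plus \<open>\<nu>\<close>.\<close>
  define N where "N s = distr (density K (\<lambda>p. ennreal (s * G p))) borel X" for s
  have emN: "emeasure (N s) S = (\<integral>\<^sup>+p. ennreal (s * G p) * indicator S (X p) \<partial>K)" if "S \<in> sets borel" for s S
    unfolding N_def using Xm Gm that
    by (subst emeasure_distr) (auto simp: emeasure_density space_pair_measure K_def intro!: nn_integral_cong split: split_indicator)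
  have fin: "finite_measure (N s)" for s
  proof (rule finite_measureI)
    have "emeasure (N s) UNIV = (\<integral>\<^sup>+p. ennreal (s * G p) \<partial>K)" by (simp add: emN)
    also have "\<dots> \<le> (\<integral>\<^sup>+p. ennreal (norm (s * G p)) \<partial>K)" by (intro nn_integral_mono ennreal_leI) simp
    also have "\<dots> < \<infinity>" using integrable_mult_right[OF Gi, of s] unfolding integrable_iff_bounded by blast
    finally show "emeasure (N s) (space (N s)) \<noteq> \<infinity>" by (simp add: N_def)
  qed
  have iG: "integrable K (\<lambda>p. c p *\<^sub>R iexp (blinfun_apply \<phi> (X p)))" if "integrable K c" for c :: "_ \<Rightarrow> real" and \<phi> :: "'w \<Rightarrow>\<^sub>L real"
  proof (rule Bochner_Integration.integrable_bound[OF that])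
    note [measurable] = borel_measurable_integrable[OF that] measurable_compose[OF Xm blinfun_borel_measurable]
    show "(\<lambda>p. c p *\<^sub>R iexp (blinfun_apply \<phi> (X p))) \<in> borel_measurable K" by measurable
  qed simp
  have chN: "(CLINT w|N s. iexp (blinfun_apply \<phi> w)) = (CLINT p|K. max 0 (s * G p) *\<^sub>R iexp (blinfun_apply \<phi> (X p)))" for s and \<phi> :: "'w \<Rightarrow>\<^sub>L real"
  proof -
    note [measurable] = Gm measurable_compose[OF Xm blinfun_borel_measurable]
    have "(\<lambda>p. ennreal (s * G p)) = (\<lambda>p. ennreal (max 0 (s * G p)))"
      by (rule ext) (simp add: max_def ennreal_neg)
    then have "N s = distr (density K (\<lambda>p. ennreal (max 0 (s * G p)))) borel X" by (simp add: N_def)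
    then have "(CLINT w|N s. iexp (blinfun_apply \<phi> w)) = (CLINT p|density K (\<lambda>p. ennreal (max 0 (s * G p))). iexp (blinfun_apply \<phi> (X p)))"
      using Xm measurable_compose[OF blinfun_borel_measurable[of \<phi>], of iexp borel] by (simp add: integral_distr)
    also have "\<dots> = (CLINT p|K. max 0 (s * G p) *\<^sub>R iexp (blinfun_apply \<phi> (X p)))"
      by (rule integral_density) auto
    finally show ?thesis .
  qed
  have "N 1 = N (-1)"
  proof (rule characteristic_functional_unique[OF fin fin])
    show "sets (N 1) = sets borel" "sets (N (- 1)) = sets borel" by (simp_all add: N_def)
    fix \<phi> :: "'w \<Rightarrow>\<^sub>L real"
    have \<phi>m: "(\<lambda>w. iexp (blinfun_apply \<phi> w)) \<in> borel_measurable borel"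
      by (rule measurable_compose[OF blinfun_borel_measurable]) simp
    have \<phi>\<mu>: "(\<lambda>w. iexp (blinfun_apply \<phi> w)) \<in> borel_measurable \<mu>" using \<phi>m by (subst measurable_cong_sets[OF \<mu>(2) refl])
    have \<phi>\<nu>: "(\<lambda>w. iexp (blinfun_apply \<phi> w)) \<in> borel_measurable \<nu>" using \<phi>m by (subst measurable_cong_sets[OF \<nu>(2) refl])
    have "(CLINT p|K. G p *\<^sub>R iexp (blinfun_apply \<phi> (X p)))
        = (CLINT q|Q. \<xi> (fst q) *\<^sub>R iexp (blinfun_apply \<phi> (fst q))) + (CLINT q|Q. - iexp (blinfun_apply \<phi> (snd q)))"
      using clK[OF iG[OF Gi, of \<phi>]] by (simp add: G_def X_def case_prod_unfold)
    also have "(CLINT q|Q. \<xi> (fst q) *\<^sub>R iexp (blinfun_apply \<phi> (fst q))) = (CLINT w|\<mu>. \<xi> w *\<^sub>R iexp (blinfun_apply \<phi> w))"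
      using \<xi>m \<phi>\<mu> by (intro clfst[of "\<lambda>w. \<xi> w *\<^sub>R iexp (blinfun_apply \<phi> w)"] borel_measurable_scaleR)
    also have "(CLINT q|Q. - iexp (blinfun_apply \<phi> (snd q))) = - (CLINT v|\<nu>. iexp (blinfun_apply \<phi> v))"
      using clsnd[OF \<phi>\<nu>] by simp
    also have "(CLINT w|\<mu>. \<xi> w *\<^sub>R iexp (blinfun_apply \<phi> w)) + - (CLINT v|\<nu>. iexp (blinfun_apply \<phi> v)) = 0"
      using char[of \<phi>] by (simp add: scaleR_conv_of_real)
    finally have 0: "(CLINT p|K. G p *\<^sub>R iexp (blinfun_apply \<phi> (X p))) = 0" .
    have im: "integrable K (\<lambda>p. max 0 (s * G p))" for s
      by (intro integrable_max integrable_mult_right Gi) simp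
    have "(CLINT p|K. max 0 (1 * G p) *\<^sub>R iexp (blinfun_apply \<phi> (X p))) - (CLINT p|K. max 0 (- 1 * G p) *\<^sub>R iexp (blinfun_apply \<phi> (X p)))
        = (CLINT p|K. G p *\<^sub>R iexp (blinfun_apply \<phi> (X p)))"
      unfolding Bochner_Integration.integral_diff[OF iG[OF im] iG[OF im], symmetric] scaleR_diff_left[symmetric]
      by (intro Bochner_Integration.integral_cong refl arg_cong2[of _ _ _ _ scaleR]) (simp add: max_def)
    with 0 show "(CLINT w|N 1. iexp (blinfun_apply \<phi> w)) = (CLINT w|N (- 1). iexp (blinfun_apply \<phi> w))"
      unfolding chN by simp
  qed
  then have key: "(\<integral>\<^sup>+w. ennreal (\<xi> w) * indicator S w \<partial>\<mu>)
      = (\<integral>\<^sup>+w. ennreal (- \<xi> w) * indicator S w \<partial>\<mu>) + emeasure \<nu> S" if S: "S \<in> sets borel" for S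
  proof -
    have S\<mu>: "S \<in> sets \<mu>" and S\<nu>: "S \<in> sets \<nu>" using S \<mu>(2) \<nu>(2) by simp_all
    have m: "(\<lambda>p. ennreal (s * G p) * indicator S (X p)) \<in> borel_measurable K" for s
      using Gm measurable_compose[OF Xm borel_measurable_indicator[OF S]] by measurable
    have "emeasure (N 1) S = (\<integral>\<^sup>+w. ennreal (\<xi> w) * indicator S w \<partial>\<mu>)"
      unfolding emN[OF S] nnK[OF m] using nnfst[of "\<lambda>w. ennreal (\<xi> w) * indicator S w"] \<xi>m S\<mu>
      by (simp add: G_def X_def case_prod_unfold ennreal_neg)
    moreover have "emeasure (N (- 1)) S = (\<integral>\<^sup>+w. ennreal (- \<xi> w) * indicator S w \<partial>\<mu>) + emeasure \<nu> S"
      unfolding emN[OF S] nnK[OF m] using nnfst[of "\<lambda>w. ennreal (- \<xi> w) * indicator S w"]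
        nnsnd[of "indicator S"] \<xi>m S\<mu> S\<nu>
      by (simp add: G_def X_def case_prod_unfold)
    ultimately show ?thesis using \<open>N 1 = N (-1)\<close> by simp
  qed
  define A where "A = {w. \<xi> w < 0}"
  have A: "A \<in> sets borel"
    using \<xi>m unfolding A_def measurable_cong_sets[OF \<mu>(2) refl] by measurable
  have "(\<integral>\<^sup>+w. ennreal (\<xi> w) * indicator A w \<partial>\<mu>) = (\<integral>\<^sup>+w. 0 \<partial>\<mu>)"
    by (intro nn_integral_cong) (auto simp: A_def ennreal_neg split: split_indicator)
  then have "(\<integral>\<^sup>+w. ennreal (- \<xi> w) * indicator A w \<partial>\<mu>) = 0" using key[OF A] by simp
  then have "AE w in \<mu>. ennreal (- \<xi> w) * indicator A w = 0"
    using \<xi>m A \<mu>(2) by (subst (asm) nn_integral_0_iff_AE) simp_all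
  then show nonneg: "AE w in \<mu>. 0 \<le> \<xi> w"
    by eventually_elim (auto simp: A_def indicator_def ennreal_eq_0_iff split: if_splits)
  show "\<nu> = density \<mu> (\<lambda>w. ennreal (\<xi> w))"
  proof (rule measure_eqI)
    show "sets \<nu> = sets (density \<mu> (\<lambda>w. ennreal (\<xi> w)))" using \<mu>(2) \<nu>(2) by simp
    fix S assume "S \<in> sets \<nu>"
    then have S: "S \<in> sets borel" using \<nu>(2) by simp
    have "(\<integral>\<^sup>+w. ennreal (- \<xi> w) * indicator S w \<partial>\<mu>) = (\<integral>\<^sup>+w. 0 \<partial>\<mu>)"
      by (rule nn_integral_cong_AE, use nonneg in eventually_elim) (simp add: ennreal_neg)
    then show "emeasure \<nu> S = emeasure (density \<mu> (\<lambda>w. ennreal (\<xi> w))) S"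
      using key[OF S] \<xi>m S \<mu>(2) by (simp add: emeasure_density)
  qed
qed

section \<open>Positive forms as sums of squares\<close>

lemma psd_Cauchy_Schwarz:
  fixes g :: "'a::real_vector \<Rightarrow> 'a \<Rightarrow> real"
  assumes lin: "\<And>x. linear (g x)" and sym: "\<And>x y. g x y = g y x" and psd: "\<And>x. 0 \<le> g x x"
  shows "(g x y)\<^sup>2 \<le> g x x * g y y"
proof -
  have expand: "g (x + t *\<^sub>R y) (x + t *\<^sub>R y) = g x x + 2 * t * g x y + t\<^sup>2 * g y y" for t
    using linear_add[OF lin] linear_scale[OF lin] sym[of "x + t *\<^sub>R y"] sym[of y x]
    by (simp add: power2_eq_square algebra_simps)
  show ?thesis
  proof (cases "g y y = 0")
    case True
    have "g x y = 0"
    proof (rule ccontr)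
      assume n: "g x y \<noteq> 0"
      have "0 \<le> g x x + 2 * (- (g x x + 1) / (2 * g x y)) * g x y"
        using psd[of "x + (- (g x x + 1) / (2 * g x y)) *\<^sub>R y"] unfolding expand True by simp
      also have "\<dots> = - 1" using n by (simp add: field_simps)
      finally show False by simp
    qed
    then show ?thesis by (simp add: True)
  next
    case False
    with psd[of y] have p: "0 < g y y" by (simp add: less_le)
    have "0 \<le> g x x + 2 * (- g x y / g y y) * g x y + (- g x y / g y y)\<^sup>2 * g y y"
      using psd[of "x + (- g x y / g y y) *\<^sub>R y"] unfolding expand .
    also have "\<dots> = g x x - (g x y)\<^sup>2 / g y y"
      using p by (simp add: field_simps power2_eq_square)
    finally show ?thesis using p by (simp add: field_simps)
  qed
qed

text \<open>
  The remainders of the elimination along the sequence \<open>e\<close>. If the pivot is zero, the quotient is zero by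
  the convention for division and the step changes nothing.
\<close>
primrec cholesky :: "('a \<Rightarrow> 'a \<Rightarrow> real) \<Rightarrow> (nat \<Rightarrow> 'a) \<Rightarrow> nat \<Rightarrow> 'a \<Rightarrow> 'a \<Rightarrow> real" where
  "cholesky A e 0 = A"
| "cholesky A e (Suc m) = (\<lambda>x y. cholesky A e m x y
     - cholesky A e m (e m) x * cholesky A e m (e m) y / cholesky A e m (e m) (e m))"

text \<open>
  The subtracted square is at most the form itself by Cauchy-Schwarz, so the remainder stays positive.
  The same inequality shows that a vector with pivot zero is already in the kernel.
\<close>
lemma cholesky_invariant:
  fixes A :: "'a::real_vector \<Rightarrow> 'a \<Rightarrow> real"
  assumes lin: "\<And>x. linear (A x)" and sym: "\<And>x y. A x y = A y x" and psd: "\<And>x. 0 \<le> A x x"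
  shows "linear (cholesky A e m x) \<and> cholesky A e m x y = cholesky A e m y x \<and> 0 \<le> cholesky A e m x x
    \<and> cholesky A e m x x \<le> A x x \<and> (\<forall>i<m. cholesky A e m (e i) x = 0)"
proof (induction m arbitrary: x y)
  case 0
  show ?case unfolding cholesky.simps(1) using lin[of x] sym[of x y] psd[of x] by blast
next
  case (Suc m)
  define g where "g = cholesky A e m"
  have g: "\<And>x. linear (g x)" "\<And>x y. g x y = g y x" "\<And>x. 0 \<le> g x x" "\<And>x. g x x \<le> A x x"
    "\<And>i x. i < m \<Longrightarrow> g (e i) x = 0"
    using Suc unfolding g_def by blast+
  have CS: "(g (e m) x)\<^sup>2 \<le> g (e m) (e m) * g x x" for x by (rule psd_Cauchy_Schwarz[OF g(1-3)])
  define g' where "g' x y = g x y - g (e m) x * g (e m) y / g (e m) (e m)" for x y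
  have g': "cholesky A e (Suc m) = g'" by (intro ext) (simp add: g'_def g_def)
  have 1: "linear (g' x)" for x
    using linear_add[OF g(1)] linear_scale[OF g(1)]
    by (intro linearI) (simp_all add: g'_def distrib_left add_divide_distrib right_diff_distrib)
  have 2: "g' x y = g' y x" for x y using g(2)[of x y] by (simp add: g'_def mult.commute)
  have 3: "0 \<le> g' x x" for x
  proof (cases "g (e m) (e m) = 0")
    case False
    then have p: "g (e m) (e m) > 0" using g(3)[of "e m"] by simp
    then show ?thesis using CS[of x] by (simp add: g'_def power2_eq_square field_simps)
  qed (simp add: g'_def g(3))
  have 4: "g' x x \<le> A x x" for x
  proof -
    have "0 \<le> g (e m) x * g (e m) x / g (e m) (e m)" using g(3) by simp
    then show ?thesis using g(4)[of x] by (simp add: g'_def)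
  qed
  have 5: "g' (e i) x = 0" if "i < Suc m" for i x
  proof (cases "i = m")
    case True
    show ?thesis
    proof (cases "g (e m) (e m) = 0")
      case z: True
      then have "g (e m) x = 0" using CS[of x] by simp
      then show ?thesis using True z by (simp add: g'_def)
    qed (simp add: g'_def True)
  next
    case False
    then have "g (e i) x = 0" "g (e m) (e i) = 0" using that g(5)[of i] g(2)[of "e m" "e i"] by simp_all
    then show ?thesis by (simp add: g'_def)
  qed
  show ?case unfolding g' using 1 2 3 4 5 by blast
qed

text \<open>
  Each elimination step splits off the square of a continuous linear functional, represented by a vector
  of \<open>H\<close>. Along a dense sequence the remainders tend to zero: they vanish at the vectors already used and are
  uniformly bounded by the original form.
\<close>
theorem positive_form_sum_of_squares:
  fixes A :: "'h::{real_inner, complete_space, second_countable_topology} \<Rightarrow> 'h \<Rightarrow> real"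
  assumes lin: "\<And>x. linear (A x)" and sym: "\<And>x y. A x y = A y x" and psd: "\<And>x. 0 \<le> A x x"
    and bnd: "\<And>x. A x x \<le> C * (norm x)\<^sup>2"
  shows "\<exists>v::nat \<Rightarrow> 'h. \<forall>x. (\<lambda>m. (inner (v m) x)\<^sup>2) sums A x x"
proof -
  obtain D :: "'h set" where D: "countable D" "\<And>X. open X \<Longrightarrow> X \<noteq> {} \<Longrightarrow> \<exists>d\<in>D. d \<in> X"
    using countable_dense_setE by blast
  have "D \<noteq> {}" using D(2)[of UNIV] by auto
  define e where "e = from_nat_into D"
  have e: "\<exists>i. e i \<in> X" if "open X" "X \<noteq> {}" for X
    using D(2)[OF that] range_from_nat_into[OF \<open>D \<noteq> {}\<close> D(1)] unfolding e_def by (metis imageE)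
  define g where "g = cholesky A e"
  have g: "\<And>m x. linear (g m x)" "\<And>m x y. g m x y = g m y x" "\<And>m x. 0 \<le> g m x x" "\<And>m x. g m x x \<le> A x x"
    "\<And>m i x. i < m \<Longrightarrow> g m (e i) x = 0"
    using cholesky_invariant[of A e, OF lin sym psd] unfolding g_def by blast+
  define l where "l m x = g m (e m) x / sqrt (g m (e m) (e m))" for m x
  have l2: "(l m x)\<^sup>2 = g m (e m) x * g m (e m) x / g m (e m) (e m)" for m x
    using g(3)[of m "e m"] by (simp add: l_def power_divide power2_eq_square[of "g m (e m) x"])
  have step: "g (Suc m) x x = g m x x - (l m x)\<^sup>2" for m x
    unfolding l2 by (simp add: g_def)
  have "\<exists>v. \<forall>x. l m x = inner x v" for m
  proof (rule Riesz_representation, rule bounded_linear_intro[where K="sqrt \<bar>C\<bar>"])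
    show "l m (x + y) = l m x + l m y" for x y
      using linear_add[OF g(1)[of m "e m"]] by (simp add: l_def add_divide_distrib)
    show "l m (r *\<^sub>R x) = r *\<^sub>R l m x" for r x
      using linear_scale[OF g(1)[of m "e m"]] by (simp add: l_def)
    show "norm (l m x) \<le> norm x * sqrt \<bar>C\<bar>" for x
    proof -
      have "(l m x)\<^sup>2 \<le> A x x" using step[of m x] g(3)[of "Suc m" x] g(4)[of m x] by simp
      also have "\<dots> \<le> \<bar>C\<bar> * (norm x)\<^sup>2"
        using bnd[of x] mult_right_mono[OF abs_ge_self[of C], of "(norm x)\<^sup>2"] by simp
      finally have "sqrt ((l m x)\<^sup>2) \<le> sqrt (\<bar>C\<bar> * (norm x)\<^sup>2)" by (rule real_sqrt_le_mono)
      then show ?thesis by (simp add: real_sqrt_mult mult.commute)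
    qed
  qed
  then obtain v where v: "\<And>m x. l m x = inner x (v m)" by metis
  have partial: "(\<Sum>m<N. (inner (v m) x)\<^sup>2) = A x x - g N x x" for N x
  proof (induction N)
    case (Suc N)
    then show ?case using step[of N x] v[of N x] by (simp add: inner_commute)
  qed (simp add: g_def)
  have "(\<lambda>N. g N x x) \<longlonglongrightarrow> 0" for x
  proof (rule LIMSEQ_I)
    fix r :: real assume "r > 0"
    define s where "s = sqrt (r / (\<bar>C\<bar> + 1))"
    have "0 < r / (\<bar>C\<bar> + 1)" using \<open>r > 0\<close> by simp
    then have s: "s > 0" "(\<bar>C\<bar> + 1) * s\<^sup>2 = r" by (simp_all add: s_def)
    obtain i where i: "e i \<in> ball x s" using e[of "ball x s"] s(1) by auto
    have "norm (g N x x - 0) < r" if "N \<ge> Suc i" for N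
    proof -
      \<comment> \<open>The remainder no longer sees \<open>e i\<close>, so \<open>x\<close> may be replaced by the small vector \<open>x - e i\<close>.\<close>
      have z: "g N (e i) y = 0" for y using g(5)[of i N y] that by simp
      have "g N (x - e i) (x - e i) = g N x x"
        using linear_diff[OF g(1)[of N]] g(2)[of N "x - e i"] g(2)[of N x "e i"] z by simp
      then have "g N x x \<le> A (x - e i) (x - e i)" using g(4)[of N "x - e i"] by simp
      also have "\<dots> \<le> (\<bar>C\<bar> + 1) * (norm (x - e i))\<^sup>2"
      proof (rule order_trans[OF bnd])
        have "C \<le> \<bar>C\<bar> + 1" by simp
        then show "C * (norm (x - e i))\<^sup>2 \<le> (\<bar>C\<bar> + 1) * (norm (x - e i))\<^sup>2"
          by (rule mult_right_mono) simp
      qed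
      also have "\<dots> < (\<bar>C\<bar> + 1) * s\<^sup>2"
        using i by (intro mult_strict_left_mono power_strict_mono) (simp_all add: dist_norm)
      finally show ?thesis using g(3)[of N x] s(2) by simp
    qed
    then show "\<exists>N0. \<forall>N\<ge>N0. norm (g N x x - 0) < r" by blast
  qed
  then have "(\<lambda>N. A x x - g N x x) \<longlonglongrightarrow> A x x - 0" for x by (intro tendsto_intros)
  then have "(\<lambda>m. (inner (v m) x)\<^sup>2) sums A x x" for x unfolding sums_def partial by simp
  then show ?thesis by blast
qed

text \<open>Parseval turns the trace of the form into the sum of the squared norms.\<close>
lemma trace_class_square_summable:
  fixes v :: "nat \<Rightarrow> 'h::real_inner"
  assumes B: "orthonormal_basis B" and v: "\<And>x. (\<lambda>m. (inner (v m) x)\<^sup>2) sums a x" and a: "a summable_on B"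
  shows "summable (\<lambda>m. (norm (v m))\<^sup>2)"
proof (rule summableI_nonneg_bounded)
  fix N :: nat
  have "((\<lambda>b. \<Sum>m<N. (inner (v m) b)\<^sup>2) has_sum (\<Sum>m<N. (norm (v m))\<^sup>2)) B"
  proof (induction N)
    case (Suc N)
    then show ?case using has_sum_add[OF Suc Parseval_norm_has_sum[OF B, of "v N"]] by simp
  qed simp
  moreover have "(\<Sum>m<N. (inner (v m) b)\<^sup>2) \<le> a b" for b
    using v[of b] by (metis sums_unique sums_summable sum_le_suminf finite_lessThan zero_le_power2)
  ultimately show "(\<Sum>m<N. (norm (v m))\<^sup>2) \<le> infsum a B"
    by (intro has_sum_mono[OF _ has_sum_infsum[OF a]])
qed simp

section \<open>Gaussian measures\<close>

text \<open>
  On the line of \<open>\<phi>\<close> the characteristic functional is that of the centred normal law with variance \<open>s \<phi>\<close>,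
  which degenerates to a point mass if \<open>s \<phi> = 0\<close>.
\<close>
lemma gaussian_measure_of_char:
  fixes \<nu> :: "'w::{real_normed_vector, second_countable_topology} measure"
  assumes \<nu>: "prob_space \<nu>" "sets \<nu> = sets borel"
    and s: "\<And>\<phi>. 0 \<le> s \<phi>" "\<And>t \<phi>. s (t *\<^sub>R \<phi>) = t\<^sup>2 * s \<phi>"
    and char: "\<And>\<phi>::'w \<Rightarrow>\<^sub>L real. (CLINT w|\<nu>. iexp (blinfun_apply \<phi> w)) = complex_of_real (exp (- s \<phi> / 2))"
  shows "gaussian_measure \<nu>"
  unfolding gaussian_measure_def
proof (intro conjI \<nu> allI)
  fix \<phi> :: "'w \<Rightarrow>\<^sub>L real"
  interpret \<nu>: prob_space \<nu> by fact
  interpret S: real_distribution std_normal_distribution by (rule real_dist_normal_dist)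
  define \<sigma> where "\<sigma> = sqrt (s \<phi>)"
  have \<sigma>: "0 \<le> \<sigma>" "\<sigma>\<^sup>2 = s \<phi>" using s(1)[of \<phi>] by (simp_all add: \<sigma>_def)
  have \<phi>m: "blinfun_apply \<phi> \<in> borel_measurable \<nu>"
    by (subst measurable_cong_sets[OF \<nu>(2) refl]) (rule blinfun_borel_measurable)
  have law: "distr \<nu> borel (blinfun_apply \<phi>) = distr std_normal_distribution borel (\<lambda>x. \<sigma> * x)"
  proof (rule Levy_uniqueness)
    show "real_distribution (distr \<nu> borel (blinfun_apply \<phi>))" by (rule \<nu>.real_distribution_distr[OF \<phi>m])
    show "real_distribution (distr std_normal_distribution borel (\<lambda>x. \<sigma> * x))"
      by (intro S.real_distribution_distr) simp
    show "char (distr \<nu> borel (blinfun_apply \<phi>)) = char (distr std_normal_distribution borel (\<lambda>x. \<sigma> * x))"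
    proof
      fix t
      have "char (distr \<nu> borel (blinfun_apply \<phi>)) t = (CLINT w|\<nu>. iexp (blinfun_apply (t *\<^sub>R \<phi>) w))"
        unfolding char_def using \<phi>m by (subst integral_distr) (auto simp: blinfun.scaleR_left)
      also have "\<dots> = char std_normal_distribution (t * \<sigma>)"
        unfolding char s(2) char_std_normal_distribution \<sigma>(2)[symmetric] by (simp add: power_mult_distrib)
      also have "\<dots> = char (distr std_normal_distribution borel (\<lambda>x. \<sigma> * x)) t"
        unfolding char_def by (subst integral_distr) (auto simp: mult.assoc)
      finally show "char (distr \<nu> borel (blinfun_apply \<phi>)) t = char (distr std_normal_distribution borel (\<lambda>x. \<sigma> * x)) t" .
    qed
  qed
  show "\<exists>m \<sigma>. 0 \<le> \<sigma> \<and> distr \<nu> borel (blinfun_apply \<phi>)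
      = (if \<sigma> = 0 then return borel m else density lborel (\<lambda>x. ennreal (normal_density m \<sigma> x)))"
  proof (rule exI[of _ 0], rule exI[of _ \<sigma>], intro conjI \<sigma>(1))
    show "distr \<nu> borel (blinfun_apply \<phi>)
        = (if \<sigma> = 0 then return borel 0 else density lborel (\<lambda>x. ennreal (normal_density 0 \<sigma> x)))"
    proof (cases "\<sigma> = 0")
      case True
      then have "(\<lambda>x. \<sigma> * x) = (\<lambda>_. 0)" by auto
      then have "distr \<nu> borel (blinfun_apply \<phi>) = distr std_normal_distribution borel (\<lambda>_. 0)"
        unfolding law by (simp only:)
      with True show ?thesis using S.distr_const[of 0 borel] by (simp only: if_True) simp
    next
      case False
      have "distributed std_normal_distribution lborel (\<lambda>x. x) (\<lambda>x. ennreal (std_normal_density x))"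
        by (simp add: distributed_def distr_id2)
      from S.normal_density_affine[OF this, of \<sigma> 0] False \<sigma>(1)
      have "distr std_normal_distribution lborel (\<lambda>x. \<sigma> * x) = density lborel (\<lambda>x. ennreal (normal_density 0 \<sigma> x))"
        by (simp add: distributed_def)
      moreover have "distr std_normal_distribution lborel (\<lambda>x. \<sigma> * x) = distr std_normal_distribution borel (\<lambda>x. \<sigma> * x)"
        by (rule distr_cong) simp_all
      ultimately show ?thesis using law False by simp
    qed
  qed
qed

text \<open>
  A quadratic exponent is what makes the law stable: dividing the functional by \<open>sqrt n\<close> divides the
  exponent by \<open>n\<close>, which the \<open>n\<close> factors of the sum restore.
\<close>
lemma stable_law_of_char:
  fixes \<nu> :: "'w::{real_normed_vector, second_countable_topology} measure"
  assumes \<nu>: "prob_space \<nu>" "sets \<nu> = sets borel"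
    and s: "\<And>t \<phi>. s (t *\<^sub>R \<phi>) = t\<^sup>2 * s \<phi>"
    and char: "\<And>\<phi>::'w \<Rightarrow>\<^sub>L real. (CLINT w|\<nu>. iexp (blinfun_apply \<phi> w)) = complex_of_real (exp (- s \<phi> / 2))"
    and M: "prob_space M" and n: "n \<ge> 1"
    and indep: "prob_space.indep_vars M (\<lambda>_. borel) Y {1..n::nat}"
    and law: "\<And>i. i \<in> {1..n} \<Longrightarrow> distr M borel (Y i) = \<nu>"
  shows "distr M borel (\<lambda>x. (\<Sum>i=1..n. Y i x) /\<^sub>R sqrt (real n)) = \<nu>"
proof (rule characteristic_functional_unique)
  interpret M: prob_space M by fact
  interpret \<nu>: prob_space \<nu> by fact
  have Ym [measurable]: "Y i \<in> measurable M borel" if "i \<in> {1..n}" for i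
    using indep that unfolding M.indep_vars_def by blast
  have Sm: "(\<lambda>x. (\<Sum>i=1..n. Y i x) /\<^sub>R sqrt (real n)) \<in> measurable M borel"
    by (intro borel_measurable_scaleR borel_measurable_const borel_measurable_sum Ym)
  show "finite_measure (distr M borel (\<lambda>x. (\<Sum>i=1..n. Y i x) /\<^sub>R sqrt (real n)))"
    using Sm by (rule M.finite_measure_distr)
  show "finite_measure \<nu>" by (rule \<nu>.finite_measure_axioms)
  show "sets (distr M borel (\<lambda>x. (\<Sum>i=1..n. Y i x) /\<^sub>R sqrt (real n))) = sets borel" by simp
  show "sets \<nu> = sets borel" by fact
  fix \<phi> :: "'w \<Rightarrow>\<^sub>L real"
  define \<psi> where "\<psi> = (1 / sqrt (real n)) *\<^sub>R \<phi>"
  have im: "(\<lambda>w. iexp (blinfun_apply \<eta> w)) \<in> borel_measurable borel" for \<eta> :: "'w \<Rightarrow>\<^sub>L real"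
    by (rule measurable_compose[OF blinfun_borel_measurable]) simp
  have indep': "M.indep_vars (\<lambda>_. borel) (\<lambda>i x. blinfun_apply \<psi> (Y i x)) {1..n}"
    by (rule M.indep_vars_compose2[OF indep]) (rule blinfun_borel_measurable)
  have \<psi>m: "(\<lambda>x. blinfun_apply \<psi> (Y i x)) \<in> borel_measurable M" if "i \<in> {1..n}" for i
    by (rule measurable_compose[OF Ym[OF that] blinfun_borel_measurable])
  have "(CLINT w|distr M borel (\<lambda>x. (\<Sum>i=1..n. Y i x) /\<^sub>R sqrt (real n)). iexp (blinfun_apply \<phi> w))
      = (CLINT x|M. iexp (blinfun_apply \<phi> ((\<Sum>i=1..n. Y i x) /\<^sub>R sqrt (real n))))"
    by (rule integral_distr[OF Sm im])
  also have "\<dots> = (CLINT x|M. iexp (1 * (\<Sum>i=1..n. blinfun_apply \<psi> (Y i x))))"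
    by (simp add: \<psi>_def blinfun.scaleR_left blinfun.scaleR_right blinfun.sum_right sum_divide_distrib divide_inverse mult.commute sum_distrib_left)
  also have "\<dots> = char (distr M borel (\<lambda>x. \<Sum>i=1..n. blinfun_apply \<psi> (Y i x))) 1"
    unfolding char_def using \<psi>m by (subst integral_distr) (auto intro!: borel_measurable_sum)
  also have "\<dots> = (\<Prod>i=1..n. char (distr M borel (\<lambda>x. blinfun_apply \<psi> (Y i x))) 1)"
    by (rule M.char_distr_sum[OF indep'])
  also have "\<dots> = (\<Prod>i=1..n. complex_of_real (exp (- s \<psi> / 2)))"
  proof (rule prod.cong[OF refl])
    fix i assume i: "i \<in> {1..n}"
    have "char (distr M borel (\<lambda>x. blinfun_apply \<psi> (Y i x))) 1 = (CLINT x|M. iexp (blinfun_apply \<psi> (Y i x)))"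
      unfolding char_def using \<psi>m[OF i] by (subst integral_distr) simp_all
    also have "\<dots> = (CLINT w|distr M borel (Y i). iexp (blinfun_apply \<psi> w))"
      by (rule integral_distr[OF Ym[OF i] im, symmetric])
    finally show "char (distr M borel (\<lambda>x. blinfun_apply \<psi> (Y i x))) 1 = complex_of_real (exp (- s \<psi> / 2))"
      unfolding law[OF i] char .
  qed
  also have "\<dots> = complex_of_real (exp (- s \<psi> / 2) ^ n)" by (simp only: prod_constant card_atLeastAtMost of_real_power) simp
  also have "exp (- s \<psi> / 2) ^ n = exp (real n * (- s \<psi> / 2))" by (rule exp_of_nat_mult[symmetric])
  also have "real n * (- s \<psi> / 2) = - s \<phi> / 2"
    using n unfolding \<psi>_def s by (simp add: power_divide)
  finally show "(CLINT w|distr M borel (\<lambda>x. (\<Sum>i=1..n. Y i x) /\<^sub>R sqrt (real n)). iexp (blinfun_apply \<phi> w))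
      = (CLINT w|\<nu>. iexp (blinfun_apply \<phi> w))" unfolding char .
qed

section \<open>Gaussian series\<close>

abbreviation normal_sequence :: "(nat \<Rightarrow> real) measure" where
  "normal_sequence \<equiv> PiM UNIV (\<lambda>_. std_normal_distribution)"

lemma prob_space_normal_sequence: "prob_space normal_sequence"
  by (intro prob_space_PiM prob_space_normal_density) simp

lemma normal_sequence_coordinate [measurable]: "(\<lambda>z. z m) \<in> borel_measurable normal_sequence"
proof -
  have "(\<lambda>z. z m) \<in> measurable normal_sequence std_normal_distribution"
    by (rule measurable_component_singleton) simp
  then show ?thesis by simp
qed

lemma normal_sequence_distr: "distr normal_sequence borel (\<lambda>z. z m) = std_normal_distribution"
proof -
  have "distr normal_sequence std_normal_distribution (\<lambda>z. z m) = std_normal_distribution"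
    by (rule distr_PiM_component) (auto intro: prob_space_normal_density)
  moreover have "distr normal_sequence borel (\<lambda>z. z m) = distr normal_sequence std_normal_distribution (\<lambda>z. z m)"
    by (rule distr_cong) simp_all
  ultimately show ?thesis by simp
qed

lemma normal_sequence_indep: "prob_space.indep_vars normal_sequence (\<lambda>_. borel) (\<lambda>m z. z m) UNIV"
proof -
  interpret prob_space normal_sequence by (rule prob_space_normal_sequence)
  have s: "sets (PiM UNIV (\<lambda>_::nat. borel :: real measure)) = sets normal_sequence"
    by (rule sets_PiM_cong) simp_all
  show ?thesis
  proof (subst indep_vars_iff_distr_eq_PiM')
    have "distr normal_sequence (PiM UNIV (\<lambda>_::nat. borel :: real measure)) (\<lambda>x. \<lambda>i\<in>UNIV. x i)
        = distr normal_sequence normal_sequence (\<lambda>x. x)"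
      by (rule distr_cong) (simp_all only: s restrict_UNIV refl)
    also have "\<dots> = normal_sequence" by (rule distr_id2) simp
    finally show "distr normal_sequence (PiM UNIV (\<lambda>_::nat. borel :: real measure)) (\<lambda>x. \<lambda>i\<in>UNIV. x i)
        = PiM UNIV (\<lambda>i. distr normal_sequence borel (\<lambda>z. z i))"
      by (simp add: normal_sequence_distr)
  qed simp_all
qed

lemma normal_sequence_char:
  "(CLINT z|normal_sequence. iexp (\<Sum>m<n. c m * z m)) = complex_of_real (exp (- (\<Sum>m<n. (c m)\<^sup>2) / 2))"
proof -
  interpret prob_space normal_sequence by (rule prob_space_normal_sequence)
  have ind: "indep_vars (\<lambda>_. borel) (\<lambda>m z. c m * z m) {..<n}"
    by (rule indep_vars_compose2[OF indep_vars_subset[OF normal_sequence_indep]]) simp_all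
  have "(CLINT z|normal_sequence. iexp (\<Sum>m<n. c m * z m)) = char (distr normal_sequence borel (\<lambda>z. \<Sum>m<n. c m * z m)) 1"
    unfolding char_def by (subst integral_distr) simp_all
  also have "\<dots> = (\<Prod>m<n. char (distr normal_sequence borel (\<lambda>z. c m * z m)) 1)"
    by (rule char_distr_sum[OF ind])
  also have "\<dots> = (\<Prod>m<n. complex_of_real (exp (- (c m)\<^sup>2 / 2)))"
  proof (rule prod.cong[OF refl])
    fix m
    have "char (distr normal_sequence borel (\<lambda>z. c m * z m)) 1 = (CLINT z|normal_sequence. iexp (c m * z m))"
      unfolding char_def by (subst integral_distr) simp_all
    also have "\<dots> = char (distr normal_sequence borel (\<lambda>z. z m)) (c m)"
      unfolding char_def by (subst integral_distr) simp_all
    finally show "char (distr normal_sequence borel (\<lambda>z. c m * z m)) 1 = complex_of_real (exp (- (c m)\<^sup>2 / 2))"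
      unfolding normal_sequence_distr char_std_normal_distribution .
  qed
  also have "\<dots> = complex_of_real (exp (\<Sum>m<n. - (c m)\<^sup>2 / 2))"
    by (simp add: exp_sum)
  finally show ?thesis by (simp add: sum_negf sum_divide_distrib)
qed

lemma normal_sequence_covariance:
  "integrable normal_sequence (\<lambda>z. z i * z j)"
  "(\<integral>z. z i * z j \<partial>normal_sequence) = (if i = j then 1 else 0)"
proof -
  interpret prob_space normal_sequence by (rule prob_space_normal_sequence)
  have i1: "integrable normal_sequence (\<lambda>z. (z m) ^ k)" for m k
  proof -
    have "integrable (distr normal_sequence borel (\<lambda>z. z m)) (\<lambda>x. x ^ k)"
      unfolding normal_sequence_distr by (rule integrable_std_normal_distribution_moment)
    then show ?thesis by (subst (asm) integrable_distr_eq) simp_all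
  qed
  have e1: "(\<integral>z. (z m) ^ k \<partial>normal_sequence) = (\<integral>x. x ^ k \<partial>std_normal_distribution)" for m k
  proof -
    have "(\<integral>z. (z m) ^ k \<partial>normal_sequence) = (\<integral>x. x ^ k \<partial>distr normal_sequence borel (\<lambda>z. z m))"
      by (rule integral_distr[symmetric]) simp_all
    then show ?thesis unfolding normal_sequence_distr .
  qed
  have sq: "square_integrable normal_sequence (\<lambda>z. z m)" for m
    using i1[of m 2] by (simp add: square_integrable_def)
  show "integrable normal_sequence (\<lambda>z. z i * z j)" by (rule square_integrable_mult[OF sq sq])
  show "(\<integral>z. z i * z j \<partial>normal_sequence) = (if i = j then 1 else 0)"
  proof (cases "i = j")
    case True
    have "(\<integral>x. x ^ (2 * 1) \<partial>std_normal_distribution) = 1"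
      unfolding std_normal_distribution_even_moments(1) by simp
    then show ?thesis using True e1[of j 2] by (simp add: power2_eq_square)
  next
    case False
    have "(\<integral>z. (\<Prod>m\<in>{i, j}. z m) \<partial>normal_sequence) = (\<Prod>m\<in>{i, j}. \<integral>z. z m \<partial>normal_sequence)"
      using i1[of _ 1] by (intro indep_vars_lebesgue_integral indep_vars_subset[OF normal_sequence_indep]) simp_all
    also have "\<dots> = 0"
      using False e1[of i 1] integral_std_normal_distribution_moment_odd[of 1] by simp
    finally show ?thesis using False by simp
  qed
qed

text \<open>
  By independence, the mean of the squared norm of a block of the series is the sum of \<open>\<bar>v\<^sub>m\<bar>\<^sup>2\<close> over the
  block. Along a fast subsequence the partial sums therefore converge almost surely, and the characteristic
  functional of the limit is that of the full series.
\<close>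
lemma (in abstract_wiener_space) gaussian_series_exists:
  assumes v: "summable (\<lambda>m. (norm (v m :: 'h))\<^sup>2)"
  shows "\<exists>Z :: (nat \<Rightarrow> real) \<Rightarrow> 'w. Z \<in> borel_measurable normal_sequence \<and>
    (\<forall>\<phi>. (CLINT z|normal_sequence. iexp (blinfun_apply \<phi> (Z z)))
      = complex_of_real (exp (- (\<Sum>m. (inner (v m) (J \<phi>))\<^sup>2) / 2)))"
proof -
  interpret Q: prob_space normal_sequence by (rule prob_space_normal_sequence)
  define S where "S n z = (\<Sum>m<n. z m *\<^sub>R v m)" for n and z :: "nat \<Rightarrow> real"
  define s where "s n = (\<Sum>m<n. (norm (v m))\<^sup>2)" for n
  have Sm [measurable]: "S n \<in> borel_measurable normal_sequence" for n
    unfolding S_def by measurable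
  have dist2: "square_integrable normal_sequence (\<lambda>z. norm (S n z - S m z))"
    "(\<integral>z. (norm (S n z - S m z))\<^sup>2 \<partial>normal_sequence) = s n - s m" if "m \<le> n" for m n
  proof -
    have "S n z - S m z = (\<Sum>i\<in>{m..<n}. z i *\<^sub>R v i)" for z
      using sum_diff_nat_ivl[of 0 m n "\<lambda>i. z i *\<^sub>R v i"] that by (simp add: S_def atLeast0LessThan)
    then have e: "(norm (S n z - S m z))\<^sup>2 = (\<Sum>i\<in>{m..<n}. \<Sum>j\<in>{m..<n}. inner (v i) (v j) * (z i * z j))" for z
    proof -
      have "inner (\<Sum>i\<in>{m..<n}. z i *\<^sub>R v i) (\<Sum>i\<in>{m..<n}. z i *\<^sub>R v i)
          = (\<Sum>i\<in>{m..<n}. \<Sum>j\<in>{m..<n}. inner (z i *\<^sub>R v i) (z j *\<^sub>R v j))"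
        by (subst inner_sum_left, subst inner_sum_right) (rule refl)
      also have "\<dots> = (\<Sum>i\<in>{m..<n}. \<Sum>j\<in>{m..<n}. inner (v i) (v j) * (z i * z j))"
        by (intro sum.cong refl) simp
      finally show ?thesis unfolding power2_norm_eq_inner \<open>S n z - S m z = _\<close> .
    qed
    note i = integrable_mult_right[OF normal_sequence_covariance(1)]
    show "square_integrable normal_sequence (\<lambda>z. norm (S n z - S m z))"
      unfolding square_integrable_def e
      by (intro conjI Bochner_Integration.integrable_sum i) measurable
    have "(\<integral>z. (norm (S n z - S m z))\<^sup>2 \<partial>normal_sequence)
        = (\<Sum>i\<in>{m..<n}. \<integral>z. (\<Sum>j\<in>{m..<n}. inner (v i) (v j) * (z i * z j)) \<partial>normal_sequence)"
      unfolding e by (intro Bochner_Integration.integral_sum Bochner_Integration.integrable_sum i)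
    also have "\<dots> = (\<Sum>i\<in>{m..<n}. \<Sum>j\<in>{m..<n}. \<integral>z. inner (v i) (v j) * (z i * z j) \<partial>normal_sequence)"
      by (intro sum.cong refl Bochner_Integration.integral_sum i)
    also have "\<dots> = (\<Sum>i\<in>{m..<n}. \<Sum>j\<in>{m..<n}. if i = j then inner (v i) (v i) else 0)"
      by (intro sum.cong refl) (simp add: normal_sequence_covariance(2))
    also have "\<dots> = (\<Sum>i\<in>{m..<n}. (norm (v i))\<^sup>2)" by (simp add: power2_norm_eq_inner)
    also have "\<dots> = s n - s m"
      using sum_diff_nat_ivl[of 0 m n "\<lambda>i. (norm (v i))\<^sup>2"] that by (simp add: s_def atLeast0LessThan)
    finally show "(\<integral>z. (norm (S n z - S m z))\<^sup>2 \<partial>normal_sequence) = s n - s m" .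
  qed
  have "Cauchy s" using v unfolding s_def[abs_def] summable_iff_convergent by (rule convergent_Cauchy)
  then have "\<exists>N. \<forall>m\<ge>N. \<forall>n\<ge>N. \<bar>s m - s n\<bar> < e" if "e > 0" for e
    using that unfolding Cauchy_def dist_real_def by blast
  then obtain r where r: "strict_mono r" "\<And>k. \<bar>s (r (Suc k)) - s (r k)\<bar> \<le> (1/4) ^ k"
    using fast_Cauchy_subsequence[of "\<lambda>m n. \<bar>s m - s n\<bar>"] by blast
  obtain K where K: "K > 0" "\<And>x. norm (\<iota> x) \<le> norm x * K"
    using bounded_linear.pos_bounded[OF bounded_linear_embedding] by blast
  have \<iota>m: "\<iota> \<in> borel_measurable borel"
    by (intro borel_measurable_continuous_onI bounded_linear.continuous_on[OF bounded_linear_embedding] continuous_on_id)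
  have \<iota>Sm [measurable]: "(\<lambda>z. \<iota> (S n z)) \<in> borel_measurable normal_sequence" for n
    by (rule measurable_compose[OF Sm \<iota>m])
  have "AE z in normal_sequence. convergent (\<lambda>k. \<iota> (S (r k) z))"
  proof (rule AE_convergent_summable_steps[where c="\<lambda>k. (1/2)^k * K"])
    fix k
    have le: "r k \<le> r (Suc k)" using strict_monoD[OF r(1), of k "Suc k"] by simp
    have "(\<integral>z. \<bar>norm (S (r (Suc k)) z - S (r k) z)\<bar> \<partial>normal_sequence) \<le> sqrt (s (r (Suc k)) - s (r k))"
      using Q.L1_le_L2[OF dist2(1)[OF le]] by (simp only: dist2(2)[OF le])
    also have "\<dots> \<le> sqrt ((1/4) ^ k)"
      by (rule real_sqrt_le_mono[OF order_trans[OF abs_ge_self r(2)]])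
    also have "sqrt ((1/4) ^ k) = (1/2 :: real) ^ k" by (simp add: real_sqrt_power real_sqrt_divide)
    finally have le2: "(\<integral>z. norm (S (r (Suc k)) z - S (r k) z) * K \<partial>normal_sequence) \<le> (1/2)^k * K"
      using K(1) by simp
    have "(\<integral>\<^sup>+z. ennreal (norm (\<iota> (S (r (Suc k)) z) - \<iota> (S (r k) z))) \<partial>normal_sequence)
        \<le> (\<integral>\<^sup>+z. ennreal (norm (S (r (Suc k)) z - S (r k) z) * K) \<partial>normal_sequence)"
      using K(2) by (intro nn_integral_mono ennreal_leI)
        (simp add: linear_diff[OF bounded_linear.linear[OF bounded_linear_embedding], symmetric])
    also have "\<dots> = ennreal (\<integral>z. norm (S (r (Suc k)) z - S (r k) z) * K \<partial>normal_sequence)"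
      using Q.square_integrable_integrable[OF dist2(1)[OF le]] K(1)
      by (intro nn_integral_eq_integral) simp_all
    also have "\<dots> \<le> ennreal ((1/2)^k * K)" by (rule ennreal_leI[OF le2])
    finally show "(\<integral>\<^sup>+z. ennreal (norm (\<iota> (S (r (Suc k)) z) - \<iota> (S (r k) z))) \<partial>normal_sequence) \<le> ennreal ((1/2)^k * K)" .
  next
    show "summable (\<lambda>k. (1/2) ^ k * K)" by (intro summable_mult2 summable_geometric) simp
    show "0 \<le> (1/2) ^ k * K" for k using K(1) by simp
  qed (rule \<iota>Sm)
  then have conv: "AE z in normal_sequence. (\<lambda>k. \<iota> (S (r k) z)) \<longlonglongrightarrow> lim (\<lambda>k. \<iota> (S (r k) z))"
    by eventually_elim (simp add: convergent_LIMSEQ_iff)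
  define Z where "Z z = lim (\<lambda>k. \<iota> (S (r k) z))" for z
  have Zm: "Z \<in> borel_measurable normal_sequence" unfolding Z_def by measurable
  have "(CLINT z|normal_sequence. iexp (blinfun_apply \<phi> (Z z)))
      = complex_of_real (exp (- (\<Sum>m. (inner (v m) (J \<phi>))\<^sup>2) / 2))" for \<phi>
  proof -
    note [measurable] = measurable_compose[OF Zm blinfun_borel_measurable[of \<phi>]]
      measurable_compose[OF \<iota>Sm blinfun_borel_measurable[of \<phi>]]
    have lim1: "(\<lambda>k. CLINT z|normal_sequence. iexp (blinfun_apply \<phi> (\<iota> (S (r k) z))))
        \<longlonglongrightarrow> (CLINT z|normal_sequence. iexp (blinfun_apply \<phi> (Z z)))"
    proof (rule integral_dominated_convergence[where w="\<lambda>_. 1"])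
      show "AE z in normal_sequence. (\<lambda>k. iexp (blinfun_apply \<phi> (\<iota> (S (r k) z)))) \<longlonglongrightarrow> iexp (blinfun_apply \<phi> (Z z))"
        using conv unfolding Z_def by eventually_elim (intro tendsto_intros)
    qed simp_all
    have "blinfun_apply \<phi> (\<iota> (S n z)) = (\<Sum>m<n. inner (v m) (J \<phi>) * z m)" for n z
      unfolding apply_embedding by (simp add: S_def inner_sum_left mult.commute)
    then have chS: "(CLINT z|normal_sequence. iexp (blinfun_apply \<phi> (\<iota> (S n z))))
        = complex_of_real (exp (- (\<Sum>m<n. (inner (v m) (J \<phi>))\<^sup>2) / 2))" for n
      by (simp only: normal_sequence_char)
    have "summable (\<lambda>m. (inner (v m) (J \<phi>))\<^sup>2)"
    proof (rule summable_comparison_test'[OF summable_mult2[OF v, of "(norm (J \<phi>))\<^sup>2"]])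
      show "norm ((inner (v m) (J \<phi>))\<^sup>2) \<le> (norm (v m))\<^sup>2 * (norm (J \<phi>))\<^sup>2" for m
        using power_mono[OF Cauchy_Schwarz_ineq2[of "v m" "J \<phi>"], of 2] by (simp add: power_mult_distrib)
    qed
    then have "(\<lambda>n. \<Sum>m<n. (inner (v m) (J \<phi>))\<^sup>2) \<longlonglongrightarrow> (\<Sum>m. (inner (v m) (J \<phi>))\<^sup>2)" by (rule summable_LIMSEQ)
    from LIMSEQ_subseq_LIMSEQ[OF this r(1)]
    have "(\<lambda>k. \<Sum>m<r k. (inner (v m) (J \<phi>))\<^sup>2) \<longlonglongrightarrow> (\<Sum>m. (inner (v m) (J \<phi>))\<^sup>2)"
      unfolding o_def .
    then have "(\<lambda>k. complex_of_real (exp (- (\<Sum>m<r k. (inner (v m) (J \<phi>))\<^sup>2) / 2)))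
        \<longlonglongrightarrow> complex_of_real (exp (- (\<Sum>m. (inner (v m) (J \<phi>))\<^sup>2) / 2))"
      by (intro tendsto_intros) simp_all
    with lim1 show ?thesis unfolding chS by (rule LIMSEQ_unique)
  qed
  with Zm show ?thesis by blast
qed

text \<open>
  The law of the sum of a Wiener sample and an independent Gaussian series: the characteristic functionals
  multiply, so the covariances add.
\<close>
lemma (in abstract_wiener_space) gaussian_perturbation_exists:
  assumes v: "summable (\<lambda>m. (norm (v m :: 'h))\<^sup>2)"
  shows "\<exists>\<nu>::'w measure. prob_space \<nu> \<and> sets \<nu> = sets borel \<and> (\<forall>\<phi>. (CLINT w|\<nu>. iexp (blinfun_apply \<phi> w))
    = complex_of_real (exp (- (norm (J \<phi>))\<^sup>2 / 2 - (\<Sum>m. (inner (v m) (J \<phi>))\<^sup>2) / 2)))"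
proof -
  obtain Z :: "(nat \<Rightarrow> real) \<Rightarrow> 'w" where Z: "Z \<in> borel_measurable normal_sequence"
    "\<And>\<phi>. (CLINT z|normal_sequence. iexp (blinfun_apply \<phi> (Z z)))
      = complex_of_real (exp (- (\<Sum>m. (inner (v m) (J \<phi>))\<^sup>2) / 2))"
    using gaussian_series_exists[OF v] by blast
  interpret Q: prob_space normal_sequence by (rule prob_space_normal_sequence)
  interpret P: pair_prob_space \<mu> normal_sequence ..
  define P where "P = \<mu> \<Otimes>\<^sub>M normal_sequence"
  define X where "X p = fst p + Z (snd p)" for p
  have fst_m: "fst \<in> borel_measurable P"
    using measurable_fst[of \<mu> normal_sequence] unfolding P_def measurable_cong_sets[OF refl sets_mu] .
  have snd_m: "(\<lambda>p. Z (snd p)) \<in> borel_measurable P"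
    unfolding P_def by (rule measurable_compose[OF measurable_snd Z(1)])
  have Xm: "X \<in> borel_measurable P" unfolding X_def using fst_m snd_m by (rule borel_measurable_add)
  define \<nu> where "\<nu> = distr P borel X"
  have "(CLINT w|\<nu>. iexp (blinfun_apply \<phi> w))
    = complex_of_real (exp (- (norm (J \<phi>))\<^sup>2 / 2 - (\<Sum>m. (inner (v m) (J \<phi>))\<^sup>2) / 2))" for \<phi>
  proof -
    have im: "(\<lambda>w. iexp (blinfun_apply \<phi> w)) \<in> borel_measurable borel"
      by (rule measurable_compose[OF blinfun_borel_measurable]) simp
    have "(CLINT w|\<nu>. iexp (blinfun_apply \<phi> w)) = (CLINT p|P. iexp (blinfun_apply \<phi> (X p)))"
      unfolding \<nu>_def by (rule integral_distr[OF Xm im])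
    also have "\<dots> = (CLINT w|\<mu>. CLINT z|normal_sequence. iexp (blinfun_apply \<phi> (X (w, z))))"
    proof (unfold P_def, rule P.integral_fst'[symmetric])
      show "integrable (\<mu> \<Otimes>\<^sub>M normal_sequence) (\<lambda>p. iexp (blinfun_apply \<phi> (X p)))"
        using measurable_compose[OF Xm im] unfolding P_def
        by (intro integrable_bounded_finite_measure[where K=1] P.finite_measure_axioms) simp_all
    qed
    also have "\<dots> = (CLINT w|\<mu>. CLINT z|normal_sequence. iexp (blinfun_apply \<phi> w) * iexp (blinfun_apply \<phi> (Z z)))"
      by (simp add: X_def blinfun.add_right distrib_left exp_add)
    also have "\<dots> = (CLINT w|\<mu>. iexp (blinfun_apply \<phi> w)) * (CLINT z|normal_sequence. iexp (blinfun_apply \<phi> (Z z)))"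
      by (simp only: integral_mult_right_zero integral_mult_left_zero)
    also have "\<dots> = complex_of_real (exp (- (norm (J \<phi>))\<^sup>2 / 2) * exp (- (\<Sum>m. (inner (v m) (J \<phi>))\<^sup>2) / 2))"
      unfolding characteristic_functional Z(2) by simp
    finally show ?thesis unfolding exp_add[symmetric] by simp
  qed
  moreover have "prob_space \<nu>" unfolding \<nu>_def P_def using Xm unfolding P_def by (rule P.prob_space_distr)
  moreover have "sets \<nu> = sets borel" by (simp add: \<nu>_def)
  ultimately show ?thesis by blast
qed

section \<open>Covariances and kernels\<close>

text \<open>
  The character of the line is Lipschitz with constant \<open>1\<close>; Cauchy-Schwarz against \<open>\<xi>\<close> does the rest.
\<close>
lemma L2_lim_iexp:
  assumes L: "L2_lim M Y Z" and \<xi>: "square_integrable M \<xi>" and fin: "prob_space M"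
  shows "(\<lambda>n. CLINT x|M. iexp (Y n x) * complex_of_real (\<xi> x)) \<longlonglongrightarrow> (CLINT x|M. iexp (Z x) * complex_of_real (\<xi> x))"
proof -
  interpret prob_space M by fact
  note [measurable] = square_integrableD(1)[OF L2_limD(1)[OF L]] square_integrableD(1)[OF L2_limD(2)[OF L]]
    square_integrableD(1)[OF \<xi>]
  have i: "integrable M (\<lambda>x. iexp (V x) * complex_of_real (\<xi> x))" if [measurable]: "V \<in> borel_measurable M" for V
  proof (rule Bochner_Integration.integrable_bound[OF square_integrable_integrable[OF \<xi>]])
    show "(\<lambda>x. iexp (V x) * complex_of_real (\<xi> x)) \<in> borel_measurable M" by measurable
    show "AE x in M. norm (iexp (V x) * complex_of_real (\<xi> x)) \<le> norm (\<xi> x)"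
      by (rule AE_I2) (simp add: norm_mult)
  qed
  have "(\<lambda>n. (CLINT x|M. iexp (Y n x) * complex_of_real (\<xi> x)) - (CLINT x|M. iexp (Z x) * complex_of_real (\<xi> x))) \<longlonglongrightarrow> 0"
  proof (rule Lim_null_comparison)
    have "(\<lambda>n. sqrt (\<integral>x. (Y n x - Z x)\<^sup>2 \<partial>M) * sqrt (\<integral>x. (\<xi> x)\<^sup>2 \<partial>M)) \<longlonglongrightarrow> sqrt 0 * sqrt (\<integral>x. (\<xi> x)\<^sup>2 \<partial>M)"
      by (intro tendsto_intros L2_limD(3)[OF L])
    then show "(\<lambda>n. sqrt (\<integral>x. (Y n x - Z x)\<^sup>2 \<partial>M) * sqrt (\<integral>x. (\<xi> x)\<^sup>2 \<partial>M)) \<longlonglongrightarrow> 0" by simp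
    show "\<forall>\<^sub>F n in sequentially. norm ((CLINT x|M. iexp (Y n x) * complex_of_real (\<xi> x)) - (CLINT x|M. iexp (Z x) * complex_of_real (\<xi> x)))
        \<le> sqrt (\<integral>x. (Y n x - Z x)\<^sup>2 \<partial>M) * sqrt (\<integral>x. (\<xi> x)\<^sup>2 \<partial>M)"
    proof (intro always_eventually allI)
      fix n
      have abs: "square_integrable M (\<lambda>x. \<bar>V x\<bar>)" if "square_integrable M V" for V
        using that by (auto simp: square_integrable_def)
      have dY: "square_integrable M (\<lambda>x. Y n x - Z x)" by (intro square_integrable_diff L2_limD[OF L])
      have "(CLINT x|M. iexp (Y n x) * complex_of_real (\<xi> x)) - (CLINT x|M. iexp (Z x) * complex_of_real (\<xi> x))
          = (CLINT x|M. iexp (Y n x) * complex_of_real (\<xi> x) - iexp (Z x) * complex_of_real (\<xi> x))"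
        by (rule Bochner_Integration.integral_diff[symmetric]) (intro i; measurable)+
      also have "norm \<dots> \<le> (\<integral>x. norm (iexp (Y n x) * complex_of_real (\<xi> x) - iexp (Z x) * complex_of_real (\<xi> x)) \<partial>M)"
        by (rule integral_norm_bound)
      also have "\<dots> \<le> (\<integral>x. \<bar>Y n x - Z x\<bar> * \<bar>\<xi> x\<bar> \<partial>M)"
      proof (rule integral_mono)
        show "integrable M (\<lambda>x. norm (iexp (Y n x) * complex_of_real (\<xi> x) - iexp (Z x) * complex_of_real (\<xi> x)))"
          by (intro integrable_norm Bochner_Integration.integrable_diff i; measurable)
        show "integrable M (\<lambda>x. \<bar>Y n x - Z x\<bar> * \<bar>\<xi> x\<bar>)"
          by (intro square_integrable_mult abs dY \<xi>)
        fix x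
        have "iexp (Y n x) = iexp (Z x) * iexp (Y n x - Z x)"
          by (simp add: exp_add[symmetric] right_diff_distrib)
        then have "iexp (Y n x) * complex_of_real (\<xi> x) - iexp (Z x) * complex_of_real (\<xi> x)
            = iexp (Z x) * (iexp (Y n x - Z x) - 1) * complex_of_real (\<xi> x)"
          by (simp only: right_diff_distrib left_diff_distrib mult_1_right)
        then have "norm (iexp (Y n x) * complex_of_real (\<xi> x) - iexp (Z x) * complex_of_real (\<xi> x))
            = norm (iexp (Y n x - Z x) - 1) * \<bar>\<xi> x\<bar>"
          by (simp only: norm_mult norm_of_real) simp
        also have "norm (iexp (Y n x - Z x) - 1) \<le> \<bar>Y n x - Z x\<bar>"
          using iexp_approx1[of "Y n x - Z x" 0] by simp
        finally show "norm (iexp (Y n x) * complex_of_real (\<xi> x) - iexp (Z x) * complex_of_real (\<xi> x)) \<le> \<bar>Y n x - Z x\<bar> * \<bar>\<xi> x\<bar>"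
          by (simp add: mult_right_mono)
      qed
      also have "\<dots> \<le> sqrt (\<integral>x. (\<bar>Y n x - Z x\<bar>)\<^sup>2 \<partial>M) * sqrt (\<integral>x. (\<bar>\<xi> x\<bar>)\<^sup>2 \<partial>M)"
        by (rule order_trans[OF abs_ge_self L2_Cauchy_Schwarz[OF abs[OF dY] abs[OF \<xi>]]])
      finally show "norm ((CLINT x|M. iexp (Y n x) * complex_of_real (\<xi> x)) - (CLINT x|M. iexp (Z x) * complex_of_real (\<xi> x)))
        \<le> sqrt (\<integral>x. (Y n x - Z x)\<^sup>2 \<partial>M) * sqrt (\<integral>x. (\<xi> x)\<^sup>2 \<partial>M)" by simp
    qed
  qed
  then show ?thesis using LIM_zero_iff by blast
qed

lemma (in prob_space) covariance_eq:
  assumes Y: "square_integrable M Y" and Z: "square_integrable M Z"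
  shows "covariance M Y Z = expectation (\<lambda>x. Y x * Z x) - expectation Y * expectation Z"
proof -
  define a b where "a = expectation Y" and "b = expectation Z"
  have i: "integrable M Y" "integrable M Z" "integrable M (\<lambda>x. Y x * Z x)"
    using square_integrable_integrable[OF Y] square_integrable_integrable[OF Z] square_integrable_mult[OF Y Z] by auto
  have "(Y x - a) * (Z x - b) = Y x * Z x - b * Y x - a * Z x + a * b" for x
    by (simp add: algebra_simps)
  then have "covariance M Y Z = expectation (\<lambda>x. Y x * Z x - b * Y x - a * Z x + a * b)"
    unfolding covariance_def a_def[symmetric] b_def[symmetric] by simp
  also have "\<dots> = expectation (\<lambda>x. Y x * Z x) - b * a - a * b + a * b"
    using i by (simp add: a_def b_def prob_space)
  finally show ?thesis by (simp add: a_def b_def)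
qed

context wiener_chaos
begin

text \<open>
  The Hermite polynomials of degrees one and two are \<open>x\<close> and \<open>x\<^sup>2 - \<sigma>\<close>, so pairing them with \<open>f\<close> gives the
  mean and the second moment of each functional. Polarization in \<open>\<phi>\<close> yields the mixed moments.
\<close>
lemma kernel_moments:
  assumes f: "square_integrable \<mu> f" "(\<integral>w. f w \<partial>\<mu>) = 1" and F: "chaos_kernels \<iota> \<mu> f F"
  shows "(\<integral>w. f w * blinfun_apply \<phi> w \<partial>\<mu>) = F 1 [J \<phi>]"
    and "(\<integral>w. f w * (blinfun_apply \<phi> w * blinfun_apply \<psi> w) \<partial>\<mu>) = inner (J \<phi>) (J \<psi>) + 2 * F 2 [J \<phi>, J \<psi>]"
proof -
  show "(\<integral>w. f w * blinfun_apply \<phi> w \<partial>\<mu>) = F 1 [J \<phi>]"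
    using chaos_kernels_hermite[OF F, of 1 \<phi>] by simp
  have F2: "F 2 \<in> tensor_space 2" and sym: "F 2 [x, y] = F 2 [y, x]" for x y
    using F symmetric_2[of "F 2" x y] by (auto simp: chaos_kernels_def sym_tensor_space_def)
  have sqi: "integrable \<mu> (\<lambda>w. f w * G w)" if "moments G" for G
    by (rule square_integrable_mult[OF f(1) moments_square_integrable[OF that]])
  have m: "moments (\<lambda>w. blinfun_apply \<theta> w * blinfun_apply \<theta> w)" for \<theta> :: "'w \<Rightarrow>\<^sub>L real"
    by (intro moments_mult moments_functional)
  have square: "(\<integral>w. f w * (blinfun_apply \<theta> w * blinfun_apply \<theta> w) \<partial>\<mu>) = (norm (J \<theta>))\<^sup>2 + 2 * F 2 [J \<theta>, J \<theta>]" for \<theta>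
  proof -
    define H where "H w = hermite 2 ((norm (J \<theta>))\<^sup>2) (blinfun_apply \<theta> w)" for w
    have mH: "moments H" unfolding H_def by (rule moments_hermite)
    have "f w * (blinfun_apply \<theta> w * blinfun_apply \<theta> w) = f w * H w + (norm (J \<theta>))\<^sup>2 * f w" for w
      by (simp add: H_def numeral_2_eq_2 algebra_simps)
    then have "(\<integral>w. f w * (blinfun_apply \<theta> w * blinfun_apply \<theta> w) \<partial>\<mu>) = (\<integral>w. f w * H w + (norm (J \<theta>))\<^sup>2 * f w \<partial>\<mu>)"
      by simp
    also have "\<dots> = (\<integral>w. f w * H w \<partial>\<mu>) + (norm (J \<theta>))\<^sup>2 * (\<integral>w. f w \<partial>\<mu>)"
      using sqi[OF mH] mu.square_integrable_integrable[OF f(1)] by simp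
    also have "(\<integral>w. f w * H w \<partial>\<mu>) = 2 * F 2 [J \<theta>, J \<theta>]"
      using chaos_kernels_hermite[OF F, of 2 \<theta>] unfolding H_def by (simp add: numeral_2_eq_2)
    finally show ?thesis using f(2) by simp
  qed
  have add: "F 2 [x + y, z] = F 2 [x, z] + F 2 [y, z]" "F 2 [z, x + y] = F 2 [z, x] + F 2 [z, y]"
    "F 2 [x - y, z] = F 2 [x, z] - F 2 [y, z]" "F 2 [z, x - y] = F 2 [z, x] - F 2 [z, y]" for x y z
    using linear_add[OF tensor_space_2(1)[OF F2]] linear_add[OF tensor_space_2(2)[OF F2]]
      linear_diff[OF tensor_space_2(1)[OF F2]] linear_diff[OF tensor_space_2(2)[OF F2]] by auto
  have "f w * (blinfun_apply \<phi> w * blinfun_apply \<psi> w)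
      = (1/4) * (f w * (blinfun_apply (\<phi> + \<psi>) w * blinfun_apply (\<phi> + \<psi>) w)
        - f w * (blinfun_apply (\<phi> - \<psi>) w * blinfun_apply (\<phi> - \<psi>) w))" for w
    by (simp add: blinfun.add_left blinfun.diff_left algebra_simps)
  then have "(\<integral>w. f w * (blinfun_apply \<phi> w * blinfun_apply \<psi> w) \<partial>\<mu>)
      = (\<integral>w. (1/4) * (f w * (blinfun_apply (\<phi> + \<psi>) w * blinfun_apply (\<phi> + \<psi>) w)
        - f w * (blinfun_apply (\<phi> - \<psi>) w * blinfun_apply (\<phi> - \<psi>) w)) \<partial>\<mu>)" by (simp only:)
  also have "\<dots> = (1/4) * ((\<integral>w. f w * (blinfun_apply (\<phi> + \<psi>) w * blinfun_apply (\<phi> + \<psi>) w) \<partial>\<mu>)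
        - (\<integral>w. f w * (blinfun_apply (\<phi> - \<psi>) w * blinfun_apply (\<phi> - \<psi>) w) \<partial>\<mu>))"
    by (simp only: integral_mult_right_zero Bochner_Integration.integral_diff[OF sqi[OF m] sqi[OF m]])
  also have "\<dots> = inner (J \<phi>) (J \<psi>) + 2 * F 2 [J \<phi>, J \<psi>]"
  proof -
    have n: "(norm (J \<phi> + J \<psi>))\<^sup>2 - (norm (J \<phi> - J \<psi>))\<^sup>2 = 4 * inner (J \<phi>) (J \<psi>)"
      unfolding power2_norm_eq_inner inner_add_left inner_add_right inner_diff_left inner_diff_right
        inner_commute[of "J \<psi>" "J \<phi>"] by simp
    show ?thesis unfolding square J_add J_diff add sym[of "J \<psi>" "J \<phi>"] using n by simp
  qed
  finally show "(\<integral>w. f w * (blinfun_apply \<phi> w * blinfun_apply \<psi> w) \<partial>\<mu>) = inner (J \<phi>) (J \<psi>) + 2 * F 2 [J \<phi>, J \<psi>]" .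
qed

text \<open>
  Both sides are continuous in \<open>h\<close> and \<open>k\<close>, and for functionals they are the moments given by the kernels.
\<close>
theorem pairing_covariance:
  assumes M: "prob_space M" and X: "X \<in> measurable M borel" and d: "has_density (distr M borel X) \<mu> f"
    and f: "square_integrable \<mu> f" and F: "chaos_kernels \<iota> \<mu> f F"
  shows "covariance M (wiener_pairing \<iota> M X h) (wiener_pairing \<iota> M X k)
    = inner h k + 2 * F 2 [h, k] - F 1 [h] * F 1 [k]"
proof -
  interpret M: prob_space M by fact
  have Fts: "F k \<in> tensor_space k" for k using F by (simp add: chaos_kernels_def sym_tensor_space_def)
  have f1: "(\<integral>w. f w \<partial>\<mu>) = 1"
    using law_integral(2)[OF X d f moments_const[of 1]] by (simp add: M.prob_space)
  note km = kernel_moments[OF f f1 F]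
  have "\<forall>x. \<exists>\<Phi>. (\<lambda>n. J (\<Phi> n)) \<longlonglongrightarrow> x" using J_approx by blast
  then obtain \<Phi> where \<Phi>: "\<And>x. (\<lambda>n. J (\<Phi> x n)) \<longlonglongrightarrow> x" by metis
  have ten: "(\<lambda>n. F i (map (\<lambda>x. J (\<Phi> x n)) xs)) \<longlonglongrightarrow> F i xs" if "length xs = i" for i xs
  proof -
    obtain C where C: "\<And>xs. length xs = i \<Longrightarrow> \<bar>F i xs\<bar> \<le> C * (\<Prod>j<i. norm (xs ! j))"
      using tensor_space_bounded[OF Fts[of i]] by blast
    show ?thesis by (rule multilinear_tendsto[OF tensor_space_linear[OF Fts] C \<Phi> that])
  qed
  have L: "L2_lim M (\<lambda>n x. blinfun_apply (\<Phi> h n) (X x)) (wiener_pairing \<iota> M X h)" for h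
    by (rule wiener_pairing_L2_lim[OF M law_second_moment[OF X d f] \<Phi>])
  note sq = L2_limD(2)[OF L]
  have mean: "M.expectation (wiener_pairing \<iota> M X h) = F 1 [h]" for h
  proof -
    have 1: "(\<lambda>n. M.expectation (\<lambda>x. blinfun_apply (\<Phi> h n) (X x))) \<longlonglongrightarrow> M.expectation (wiener_pairing \<iota> M X h)"
      using L2_lim_integral_mult[OF L L2_lim_const[OF M.square_integrable_const[of 1]]] by simp
    have 2: "M.expectation (\<lambda>x. blinfun_apply (\<Phi> h n) (X x)) = F 1 [J (\<Phi> h n)]" for n
      unfolding law_integral(2)[OF X d f moments_functional] km(1) ..
    show ?thesis using LIMSEQ_unique[OF 1[unfolded 2]] ten[of "[h]" 1] by simp
  qed
  have cross: "M.expectation (\<lambda>x. wiener_pairing \<iota> M X h x * wiener_pairing \<iota> M X k x) = inner h k + 2 * F 2 [h, k]"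
  proof -
    have 1: "(\<lambda>n. M.expectation (\<lambda>x. blinfun_apply (\<Phi> h n) (X x) * blinfun_apply (\<Phi> k n) (X x)))
        \<longlonglongrightarrow> M.expectation (\<lambda>x. wiener_pairing \<iota> M X h x * wiener_pairing \<iota> M X k x)"
      by (rule L2_lim_integral_mult[OF L L])
    have 2: "M.expectation (\<lambda>x. blinfun_apply (\<Phi> h n) (X x) * blinfun_apply (\<Phi> k n) (X x))
        = inner (J (\<Phi> h n)) (J (\<Phi> k n)) + 2 * F 2 [J (\<Phi> h n), J (\<Phi> k n)]" for n
      unfolding km(2)[symmetric]
      by (rule law_integral(2)[OF X d f moments_mult[OF moments_functional moments_functional]])
    have "(\<lambda>n. inner (J (\<Phi> h n)) (J (\<Phi> k n)) + 2 * F 2 [J (\<Phi> h n), J (\<Phi> k n)]) \<longlonglongrightarrow> inner h k + 2 * F 2 [h, k]"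
      using ten[of "[h, k]" 2] by (intro tendsto_intros \<Phi>) simp
    from LIMSEQ_unique[OF 1[unfolded 2] this] show ?thesis .
  qed
  show ?thesis unfolding M.covariance_eq[OF sq sq] mean cross ..
qed

text \<open>
  By density of the range of \<open>J\<close>, as both sides are continuous in \<open>h\<close>.
\<close>
lemma char_of_pairing:
  assumes \<xi>: "square_integrable \<mu> \<xi>" and g: "g \<in> tensor_space 2"
    and char: "\<And>\<eta>. char_int \<xi> \<eta> = complex_of_real (exp (- g [J \<eta>, J \<eta>] - (norm (J \<eta>))\<^sup>2 / 2))"
  shows "(CLINT w|\<mu>. iexp (wiener_pairing \<iota> \<mu> (\<lambda>w. w) h w) * complex_of_real (\<xi> w))
    = complex_of_real (exp (- g [h, h] - (norm h)\<^sup>2 / 2))"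
proof -
  obtain \<phi> where \<phi>: "(\<lambda>n. J (\<phi> n)) \<longlonglongrightarrow> h" using J_approx by blast
  have L: "L2_lim \<mu> (\<lambda>n w. blinfun_apply (\<phi> n) w) (wiener_pairing \<iota> \<mu> (\<lambda>w. w) h)"
    by (rule wiener_pairing_L2_lim[OF prob_space_mu _ _ \<phi>, where C=1])
      (simp_all add: moments_square_integrable[OF moments_functional] functional_second_moment)
  have 1: "(\<lambda>n. CLINT w|\<mu>. iexp (blinfun_apply (\<phi> n) w) * complex_of_real (\<xi> w))
      \<longlonglongrightarrow> (CLINT w|\<mu>. iexp (wiener_pairing \<iota> \<mu> (\<lambda>w. w) h w) * complex_of_real (\<xi> w))"
    by (rule L2_lim_iexp[OF L \<xi> prob_space_mu])
  have 2: "(CLINT w|\<mu>. iexp (blinfun_apply (\<phi> n) w) * complex_of_real (\<xi> w))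
      = complex_of_real (exp (- g [J (\<phi> n), J (\<phi> n)] - (norm (J (\<phi> n)))\<^sup>2 / 2))" for n
    using char[of "\<phi> n"] unfolding char_int_def by (simp only: mult.commute)
  obtain C where C: "\<And>xs. length xs = 2 \<Longrightarrow> \<bar>g xs\<bar> \<le> C * (\<Prod>j<2. norm (xs ! j))"
    using tensor_space_bounded[OF g] by blast
  \<comment> \<open>Only \<open>h\<close> has to be approximated by the range of \<open>J\<close>; leaving the other vectors fixed makes the
    maps \<open>P n\<close> converge to the identity everywhere.\<close>
  define P where "P n x = (if x = h then J (\<phi> n) else x)" for n x
  have "(\<lambda>n. P n x) \<longlonglongrightarrow> x" for x using \<phi> by (cases "x = h") (simp_all add: P_def)
  from multilinear_tendsto[OF tensor_space_linear[OF g] C this, of "[h, h]"]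
  have "(\<lambda>n. g [J (\<phi> n), J (\<phi> n)]) \<longlonglongrightarrow> g [h, h]" by (simp add: P_def)
  then have "(\<lambda>n. complex_of_real (exp (- g [J (\<phi> n), J (\<phi> n)] - (norm (J (\<phi> n)))\<^sup>2 / 2)))
      \<longlonglongrightarrow> complex_of_real (exp (- g [h, h] - (norm h)\<^sup>2 / 2))"
    by (intro tendsto_intros \<phi>) simp_all
  from LIMSEQ_unique[OF 1[unfolded 2] this] show ?thesis .
qed

text \<open>
  The trace class form \<open>2 g\<close> is realized by a Gaussian perturbation of \<open>\<mu>\<close>. Its law has the characteristic
  functional of \<open>\<xi> \<mu>\<close>, so \<open>\<xi>\<close> is its density.
\<close>
theorem wick_exponential_density:
  assumes g: "g \<in> tensor_space 2" and sym: "\<And>x y. g [x, y] = g [y, x]" and psd: "\<And>x. 0 \<le> g [x, x]"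
    and B: "orthonormal_basis B" and trace: "(\<lambda>x. 2 * g [x, x]) summable_on B"
    and \<xi>: "L2_sums \<mu> (wick_term g) \<xi>"
  shows "\<exists>\<nu>. has_density \<nu> \<mu> \<xi> \<and> prob_space \<nu> \<and> sets \<nu> = sets borel \<and> (\<forall>\<phi>. (CLINT w|\<nu>. iexp (blinfun_apply \<phi> w))
    = complex_of_real (exp (- ((norm (J \<phi>))\<^sup>2 + 2 * g [J \<phi>, J \<phi>]) / 2)))"
proof -
  have \<xi>sq: "square_integrable \<mu> \<xi>" using \<xi> L2_limD(2) unfolding L2_sums_def by blast
  obtain C where C: "C \<ge> 0" "\<And>x y. \<bar>g [x, y]\<bar> \<le> C * norm x * norm y"
    using tensor_space_2(3)[OF g] by blast
  have "\<exists>v::nat \<Rightarrow> 'h. \<forall>x. (\<lambda>m. (inner (v m) x)\<^sup>2) sums (2 * g [x, x])"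
  proof (rule positive_form_sum_of_squares[where A="\<lambda>x y. 2 * g [x, y]" and C="2 * C"])
    show "linear (\<lambda>y. 2 * g [x, y])" for x
      using linear_compose_scale_right[OF tensor_space_2(2)[OF g, of x], of 2] by simp
    show "2 * g [x, y] = 2 * g [y, x]" for x y by (simp only: sym[of x y])
    show "0 \<le> 2 * g [x, x]" for x using psd[of x] by simp
    show "2 * g [x, x] \<le> 2 * C * (norm x)\<^sup>2" for x
      using C(2)[of x x] by (simp add: power2_eq_square mult.assoc)
  qed
  then obtain v :: "nat \<Rightarrow> 'h" where v: "\<And>x. (\<lambda>m. (inner (v m) x)\<^sup>2) sums (2 * g [x, x])" by blast
  have "summable (\<lambda>m. (norm (v m))\<^sup>2)" by (rule trace_class_square_summable[OF B v trace])
  then obtain \<nu> :: "'w measure" where \<nu>: "prob_space \<nu>" "sets \<nu> = sets borel"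
    and ch: "\<And>\<phi>. (CLINT w|\<nu>. iexp (blinfun_apply \<phi> w))
      = complex_of_real (exp (- (norm (J \<phi>))\<^sup>2 / 2 - (\<Sum>m. (inner (v m) (J \<phi>))\<^sup>2) / 2))"
    using gaussian_perturbation_exists by blast
  have e: "- (norm (J \<phi>))\<^sup>2 / 2 - (2 * g [J \<phi>, J \<phi>]) / 2 = - g [J \<phi>, J \<phi>] - (norm (J \<phi>))\<^sup>2 / 2"
    "- g [J \<phi>, J \<phi>] - (norm (J \<phi>))\<^sup>2 / 2 = - ((norm (J \<phi>))\<^sup>2 + 2 * g [J \<phi>, J \<phi>]) / 2" for \<phi>
    by (simp_all add: field_simps)
  have ch': "(CLINT w|\<nu>. iexp (blinfun_apply \<phi> w)) = complex_of_real (exp (- g [J \<phi>, J \<phi>] - (norm (J \<phi>))\<^sup>2 / 2))" for \<phi>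
    unfolding ch sums_unique[OF v, symmetric] e(1) ..
  have "(CLINT w|\<mu>. complex_of_real (\<xi> w) * iexp (blinfun_apply \<phi> w)) = (CLINT w|\<nu>. iexp (blinfun_apply \<phi> w))" for \<phi>
    using wick_exponential_char[OF g \<xi>, of \<phi>] unfolding ch' char_int_def .
  note dens = density_nonneg_of_characteristic_functional[OF prob_space_mu sets_mu \<nu>
      mu.square_integrable_integrable[OF \<xi>sq] this]
  have "has_density \<nu> \<mu> \<xi>"
    unfolding has_density_def using dens square_integrableD(1)[OF \<xi>sq] by blast
  with \<nu> show ?thesis using ch' unfolding e(2) by blast
qed

end

section \<open>The Gaussian density attached to the first two kernels\<close>

theorem proposition1p4:
  fixes \<iota> :: "'h::{real_inner, complete_space, second_countable_topology}
               \<Rightarrow> 'w::{banach, second_countable_topology}"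
    and \<mu> :: "'w measure"
    and M :: "'a measure"
    and X :: "nat \<Rightarrow> 'a \<Rightarrow> 'w"
    and f :: "'w \<Rightarrow> real"
    and F :: "nat \<Rightarrow> 'h list \<Rightarrow> real"
    and g\<^sub>2 :: "'h list \<Rightarrow> real"
  assumes wiener: "abstract_wiener_space \<iota> \<mu>"
    and prob: "prob_space M"
    and independent: "prob_space.indep_vars M (\<lambda>_. borel) X {1..}"
    and identically_distributed: "\<forall>m\<ge>1. \<forall>n\<ge>1. distr M borel (X m) = distr M borel (X n)"
    and density: "\<forall>n\<ge>1. has_density (distr M borel (X n)) \<mu> f"
    and density_L2: "square_integrable \<mu> f"
    and variance_ge: "\<forall>n\<ge>1. \<forall>h.
      prob_space.variance M (wiener_pairing \<iota> M (X n) h) \<ge> (norm h)\<^sup>2"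
    and variance_summable: "\<exists>B. orthonormal_basis B \<and> (\<forall>n\<ge>1.
      (\<lambda>e. prob_space.variance M (wiener_pairing \<iota> M (X n) e) - 1) summable_on B)"
    and covariance_lt: "\<exists>B. orthonormal_basis B \<and> (\<forall>n\<ge>1.
      (\<lambda>(d, e). (covariance M (wiener_pairing \<iota> M (X n) d) (wiener_pairing \<iota> M (X n) e)
                  - (if d = e then 1 else 0))\<^sup>2) summable_on B \<times> B \<and>
      (\<Sum>\<^sub>\<infinity>(d, e)\<in>B \<times> B.
        (covariance M (wiener_pairing \<iota> M (X n) d) (wiener_pairing \<iota> M (X n) e)
                  - (if d = e then 1 else 0))\<^sup>2) < 1)"
    and kernels: "chaos_kernels \<iota> \<mu> f F"
    and g2: "g\<^sub>2 = (\<lambda>xs. F 2 xs - tensor_power 1 (F 1) 2 xs / 2)"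
  shows "(\<exists>\<xi>. L2_sums \<mu>
            (\<lambda>k w. multiple_integral \<iota> \<mu> (2 * k) (tensor_power 2 g\<^sub>2 k) w / fact k) \<xi>) \<and>
    (\<forall>\<xi>. L2_sums \<mu>
            (\<lambda>k w. multiple_integral \<iota> \<mu> (2 * k) (tensor_power 2 g\<^sub>2 k) w / fact k) \<xi> \<longrightarrow>
      square_integrable \<mu> \<xi> \<and>
      (\<exists>\<nu>. has_density \<nu> \<mu> \<xi> \<and> gaussian_measure \<nu> \<and>
        (\<forall>h. (\<integral>w. iexp (wiener_pairing \<iota> \<mu> (\<lambda>w. w) h w) * complex_of_real (\<xi> w) \<partial>\<mu>)
              = complex_of_real
                  (exp (- tensor_inner 2 g\<^sub>2 (pure_tensor [h, h]) - (norm h)\<^sup>2 / 2))) \<and>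
        (\<forall>(M' :: 'b measure) (Y :: nat \<Rightarrow> 'b \<Rightarrow> 'w) n.
          n \<ge> 1 \<longrightarrow> prob_space M' \<longrightarrow>
          prob_space.indep_vars M' (\<lambda>_. borel) Y {1..n} \<longrightarrow>
          (\<forall>i\<in>{1..n}. distr M' borel (Y i) = \<nu>) \<longrightarrow>
          distr M' borel (\<lambda>x. (\<Sum>i=1..n. Y i x) /\<^sub>R sqrt (real n)) = \<nu>)))"
proof -
  interpret M: prob_space M by (rule prob)
  obtain B2 :: "'h set" where B2: "orthonormal_basis B2"
    and hs_summable: "(\<lambda>(d, e). (covariance M (wiener_pairing \<iota> M (X 1) d) (wiener_pairing \<iota> M (X 1) e)
                  - (if d = e then 1 else 0))\<^sup>2) summable_on B2 \<times> B2"
    and hs_lt: "(\<Sum>\<^sub>\<infinity>(d, e)\<in>B2 \<times> B2.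
        (covariance M (wiener_pairing \<iota> M (X 1) d) (wiener_pairing \<iota> M (X 1) e)
                  - (if d = e then 1 else 0))\<^sup>2) < 1"
    using covariance_lt by blast
  obtain B1 :: "'h set" where B1: "orthonormal_basis B1"
    and tr: "(\<lambda>e. M.variance (wiener_pairing \<iota> M (X 1) e) - 1) summable_on B1"
    using variance_summable by blast
  \<comment> \<open>An orthonormal basis exists by hypothesis, hence \<open>some_basis\<close> is one.\<close>
  interpret wiener_chaos \<iota> \<mu>
    using wiener some_basis_orthonormal B2
    by (intro wiener_chaos.intro wiener_chaos_axioms.intro) blast+
  have Xm: "X 1 \<in> measurable M borel" using independent unfolding M.indep_vars_def by auto
  have d: "has_density (distr M borel (X 1)) \<mu> f" using density by blast
  have F: "F k \<in> tensor_space k" for k using kernels by (simp add: chaos_kernels_def sym_tensor_space_def)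
  have F2sym: "F 2 [x, y] = F 2 [y, x]" for x y
    using kernels symmetric_2[of "F 2" x y] by (auto simp: chaos_kernels_def sym_tensor_space_def)
  have F11: "tensor_power 1 (F 1) 2 \<in> tensor_space 2"
    using tensor_prod_in_tensor_space[OF F[of 1] tensor_prod_in_tensor_space[OF F[of 1] pure_tensor_in_tensor_space[OF basis, of "[]"]]]
    by (simp add: numeral_2_eq_2)
  have g: "g\<^sub>2 \<in> tensor_space 2"
    using tensor_space_lincomb[OF F[of 2] F11, of 1 "- 1 / 2"] unfolding g2 by simp
  have g_eq: "g\<^sub>2 [x, y] = F 2 [x, y] - F 1 [x] * F 1 [y] / 2" for x y
    unfolding g2 by (simp add: numeral_2_eq_2 tensor_prod_def pure_tensor_def)
  have g_sym: "g\<^sub>2 [x, y] = g\<^sub>2 [y, x]" for x y unfolding g_eq F2sym[of x y] by simp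
  \<comment> \<open>The three conditions on \<open>X 1\<close> become positivity, finite trace and smallness of the form \<open>2 g\<^sub>2\<close>.\<close>
  have cov: "covariance M (wiener_pairing \<iota> M (X 1) x) (wiener_pairing \<iota> M (X 1) y) = inner x y + 2 * g\<^sub>2 [x, y]" for x y
    unfolding pairing_covariance[OF prob Xm d density_L2 kernels] g_eq by simp
  have var: "M.variance (wiener_pairing \<iota> M (X 1) x) = (norm x)\<^sup>2 + 2 * g\<^sub>2 [x, x]" for x
    using cov[of x x] unfolding covariance_def by (simp add: power2_eq_square dot_square_norm)
  have psd: "0 \<le> g\<^sub>2 [x, x]" for x
  proof -
    have "(norm x)\<^sup>2 \<le> M.variance (wiener_pairing \<iota> M (X 1) x)" using variance_ge by blast
    then show ?thesis unfolding var by simp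
  qed
  have trace: "(\<lambda>x. 2 * g\<^sub>2 [x, x]) summable_on B1"
  proof (rule summable_on_cong[THEN iffD1, OF _ tr])
    show "M.variance (wiener_pairing \<iota> M (X 1) e) - 1 = 2 * g\<^sub>2 [e, e]" if "e \<in> B1" for e
      unfolding var using B1 that by (simp add: orthonormal_basis_def)
  qed
  have entry: "(case p of (d, e) \<Rightarrow> (covariance M (wiener_pairing \<iota> M (X 1) d) (wiener_pairing \<iota> M (X 1) e)
      - (if d = e then 1 else 0))\<^sup>2) = 4 * (case p of (d, e) \<Rightarrow> (g\<^sub>2 [d, e])\<^sup>2)" if pB: "p \<in> B2 \<times> B2" for p
  proof -
    obtain x y where p: "p = (x, y)" "x \<in> B2" "y \<in> B2" using pB by blast
    show ?thesis unfolding p(1) prod.case cov orthonormal_basis_inner[OF B2 p(2,3)]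
      by (simp add: power_mult_distrib)
  qed
  have s4: "(\<lambda>p. 4 * (case p of (d, e) \<Rightarrow> (g\<^sub>2 [d, e])\<^sup>2)) summable_on B2 \<times> B2"
    by (rule summable_on_cong[THEN iffD1, OF entry hs_summable])
  have s1: "(\<lambda>(d, e). (g\<^sub>2 [d, e])\<^sup>2) summable_on B2 \<times> B2"
    using summable_on_cmult_right[OF s4, of "1/4"] by simp
  \<comment> \<open>The bound is given in the basis \<open>B2\<close>, while the norm of tensors is computed in \<open>some_basis\<close>.\<close>
  have "4 * tensor_inner 2 g\<^sub>2 g\<^sub>2 = infsum (\<lambda>p. 4 * (case p of (d, e) \<Rightarrow> (g\<^sub>2 [d, e])\<^sup>2)) (B2 \<times> B2)"
    unfolding Hilbert_Schmidt_norm_basis[OF basis B2 g g_sym s1, symmetric] by (rule infsum_cmult_right'[symmetric])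
  also have "\<dots> = (\<Sum>\<^sub>\<infinity>(d, e)\<in>B2 \<times> B2.
      (covariance M (wiener_pairing \<iota> M (X 1) d) (wiener_pairing \<iota> M (X 1) e) - (if d = e then 1 else 0))\<^sup>2)"
    by (rule infsum_cong[OF entry, symmetric])
  also have "\<dots> < 1" by (rule hs_lt)
  finally have lt: "tensor_inner 2 g\<^sub>2 g\<^sub>2 < 1 / 4" by simp
  have wt: "(\<lambda>k w. multiple_integral \<iota> \<mu> (2 * k) (tensor_power 2 g\<^sub>2 k) w / fact k) = wick_term g\<^sub>2"
    by (intro ext) (simp add: wick_term_def)
  show ?thesis unfolding wt
  proof (intro conjI allI impI)
    show "\<exists>\<xi>. L2_sums \<mu> (wick_term g\<^sub>2) \<xi>" by (rule wick_exponential_exists[OF g lt])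
    fix \<xi> assume \<xi>: "L2_sums \<mu> (wick_term g\<^sub>2) \<xi>"
    then show sq: "square_integrable \<mu> \<xi>" using L2_limD(2) unfolding L2_sums_def by blast
    obtain \<nu> where \<nu>: "has_density \<nu> \<mu> \<xi>" "prob_space \<nu>" "sets \<nu> = sets borel"
      and ch: "\<And>\<phi>. (CLINT w|\<nu>. iexp (blinfun_apply \<phi> w)) = complex_of_real (exp (- ((norm (J \<phi>))\<^sup>2 + 2 * g\<^sub>2 [J \<phi>, J \<phi>]) / 2))"
      using wick_exponential_density[OF g g_sym psd B1 trace \<xi>] by blast
    define s where "s \<phi> = (norm (J \<phi>))\<^sup>2 + 2 * g\<^sub>2 [J \<phi>, J \<phi>]" for \<phi>
    have s_nonneg: "0 \<le> s \<phi>" for \<phi> using psd[of "J \<phi>"] by (simp add: s_def)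
    have s_scale: "s (t *\<^sub>R \<phi>) = t\<^sup>2 * s \<phi>" for t \<phi>
      using linear_scale[OF tensor_space_2(1)[OF g]] linear_scale[OF tensor_space_2(2)[OF g]]
      unfolding s_def J_scaleR by (simp add: power_mult_distrib power2_eq_square distrib_left)
    note ch_s = ch[folded s_def]
    show "\<exists>\<nu>. has_density \<nu> \<mu> \<xi> \<and> gaussian_measure \<nu> \<and>
        (\<forall>h. (\<integral>w. iexp (wiener_pairing \<iota> \<mu> (\<lambda>w. w) h w) * complex_of_real (\<xi> w) \<partial>\<mu>)
              = complex_of_real (exp (- tensor_inner 2 g\<^sub>2 (pure_tensor [h, h]) - (norm h)\<^sup>2 / 2))) \<and>
        (\<forall>(M' :: 'b measure) (Y :: nat \<Rightarrow> 'b \<Rightarrow> 'w) n.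
          n \<ge> 1 \<longrightarrow> prob_space M' \<longrightarrow>
          prob_space.indep_vars M' (\<lambda>_. borel) Y {1..n} \<longrightarrow>
          (\<forall>i\<in>{1..n}. distr M' borel (Y i) = \<nu>) \<longrightarrow>
          distr M' borel (\<lambda>x. (\<Sum>i=1..n. Y i x) /\<^sub>R sqrt (real n)) = \<nu>)"
    proof (intro exI[of _ \<nu>] conjI allI impI \<nu>(1))
      show "gaussian_measure \<nu>"
        by (rule gaussian_measure_of_char[OF \<nu>(2,3) s_nonneg s_scale ch_s])
      show "(\<integral>w. iexp (wiener_pairing \<iota> \<mu> (\<lambda>w. w) h w) * complex_of_real (\<xi> w) \<partial>\<mu>)
          = complex_of_real (exp (- tensor_inner 2 g\<^sub>2 (pure_tensor [h, h]) - (norm h)\<^sup>2 / 2))" for h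
        unfolding tensor_reproducing[OF basis g, of "[h, h]", simplified]
        by (rule char_of_pairing[OF sq g wick_exponential_char[OF g \<xi>]])
      show "distr M' borel (\<lambda>x. (\<Sum>i=1..n. Y i x) /\<^sub>R sqrt (real n)) = \<nu>"
        if "n \<ge> 1" "prob_space M'" "prob_space.indep_vars M' (\<lambda>_. borel) Y {1..n}"
          "\<forall>i\<in>{1..n}. distr M' borel (Y i) = \<nu>" for M' :: "'b measure" and Y :: "nat \<Rightarrow> 'b \<Rightarrow> 'w" and n
        using that(4) by (intro stable_law_of_char[OF \<nu>(2,3) s_scale ch_s that(2,1,3)]) blast
    qed
  qed
qed

end
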